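(* Let $\mathbb{F}$ be a field of characteristic $0$, let $R=\mathbb{F}[u,v,w,x,y,z]$ be the polynomial ring in six indeterminates with the standard grading (all variables in degree $1$), let $\mathfrak{m}=(u,v,w,x,y,z)$, and let $I=(vz-wy,\ wx-uz,\ uy-vx)$ be the ideal generated by the size two minors of the matrix $\begin{bmatrix} u & v & w\\ x & y & z\end{bmatrix}$. Then for every integer $t\geq 2$, the degree-$0$ graded component $H^3_{\mathfrak{m}}(R/I^t)_0$ of the local cohomology module $H^3_{\mathfrak{m}}(R/I^t)$ is an $\mathbb{F}$-vector space of rank (dimension) $1$.
   Context: $H^k_{\mathfrak{m}}(M)$ denotes the $k$-th local cohomology module of a graded $R$-module $M$ supported at $\mathfrak{m}$, with its natural $\mathbb{Z}$-grading; $H^k_{\mathfrak{m}}(M)_j$ is its degree-$j$ component. *)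

theory Defs
  imports
    "HOL-Algebra.Algebraic_Closure_Type"
    "HOL-Algebra.Ideal_Product"
    "HOL-Algebra.Module"
    "HOL-Library.Poly_Mapping"
    "Jordan_Normal_Form.Missing_VectorSpace"
begin

section \<open>Modules: regular module, quotients, restriction of scalars\<close>

text \<open>The record type \<^typ>\<open>('r, 'm) module\<close> extends \<^typ>\<open>'m ring\<close>, but the locale
  \<^locale>\<open>module\<close> never looks at the fields \<open>mult\<close> and \<open>one\<close>. They are left
  \<^term>\<open>undefined\<close> wherever they carry no meaning.\<close>

definition regular_module :: "('r, 'b) ring_scheme \<Rightarrow> ('r, 'r) module" where
  "regular_module R =
     \<lparr>carrier = carrier R, monoid.mult = monoid.mult R, one = one R, zero = zero R, add = add R,
      module.smult = monoid.mult R\<rparr>"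

definition quotient_module :: "('r, 'm) module \<Rightarrow> 'm set \<Rightarrow> ('r, 'm set) module" where
  "quotient_module M N =
     \<lparr>carrier = a_rcosets\<^bsub>M\<^esub> N, monoid.mult = undefined, one = undefined, zero = N, add = set_add M,
      module.smult = (\<lambda>r P. \<Union>x\<in>P. N +>\<^bsub>M\<^esub> (r \<odot>\<^bsub>M\<^esub> x))\<rparr>"

text \<open>The subset \<open>W\<close> of the module \<open>M\<close> with scalars acting through \<open>\<phi>\<close>.\<close>

definition restrict_scalars :: "('k \<Rightarrow> 'r) \<Rightarrow> ('r, 'm) module \<Rightarrow> 'm set \<Rightarrow> ('k, 'm) module" where
  "restrict_scalars \<phi> M W =
     \<lparr>carrier = W, monoid.mult = undefined, one = undefined, zero = zero M, add = add M,
      module.smult = (\<lambda>c x. \<phi> c \<odot>\<^bsub>M\<^esub> x)\<rparr>"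


section \<open>Localization of a module at one element\<close>

text \<open>The pair \<open>(m, a)\<close> stands for the fraction \<open>m / f\<^sup>a\<close>.\<close>

definition loc_rel ::
  "('r, 'b) ring_scheme \<Rightarrow> ('r, 'm) module \<Rightarrow> 'r \<Rightarrow> (('m \<times> nat) \<times> ('m \<times> nat)) set" where
  "loc_rel R M f =
     {((m, a), (n, b)). m \<in> carrier M \<and> n \<in> carrier M \<and>
        (\<exists>c::nat. (f [^]\<^bsub>R\<^esub> c) \<odot>\<^bsub>M\<^esub> ((f [^]\<^bsub>R\<^esub> b) \<odot>\<^bsub>M\<^esub> m) =
                  (f [^]\<^bsub>R\<^esub> c) \<odot>\<^bsub>M\<^esub> ((f [^]\<^bsub>R\<^esub> a) \<odot>\<^bsub>M\<^esub> n))}"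

definition loc_frac ::
  "('r, 'b) ring_scheme \<Rightarrow> ('r, 'm) module \<Rightarrow> 'r \<Rightarrow> 'm \<Rightarrow> nat \<Rightarrow> ('m \<times> nat) set" where
  "loc_frac R M f m a = loc_rel R M f `` {(m, a)}"

definition localization ::
  "('r, 'b) ring_scheme \<Rightarrow> ('r, 'm) module \<Rightarrow> 'r \<Rightarrow> ('r, ('m \<times> nat) set) module" where
  "localization R M f =
     \<lparr>carrier = (carrier M \<times> UNIV) // loc_rel R M f,
      monoid.mult = undefined, one = undefined,
      zero = loc_frac R M f \<zero>\<^bsub>M\<^esub> 0,
      add = (\<lambda>P Q. \<Union>(m, a)\<in>P. \<Union>(n, b)\<in>Q.
               loc_frac R M f (((f [^]\<^bsub>R\<^esub> b) \<odot>\<^bsub>M\<^esub> m) \<oplus>\<^bsub>M\<^esub> ((f [^]\<^bsub>R\<^esub> a) \<odot>\<^bsub>M\<^esub> n)) (a + b)),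
      module.smult = (\<lambda>r P. \<Union>(m, a)\<in>P. loc_frac R M f (r \<odot>\<^bsub>M\<^esub> m) a)\<rparr>"

text \<open>The canonical map from \<open>M\<^sub>f\<close> to \<open>M\<^sub>h\<close> for \<open>h = f g\<close>, which sends \<open>m / f\<^sup>a\<close> to
  \<open>g\<^sup>a m / h\<^sup>a\<close>.\<close>

definition loc_map ::
  "('r, 'b) ring_scheme \<Rightarrow> ('r, 'm) module \<Rightarrow> 'r \<Rightarrow> 'r \<Rightarrow> ('m \<times> nat) set \<Rightarrow> ('m \<times> nat) set" where
  "loc_map R M f g P = (\<Union>(m, a)\<in>P. loc_frac R M (f \<otimes>\<^bsub>R\<^esub> g) ((g [^]\<^bsub>R\<^esub> a) \<odot>\<^bsub>M\<^esub> m) a)"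


section \<open>Graded local cohomology via the Cech complex\<close>

text \<open>A grading of a ring or module is the family of its homogeneous components, indexed by \<^typ>\<open>int\<close>.

  For a list \<open>xs\<close> of ring elements, the \<open>k\<close>-th term of the Cech complex of \<open>M\<close> is the direct sum
  of the localizations of \<open>M\<close> at the products of \<open>xs ! i\<close> for \<open>i\<close> in \<open>S\<close>, where \<open>S\<close> ranges over
  the \<open>k\<close>-element sets of positions in \<open>xs\<close>; the term in cohomological degree \<open>0\<close> is \<open>M\<close> itself
  (localized at \<open>1\<close>). Its cohomology is the local cohomology of \<open>M\<close> supported at the ideal
  generated by \<open>xs\<close>.\<close>

definition cech_index :: "'r list \<Rightarrow> nat \<Rightarrow> nat set set" where
  "cech_index xs k = {S. S \<subseteq> {..<length xs} \<and> card S = k}"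

definition cech_elt :: "('r, 'b) ring_scheme \<Rightarrow> 'r list \<Rightarrow> nat set \<Rightarrow> 'r" where
  "cech_elt R xs S = (\<Otimes>\<^bsub>R\<^esub>i\<in>S. xs ! i)"

definition cech_module ::
  "('r, 'b) ring_scheme \<Rightarrow> 'r list \<Rightarrow> ('r, 'm) module \<Rightarrow> nat
     \<Rightarrow> ('r, nat set \<Rightarrow> ('m \<times> nat) set) module" where
  "cech_module R xs M k =
     \<lparr>carrier = (\<Pi>\<^sub>E S\<in>cech_index xs k. carrier (localization R M (cech_elt R xs S))),
      monoid.mult = undefined, one = undefined,
      zero = (\<lambda>S\<in>cech_index xs k. \<zero>\<^bsub>localization R M (cech_elt R xs S)\<^esub>),
      add = (\<lambda>c d. \<lambda>S\<in>cech_index xs k. c S \<oplus>\<^bsub>localization R M (cech_elt R xs S)\<^esub> d S),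
      module.smult = (\<lambda>r c. \<lambda>S\<in>cech_index xs k. r \<odot>\<^bsub>localization R M (cech_elt R xs S)\<^esub> c S)\<rparr>"

text \<open>The sign of the component from \<open>T - {j}\<close> to \<open>T\<close> is \<open>(-1)\<^sup>p\<close>, where \<open>p\<close> is the number of
  elements of \<open>T\<close> below \<open>j\<close>.\<close>

definition cech_diff ::
  "('r, 'b) ring_scheme \<Rightarrow> 'r list \<Rightarrow> ('r, 'm) module \<Rightarrow> nat
     \<Rightarrow> (nat set \<Rightarrow> ('m \<times> nat) set) \<Rightarrow> (nat set \<Rightarrow> ('m \<times> nat) set)" where
  "cech_diff R xs M k c =
     (\<lambda>T\<in>cech_index xs (Suc k).
        \<Oplus>\<^bsub>localization R M (cech_elt R xs T)\<^esub>j\<in>T.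
          (let y = loc_map R M (cech_elt R xs (T - {j})) (xs ! j) (c (T - {j}))
           in if even (card {i\<in>T. i < j}) then y
              else \<ominus>\<^bsub>localization R M (cech_elt R xs T)\<^esub> y))"

definition cech_cocycles ::
  "('r, 'b) ring_scheme \<Rightarrow> 'r list \<Rightarrow> ('r, 'm) module \<Rightarrow> nat
     \<Rightarrow> (nat set \<Rightarrow> ('m \<times> nat) set) set" where
  "cech_cocycles R xs M k =
     {c \<in> carrier (cech_module R xs M k). cech_diff R xs M k c = \<zero>\<^bsub>cech_module R xs M (Suc k)\<^esub>}"

definition cech_coboundaries ::
  "('r, 'b) ring_scheme \<Rightarrow> 'r list \<Rightarrow> ('r, 'm) module \<Rightarrow> nat
     \<Rightarrow> (nat set \<Rightarrow> ('m \<times> nat) set) set" where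
  "cech_coboundaries R xs M k =
     (case k of 0 \<Rightarrow> {\<zero>\<^bsub>cech_module R xs M 0\<^esub>}
      | Suc l \<Rightarrow> cech_diff R xs M l ` carrier (cech_module R xs M l))"

definition local_cohomology ::
  "('r, 'b) ring_scheme \<Rightarrow> 'r list \<Rightarrow> ('r, 'm) module \<Rightarrow> nat
     \<Rightarrow> ('r, (nat set \<Rightarrow> ('m \<times> nat) set) set) module" where
  "local_cohomology R xs M k =
     quotient_module ((cech_module R xs M k)\<lparr>carrier := cech_cocycles R xs M k\<rparr>)
       (cech_coboundaries R xs M k)"

text \<open>Given gradings \<open>A\<close> of \<open>R\<close> and \<open>G\<close> of \<open>M\<close>, and \<open>f\<close> homogeneous, the component of \<open>M\<^sub>f\<close> of
  degree \<open>j\<close> consists of the fractions with homogeneous numerator and denominator whose degrees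
  differ by \<open>j\<close>.\<close>

definition loc_grading ::
  "('r, 'b) ring_scheme \<Rightarrow> (int \<Rightarrow> 'r set) \<Rightarrow> ('r, 'm) module \<Rightarrow> (int \<Rightarrow> 'm set) \<Rightarrow> 'r
     \<Rightarrow> int \<Rightarrow> ('m \<times> nat) set set" where
  "loc_grading R A M G f j =
     {loc_frac R M f m a | m a. \<exists>d. f [^]\<^bsub>R\<^esub> a \<in> A d \<and> m \<in> G (j + d)}"

definition cech_grading ::
  "('r, 'b) ring_scheme \<Rightarrow> (int \<Rightarrow> 'r set) \<Rightarrow> 'r list \<Rightarrow> ('r, 'm) module \<Rightarrow> (int \<Rightarrow> 'm set) \<Rightarrow> nat
     \<Rightarrow> int \<Rightarrow> (nat set \<Rightarrow> ('m \<times> nat) set) set" where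
  "cech_grading R A xs M G k j =
     (\<Pi>\<^sub>E S\<in>cech_index xs k. loc_grading R A M G (cech_elt R xs S) j)"

definition local_cohomology_grading ::
  "('r, 'b) ring_scheme \<Rightarrow> (int \<Rightarrow> 'r set) \<Rightarrow> 'r list \<Rightarrow> ('r, 'm) module \<Rightarrow> (int \<Rightarrow> 'm set) \<Rightarrow> nat
     \<Rightarrow> int \<Rightarrow> (nat set \<Rightarrow> ('m \<times> nat) set) set set" where
  "local_cohomology_grading R A xs M G k j =
     {cech_coboundaries R xs M k +>\<^bsub>cech_module R xs M k\<^esub> c | c.
        c \<in> cech_cocycles R xs M k \<inter> cech_grading R A xs M G k j}"


section \<open>The polynomial ring in six indeterminates and the ideal of minors\<close>

datatype indet = Var_u | Var_v | Var_w | Var_x | Var_y | Var_z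

type_synonym 'a poly6 = "(indet \<Rightarrow>\<^sub>0 nat) \<Rightarrow>\<^sub>0 'a"

abbreviation base_field :: "'a::field_char_0 ring" where
  "base_field \<equiv> ring_of_type_algebra"

abbreviation poly_ring :: "'a::field_char_0 poly6 ring" where
  "poly_ring \<equiv> ring_of_type_algebra"

definition const_poly :: "'a::field_char_0 \<Rightarrow> 'a poly6" where
  "const_poly c = Poly_Mapping.single 0 c"

definition var :: "indet \<Rightarrow> 'a::field_char_0 poly6" where
  "var i = Poly_Mapping.single (Poly_Mapping.single i 1) 1"

definition poly_grading :: "int \<Rightarrow> 'a::field_char_0 poly6 set" where
  "poly_grading j =
     {p. \<forall>\<mu>\<in>Poly_Mapping.keys p. int (\<Sum>i\<in>Poly_Mapping.keys \<mu>. Poly_Mapping.lookup \<mu> i) = j}"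

definition max_ideal_gens :: "'a::field_char_0 poly6 list" where
  "max_ideal_gens = [var Var_u, var Var_v, var Var_w, var Var_x, var Var_y, var Var_z]"

definition minors_ideal :: "'a::field_char_0 poly6 set" where
  "minors_ideal =
     genideal poly_ring
       {var Var_v * var Var_z - var Var_w * var Var_y,
        var Var_w * var Var_x - var Var_u * var Var_z,
        var Var_u * var Var_y - var Var_v * var Var_x}"

text \<open>\<open>R / I\<^sup>t\<close> with the grading induced from \<open>R\<close>; the power is taken in the semiring of ideals.\<close>

definition minors_power :: "nat \<Rightarrow> 'a::field_char_0 poly6 set" where
  "minors_power t = minors_ideal [^]\<^bsub>ideals_set poly_ring\<^esub> t"

definition thickening :: "nat \<Rightarrow> ('a::field_char_0 poly6, 'a poly6 set) module" where
  "thickening t = quotient_module (regular_module poly_ring) (minors_power t)"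

definition thickening_grading :: "nat \<Rightarrow> int \<Rightarrow> 'a::field_char_0 poly6 set set" where
  "thickening_grading t j = (\<lambda>p. minors_power t +>\<^bsub>poly_ring\<^esub> p) ` poly_grading j"

text \<open>The component of degree \<open>j\<close> of the \<open>k\<close>-th local cohomology of \<open>R / I\<^sup>t\<close> supported at the
  ideal of all indeterminates, as a vector space over the base field.\<close>

definition thickening_local_cohomology ::
  "nat \<Rightarrow> nat \<Rightarrow> int
     \<Rightarrow> ('a::field_char_0, (nat set \<Rightarrow> ('a poly6 set \<times> nat) set) set) module" where
  "thickening_local_cohomology t k j =
     restrict_scalars const_poly
       (local_cohomology poly_ring max_ideal_gens (thickening t) k)
       (local_cohomology_grading poly_ring poly_grading max_ideal_gens
          (thickening t) (thickening_grading t) k j)"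

end

theory Submission
  imports Defs
begin

text \<open>The ideal \<open>I\<close> is of linear type: with \<open>l\<^sub>1 = u T\<^sub>1 + v T\<^sub>2 + w T\<^sub>3\<close> and
  \<open>l\<^sub>2 = x T\<^sub>1 + y T\<^sub>2 + z T\<^sub>3\<close>, the substitution \<open>T\<^sub>i \<mapsto> \<Delta>\<^sub>i\<close> of the minors identifies
  \<open>R[T\<^sub>1, T\<^sub>2, T\<^sub>3] / (l\<^sub>1, l\<^sub>2)\<close> with the Rees algebra of \<open>I\<close>, and \<open>l\<^sub>1, l\<^sub>2\<close> is a regular sequence. The part of
  degree \<open>t\<close> of the Koszul complex on \<open>l\<^sub>1, l\<^sub>2\<close> is therefore a free resolution of \<open>I\<^sup>t\<close> of length two. The local
  cohomology of \<open>R\<close> is concentrated in degree six, so three connecting homomorphisms identify \<open>H\<^sup>3(R / I\<^sup>t)\<close> with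
  the elements of \<open>H\<^sup>6(R)[T]\<close> of degree \<open>t - 2\<close> in \<open>T\<close> that are killed by \<open>l\<^sub>1\<close> and \<open>l\<^sub>2\<close>.

  Since \<open>H\<^sup>6(R)\<close> consists of inverse polynomials, in characteristic zero such an element is a polynomial in
  the entries of the \<open>3 \<times> 3\<close> matrix with rows \<open>(u, v, w)\<close>, \<open>(x, y, z)\<close> and \<open>(T\<^sub>1, T\<^sub>2, T\<^sub>3)\<close> that is
  invariant under adding multiples of the last row to the other two. Degree zero means that it has degree
  \<open>2 (t - 2)\<close> in the first two rows together and \<open>t - 2\<close> in the last one. By the representation theory of
  \<open>sl\<^sub>2\<close> it is then invariant under all row operations of determinant one, hence a multiple of the
  \<open>(t - 2)\<close>-th power of the determinant.\<close>

section \<open>Laurent polynomials\<close>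

text \<open>All localizations of R[T] at products of the indeterminates are realised as subsets of
  one Laurent ring, which is a domain. The Cech maps become inclusions, a connecting homomorphism
  becomes a choice of preimages followed by an alternating sum, and congruence modulo I^t becomes
  membership in an image of \<open>ev\<close>. The price is that exactness has to hold inside each
  subset: denominators are cleared before a divisibility argument, and valuations and degrees show
  that the cofactors lie in the right localization.

  The degree count comes from giving each T_i the weight 2 of a minor. Then l_1 and l_2 have weight
  3, and degree 0 on R / I^t corresponds to weight 0 - 3 - 3 = -6 in H^6(R)[T]. An inverse monomial
  with exponents -1 - A has degree -6 - |A|, which is why |A| = 2 (t - 2).

  Characteristic zero makes the factorials A! invertible, which turn multiplication by an
  indeterminate into differentiation, and it keeps the integers in the sl_2 argument from
  vanishing.\<close>

abbreviation lk :: "('e \<Rightarrow>\<^sub>0 'a::zero) \<Rightarrow> 'e \<Rightarrow> 'a" where "lk \<equiv> Poly_Mapping.lookup"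
abbreviation sg :: "'e \<Rightarrow> 'a \<Rightarrow> ('e \<Rightarrow>\<^sub>0 'a::zero)" where "sg \<equiv> Poly_Mapping.single"
abbreviation ks :: "('e \<Rightarrow>\<^sub>0 'a::zero) \<Rightarrow> 'e set" where "ks \<equiv> Poly_Mapping.keys"

lemma sum_single_superset:
  fixes p :: "'e \<Rightarrow>\<^sub>0 'a::comm_monoid_add"
  assumes "finite A" "ks p \<subseteq> A"
  shows "(\<Sum>\<mu>\<in>A. sg \<mu> (lk p \<mu>)) = p"
proof (rule poly_mapping_eqI)
  fix k
  have "lk (\<Sum>\<mu>\<in>A. sg \<mu> (lk p \<mu>)) k = (\<Sum>\<mu>\<in>A. if \<mu> = k then lk p k else 0)"
    by (auto simp: lookup_sum lookup_single when_def intro!: sum.cong)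
  also have "\<dots> = lk p k"
    using assms by (auto simp: sum.delta in_keys_iff)
  finally show "lk (\<Sum>\<mu>\<in>A. sg \<mu> (lk p \<mu>)) k = lk p k" .
qed

lemma sum_single_keys: "(\<Sum>\<mu>\<in>ks p. sg \<mu> (lk p \<mu>)) = (p :: 'e \<Rightarrow>\<^sub>0 'a::comm_monoid_add)"
  by (rule sum_single_superset) auto

lemma lookup_single_times:
  fixes p :: "'e::ab_group_add \<Rightarrow>\<^sub>0 'a::comm_ring_1"
  shows "lk (sg \<mu> c * p) \<nu> = c * lk p (\<nu> - \<mu>)"
proof -
  have "lk (sg \<mu> c * p) \<nu> = lk (\<Sum>\<kappa>\<in>ks p. sg (\<mu> + \<kappa>) (c * lk p \<kappa>)) \<nu>"
    by (subst sum_single_keys[of p, symmetric])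
       (simp add: sum_distrib_left mult_single)
  also have "\<dots> = (\<Sum>\<kappa>\<in>ks p. if \<kappa> = \<nu> - \<mu> then c * lk p (\<nu> - \<mu>) else 0)"
    by (auto simp: lookup_sum lookup_single when_def algebra_simps intro!: sum.cong)
  also have "\<dots> = c * lk p (\<nu> - \<mu>)"
    by (auto simp: sum.delta in_keys_iff)
  finally show ?thesis .
qed

lemma keys_single_times:
  fixes p :: "'e::ab_group_add \<Rightarrow>\<^sub>0 'a::comm_ring_1"
  shows "ks (sg \<mu> 1 * p) = (+) \<mu> ` ks p"
  by (auto simp: in_keys_iff lookup_single_times image_iff intro!: bexI[of _ "_ - \<mu>"])

subsection \<open>Ring homomorphisms out of monoid algebras\<close>

definition pm_lift ::
  "('e \<Rightarrow> ('f::comm_monoid_add \<Rightarrow>\<^sub>0 'a::comm_ring_1)) \<Rightarrow> ('e \<Rightarrow>\<^sub>0 'a) \<Rightarrow> ('f \<Rightarrow>\<^sub>0 'a)" where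
  "pm_lift \<phi> p = (\<Sum>\<mu>\<in>ks p. sg 0 (lk p \<mu>) * \<phi> \<mu>)"

lemma pm_lift_superset:
  "finite A \<Longrightarrow> ks p \<subseteq> A \<Longrightarrow> pm_lift \<phi> p = (\<Sum>\<mu>\<in>A. sg 0 (lk p \<mu>) * \<phi> \<mu>)"
  unfolding pm_lift_def by (rule sum.mono_neutral_left) (auto simp: in_keys_iff)

lemma pm_lift_zero [simp]: "pm_lift \<phi> 0 = 0"
  by (simp add: pm_lift_def)

lemma pm_lift_single [simp]: "pm_lift \<phi> (sg \<mu> c) = sg 0 c * \<phi> \<mu>"
  by (simp add: pm_lift_superset[of "{\<mu>}"])

lemma pm_lift_add: "pm_lift \<phi> (p + q) = pm_lift \<phi> p + pm_lift \<phi> q"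
proof -
  have "ks (p + q) \<subseteq> ks p \<union> ks q" by (rule keys_add)
  then show ?thesis
    by (simp add: pm_lift_superset[of "ks p \<union> ks q"] lookup_add single_add
        algebra_simps sum.distrib)
qed

lemma pm_lift_sum: "pm_lift \<phi> (sum f A) = (\<Sum>i\<in>A. pm_lift \<phi> (f i))"
  by (induction A rule: infinite_finite_induct) (auto simp: pm_lift_add)

lemma pm_lift_uminus: "pm_lift \<phi> (- p) = - pm_lift \<phi> p"
  using pm_lift_add[of \<phi> p "- p"] by (simp add: eq_neg_iff_add_eq_0 add.commute)

lemma pm_lift_diff: "pm_lift \<phi> (p - q) = pm_lift \<phi> p - pm_lift \<phi> q"
  using pm_lift_add[of \<phi> p "- q"] by (simp add: pm_lift_uminus)

text \<open>Multiplicativity of \<open>\<phi>\<close> is asked on the two supports only, because a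
  substitution with truncated exponents, as in \<open>subst\<close>, respects products of
  nonnegative powers only.\<close>

lemma pm_lift_mult:
  fixes p q :: "'e::comm_monoid_add \<Rightarrow>\<^sub>0 'a::comm_ring_1"
    and \<phi> :: "'e \<Rightarrow> ('f::comm_monoid_add \<Rightarrow>\<^sub>0 'a)"
  assumes "\<And>\<mu> \<nu>. \<mu> \<in> ks p \<Longrightarrow> \<nu> \<in> ks q \<Longrightarrow> \<phi> (\<mu> + \<nu>) = \<phi> \<mu> * \<phi> \<nu>"
  shows "pm_lift \<phi> (p * q) = pm_lift \<phi> p * pm_lift \<phi> q"
proof -
  have "pm_lift \<phi> (p * q) =
      pm_lift \<phi> (\<Sum>\<mu>\<in>ks p. \<Sum>\<nu>\<in>ks q. sg \<mu> (lk p \<mu>) * sg \<nu> (lk q \<nu>))"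
    by (simp only: sum_product[symmetric] sum_single_keys)
  also have "\<dots> = (\<Sum>\<mu>\<in>ks p. \<Sum>\<nu>\<in>ks q. sg 0 (lk p \<mu> * lk q \<nu>) * \<phi> (\<mu> + \<nu>))"
    by (simp add: pm_lift_sum mult_single)
  also have "\<dots> = (\<Sum>\<mu>\<in>ks p. \<Sum>\<nu>\<in>ks q. (sg 0 (lk p \<mu>) * \<phi> \<mu>) * (sg 0 (lk q \<nu>) * \<phi> \<nu>))"
  proof (intro sum.cong refl)
    fix \<mu> \<nu> assume "\<mu> \<in> ks p" "\<nu> \<in> ks q"
    have "sg 0 (lk p \<mu> * lk q \<nu>) = sg 0 (lk p \<mu>) * sg (0::'f) (lk q \<nu>)"
      by (simp add: mult_single)
    with assms[OF \<open>\<mu> \<in> ks p\<close> \<open>\<nu> \<in> ks q\<close>]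
    show "sg 0 (lk p \<mu> * lk q \<nu>) * \<phi> (\<mu> + \<nu>) = (sg 0 (lk p \<mu>) * \<phi> \<mu>) * (sg 0 (lk q \<nu>) * \<phi> \<nu>)"
      by (simp add: mult_ac)
  qed
  also have "\<dots> = pm_lift \<phi> p * pm_lift \<phi> q"
    by (simp add: pm_lift_def sum_product)
  finally show ?thesis .
qed

subsection \<open>Restriction to a set of monomials\<close>

lift_definition restr :: "('e \<Rightarrow> bool) \<Rightarrow> ('e \<Rightarrow>\<^sub>0 'a::zero) \<Rightarrow> ('e \<Rightarrow>\<^sub>0 'a)"
  is "\<lambda>P f k. if P k then f k else 0"
  by (rule finite_subset) auto

lemma lookup_restr: "lk (restr P p) k = (if P k then lk p k else 0)"
  by transfer simp

lemma keys_restr: "ks (restr P p) = {k \<in> ks p. P k}"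
  by (auto simp: in_keys_iff lookup_restr split: if_splits)

lemma restr_add: "restr P (p + q) = restr P p + restr P (q :: 'e \<Rightarrow>\<^sub>0 'a::comm_monoid_add)"
  by (rule poly_mapping_eqI) (simp add: lookup_restr lookup_add)

lemma restr_diff: "restr P (p - q) = restr P p - restr P (q :: 'e \<Rightarrow>\<^sub>0 'a::ab_group_add)"
  by (rule poly_mapping_eqI) (simp add: lookup_restr lookup_minus)

lemma restr_uminus: "restr P (- p) = - restr P (p :: 'e \<Rightarrow>\<^sub>0 'a::ab_group_add)"
  by (rule poly_mapping_eqI) (simp add: lookup_restr)

lemma restr_zero [simp]: "restr P 0 = 0"
  by (rule poly_mapping_eqI) (simp add: lookup_restr)

lemma restr_sum: "restr P (sum f A) = (\<Sum>i\<in>A. restr P (f i :: 'e \<Rightarrow>\<^sub>0 'a::comm_monoid_add))"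
  by (induction A rule: infinite_finite_induct) (auto simp: restr_add)

lemma restr_all: "(\<And>k. k \<in> ks p \<Longrightarrow> P k) \<Longrightarrow> restr P p = p"
  by (rule poly_mapping_eqI) (auto simp: lookup_restr in_keys_iff)

lemma restr_none: "(\<And>k. k \<in> ks p \<Longrightarrow> \<not> P k) \<Longrightarrow> restr P p = 0"
  by (rule poly_mapping_eqI) (auto simp: lookup_restr in_keys_iff)

lemma restr_split: "p = restr P p + restr (\<lambda>k. \<not> P k) (p :: 'e \<Rightarrow>\<^sub>0 'a::comm_monoid_add)"
  by (rule poly_mapping_eqI) (auto simp: lookup_restr lookup_add)

lemma keys_timesE:
  assumes "k \<in> ks (p * q)"
  obtains a b where "a \<in> ks p" "b \<in> ks q" "k = a + b"
  using keys_mult[of p q] assms by blast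

lemma restr_times_homogeneous:
  fixes w :: "'e::comm_monoid_add \<Rightarrow> int" and l p :: "'e \<Rightarrow>\<^sub>0 'a::comm_ring_1"
  assumes w: "\<And>\<mu> \<nu>. w (\<mu> + \<nu>) = w \<mu> + w \<nu>"
    and l: "\<And>\<mu>. \<mu> \<in> ks l \<Longrightarrow> w \<mu> = b"
  shows "restr (\<lambda>\<mu>. w \<mu> = d) (l * p) = l * restr (\<lambda>\<mu>. w \<mu> = d - b) p"
proof -
  let ?P = "\<lambda>\<mu>. w \<mu> = d - b"
  have "restr (\<lambda>\<mu>. w \<mu> = d) (l * p) =
      restr (\<lambda>\<mu>. w \<mu> = d) (l * restr ?P p) + restr (\<lambda>\<mu>. w \<mu> = d) (l * restr (\<lambda>k. \<not> ?P k) p)"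
    by (subst restr_split[of p ?P]) (simp add: algebra_simps restr_add)
  also have "restr (\<lambda>\<mu>. w \<mu> = d) (l * restr ?P p) = l * restr ?P p"
    by (rule restr_all) (auto elim!: keys_timesE simp: keys_restr w l)
  also have "restr (\<lambda>\<mu>. w \<mu> = d) (l * restr (\<lambda>k. \<not> ?P k) p) = 0"
    by (rule restr_none) (auto elim!: keys_timesE simp: keys_restr w l)
  finally show ?thesis by simp
qed

text \<open>Initial forms multiply: every other product of homogeneous parts has weight above
  \<open>a + b\<close>. As \<open>a\<close> and \<open>b\<close> are only lower bounds, the
  restricted parts may be zero.\<close>

lemma restr_times_lowest:
  fixes w :: "'e::comm_monoid_add \<Rightarrow> int" and l p :: "'e \<Rightarrow>\<^sub>0 'a::comm_ring_1"
  assumes w: "\<And>\<mu> \<nu>. w (\<mu> + \<nu>) = w \<mu> + w \<nu>"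
    and l: "\<And>\<mu>. \<mu> \<in> ks l \<Longrightarrow> a \<le> w \<mu>" and p: "\<And>\<mu>. \<mu> \<in> ks p \<Longrightarrow> b \<le> w \<mu>"
  shows "restr (\<lambda>\<mu>. w \<mu> = a + b) (l * p) = restr (\<lambda>\<mu>. w \<mu> = a) l * restr (\<lambda>\<mu>. w \<mu> = b) p"
proof -
  let ?l1 = "restr (\<lambda>\<mu>. w \<mu> = a) l" and ?l2 = "restr (\<lambda>\<mu>. \<not> w \<mu> = a) l"
  let ?p1 = "restr (\<lambda>\<mu>. w \<mu> = b) p" and ?p2 = "restr (\<lambda>\<mu>. \<not> w \<mu> = b) p"
  have "l * p = ?l1 * ?p1 + (?l1 * ?p2 + ?l2 * p)"
  proof -
    have "l * p = (?l1 + ?l2) * p" using restr_split[of l "\<lambda>\<mu>. w \<mu> = a"] by simp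
    also have "\<dots> = ?l1 * (?p1 + ?p2) + ?l2 * p"
      using restr_split[of p "\<lambda>\<mu>. w \<mu> = b"] by (simp add: distrib_right)
    finally show ?thesis by (simp add: distrib_left add.assoc)
  qed
  moreover have "restr (\<lambda>\<mu>. w \<mu> = a + b) (?l1 * ?p1) = ?l1 * ?p1"
    by (rule restr_all) (auto elim!: keys_timesE simp: keys_restr w)
  moreover have "restr (\<lambda>\<mu>. w \<mu> = a + b) (?l1 * ?p2) = 0"
  proof (rule restr_none)
    fix k assume "k \<in> ks (?l1 * ?p2)"
    then obtain x y where "w x = a" "y \<in> ks p" "w y \<noteq> b" "k = x + y"
      by (auto elim!: keys_timesE simp: keys_restr)
    with p[of y] show "w k \<noteq> a + b" by (simp add: w)
  qed
  moreover have "restr (\<lambda>\<mu>. w \<mu> = a + b) (?l2 * p) = 0"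
  proof (rule restr_none)
    fix k assume "k \<in> ks (?l2 * p)"
    then obtain x y where "x \<in> ks l" "w x \<noteq> a" "y \<in> ks p" "k = x + y"
      by (auto elim!: keys_timesE simp: keys_restr)
    with p[of y] l[of x] show "w k \<noteq> a + b" by (simp add: w)
  qed
  ultimately show ?thesis by (simp add: restr_add)
qed

lemma restr_eq_zero_iff: "restr P p = 0 \<longleftrightarrow> (\<forall>k\<in>ks p. \<not> P k)"
  by (auto simp: poly_mapping_eq_iff lookup_restr in_keys_iff fun_eq_iff)

text \<open>Linearly ordered exponents and field coefficients exclude zero divisors, so the parts of
  lowest weight have a nonzero product. A negative lowest weight of \<open>p\<close> would therefore
  reappear in \<open>l * p\<close>, as \<open>l\<close> has a nonzero part of weight zero.\<close>

lemma cofactor_valuation: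
  fixes w :: "'e::{ordered_cancel_comm_monoid_add, linorder} \<Rightarrow> int" and l p :: "'e \<Rightarrow>\<^sub>0 'a::field"
  assumes w: "\<And>\<mu> \<nu>. w (\<mu> + \<nu>) = w \<mu> + w \<nu>"
    and l: "\<And>\<mu>. \<mu> \<in> ks l \<Longrightarrow> 0 \<le> w \<mu>" and l0: "\<nu> \<in> ks l" "w \<nu> = 0"
    and lp: "\<And>\<mu>. \<mu> \<in> ks (l * p) \<Longrightarrow> 0 \<le> w \<mu>"
    and \<mu>: "\<mu> \<in> ks p"
  shows "0 \<le> w \<mu>"
proof (rule ccontr)
  assume neg: "\<not> 0 \<le> w \<mu>"
  define e where "e = Min (w ` ks p)"
  have fin: "finite (w ` ks p)" by simp
  have e1: "e \<le> w \<kappa>" if "\<kappa> \<in> ks p" for \<kappa>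
    unfolding e_def using fin that by (intro Min_le) auto
  have "e \<in> w ` ks p" unfolding e_def using fin \<mu> by (intro Min_in) auto
  then obtain \<kappa> where \<kappa>: "\<kappa> \<in> ks p" "w \<kappa> = e" by auto
  have "e < 0" using e1[OF \<mu>] neg by simp
  have "restr (\<lambda>\<mu>. w \<mu> = 0 + e) (l * p) = restr (\<lambda>\<mu>. w \<mu> = 0) l * restr (\<lambda>\<mu>. w \<mu> = e) p"
    by (rule restr_times_lowest[OF w]) (auto simp: l e1)
  moreover have "restr (\<lambda>\<mu>. w \<mu> = 0) l \<noteq> 0" using l0 by (auto simp: restr_eq_zero_iff)
  moreover have "restr (\<lambda>\<mu>. w \<mu> = e) p \<noteq> 0" using \<kappa> by (auto simp: restr_eq_zero_iff)
  moreover have "restr (\<lambda>\<mu>. w \<mu> = 0 + e) (l * p) = 0"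
    using lp \<open>e < 0\<close> by (force simp: restr_eq_zero_iff)
  ultimately show False by simp
qed

text \<open>Replacing \<open>p\<close> by its part of weight \<open>d - b\<close> does not change
  \<open>l * p\<close>, and \<open>l\<close> can be cancelled.\<close>

lemma cofactor_homogeneous:
  fixes w :: "'e::{ordered_cancel_comm_monoid_add, linorder} \<Rightarrow> int" and l p :: "'e \<Rightarrow>\<^sub>0 'a::field"
  assumes w: "\<And>\<mu> \<nu>. w (\<mu> + \<nu>) = w \<mu> + w \<nu>"
    and l: "\<And>\<mu>. \<mu> \<in> ks l \<Longrightarrow> w \<mu> = b" "l \<noteq> 0"
    and lp: "\<And>\<mu>. \<mu> \<in> ks (l * p) \<Longrightarrow> w \<mu> = d"
    and \<mu>: "\<mu> \<in> ks p"
  shows "w \<mu> = d - b"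
proof -
  have "l * p = restr (\<lambda>\<mu>. w \<mu> = d) (l * p)"
    by (rule restr_all[symmetric]) (rule lp)
  also have "\<dots> = l * restr (\<lambda>\<mu>. w \<mu> = d - b) p"
    by (rule restr_times_homogeneous[OF w l(1)])
  finally have "p = restr (\<lambda>\<mu>. w \<mu> = d - b) p" using l(2) by simp
  with \<mu> have "\<mu> \<in> ks (restr (\<lambda>\<mu>. w \<mu> = d - b) p)" by simp
  then show ?thesis by (simp add: keys_restr)
qed

text \<open>The indices \<open>0, \<dots>, 5\<close> stand for \<open>u, v, w, x, y, z\<close>, the order of \<^const>\<open>max_ideal_gens\<close>, and
  \<open>6, 7, 8\<close> for the variables \<open>T\<^sub>1, T\<^sub>2, T\<^sub>3\<close> of the Rees algebra.\<close>

type_synonym 'a laur = "(nat \<Rightarrow>\<^sub>0 int) \<Rightarrow>\<^sub>0 'a"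

section \<open>Laurent monomials and denominators\<close>

definition xvar :: "nat \<Rightarrow> 'a::field laur" where "xvar i = sg (sg i 1) 1"
definition xvar_inv :: "nat \<Rightarrow> 'a::field laur" where "xvar_inv i = sg (sg i (-1)) 1"

lemma xvar_inverse [simp]: "xvar i * xvar_inv i = 1" "xvar_inv i * xvar i = 1"
  by (simp_all add: xvar_def xvar_inv_def mult_single flip: single_add)

definition xpow :: "nat set \<Rightarrow> int \<Rightarrow> 'a::field laur" where
  "xpow S n = sg (\<Sum>i\<in>S. sg i n) 1"

lemma xpow_add: "xpow S (m + n) = xpow S m * xpow S n"
  by (simp add: xpow_def mult_single single_add sum.distrib)

lemma xpow_0 [simp]: "xpow S 0 = 1"
  by (simp add: xpow_def)

lemma xpow_inverse [simp]: "xpow S n * xpow S (- n) = 1" "xpow S (- n) * xpow S n = 1"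
  by (simp_all flip: xpow_add)

lemma xpow_nz [simp]: "xpow S n \<noteq> 0"
  by (metis xpow_inverse(1) mult_zero_left zero_neq_one)

lemma lookup_sum_single: "finite S \<Longrightarrow> lk (\<Sum>i\<in>S. sg i (n::int)) j = (if j \<in> S then n else 0)"
  by (simp add: lookup_sum lookup_single when_def)

text \<open>\<open>nn\<close> for nonnegative: \<open>p\<close> lies in the polynomial ring
  localized at the variables in \<open>S\<close>, seen inside the Laurent ring.\<close>

definition nn :: "nat set \<Rightarrow> 'a::field laur \<Rightarrow> bool" where
  "nn S p \<longleftrightarrow> (\<forall>\<mu>\<in>ks p. \<forall>i. i \<notin> S \<longrightarrow> 0 \<le> lk \<mu> i)"

lemma nnD: "nn S p \<Longrightarrow> \<mu> \<in> ks p \<Longrightarrow> i \<notin> S \<Longrightarrow> 0 \<le> lk \<mu> i"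
  by (simp add: nn_def)

lemma nn_add: "nn S p \<Longrightarrow> nn S q \<Longrightarrow> nn S (p + q)"
  unfolding nn_def using keys_add[of p q] by blast

lemma nn_uminus: "nn S p \<Longrightarrow> nn S (- p)"
  unfolding nn_def by (simp add: in_keys_iff)

lemma nn_diff: "nn S p \<Longrightarrow> nn S q \<Longrightarrow> nn S (p - q)"
  using nn_add[of S p "- q"] nn_uminus[of S q] by simp

lemma nn_mult: "nn S p \<Longrightarrow> nn S q \<Longrightarrow> nn S (p * q)"
  unfolding nn_def by (auto elim!: keys_timesE simp: lookup_add)

lemma nn_zero: "nn S 0" by (simp add: nn_def)

lemma nn_single: "(\<And>i. i \<notin> S \<Longrightarrow> 0 \<le> lk \<mu> i) \<Longrightarrow> nn S (sg \<mu> a)"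
  by (simp add: nn_def)

lemma nn_one: "nn S 1"
  by (simp add: nn_def)

lemma nn_xvar: "nn S (xvar i)"
  by (auto simp: xvar_def lookup_single when_def intro!: nn_single)

lemma nn_xvar_inv: "i \<in> S \<Longrightarrow> nn S (xvar_inv i)"
  by (auto simp: xvar_inv_def lookup_single when_def intro!: nn_single)

lemma nn_sum: "(\<And>i. i \<in> A \<Longrightarrow> nn S (f i)) \<Longrightarrow> nn S (sum f A)"
  by (induction A rule: infinite_finite_induct) (auto intro: nn_add nn_zero)

lemma nn_power: "nn S p \<Longrightarrow> nn S (p ^ n)"
  by (induction n) (auto intro: nn_mult nn_one)

lemma nn_prod: "(\<And>i. i \<in> A \<Longrightarrow> nn S (f i)) \<Longrightarrow> nn S (prod f A)"
  by (induction A rule: infinite_finite_induct) (auto intro: nn_mult nn_one)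

lemma nn_xpow_nonneg: "finite S \<Longrightarrow> 0 \<le> n \<Longrightarrow> nn T (xpow S n)"
  unfolding xpow_def by (rule nn_single) (simp add: lookup_sum_single)

lemma nn_mono: "nn S p \<Longrightarrow> S \<subseteq> T \<Longrightarrow> nn T p"
  by (auto simp: nn_def)

lemmas nn_intros = nn_add nn_uminus nn_diff nn_mult nn_zero nn_one nn_xvar nn_sum nn_power nn_prod

lemma clear_denominators:
  assumes "finite S" "nn (S \<union> T) p"
  shows "\<exists>N::nat. nn T (xpow S (int N) * p)"
proof -
  \<comment> \<open>The largest pole order along the variables in \<open>S\<close>; inserting 0
    keeps the set nonempty when \<open>p = 0\<close> or \<open>S\<close> is empty.\<close>
  define N where "N = Max (insert 0 ((\<lambda>(\<mu>, i). nat (- lk \<mu> i)) ` (ks p \<times> S)))"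
  have N: "- lk \<mu> i \<le> int N" if "\<mu> \<in> ks p" "i \<in> S" for \<mu> i
  proof -
    have "nat (- lk \<mu> i) \<le> N"
      unfolding N_def using assms(1) that by (intro Max_ge) force+
    then show ?thesis by simp
  qed
  have "nn T (xpow S (int N) * p)"
    unfolding nn_def
  proof (intro ballI allI impI)
    fix \<nu> i assume "\<nu> \<in> ks (xpow S (int N) * p)" "i \<notin> T"
    then obtain \<mu> where \<mu>: "\<mu> \<in> ks p" "\<nu> = (\<Sum>i\<in>S. sg i (int N)) + \<mu>"
      unfolding xpow_def keys_single_times by auto
    then have "lk \<nu> i = (if i \<in> S then int N else 0) + lk \<mu> i"
      using assms(1) by (simp add: lookup_add lookup_sum_single)
    then show "0 \<le> lk \<nu> i"
      using N[OF \<mu>(1), of i] assms(2) \<mu>(1) \<open>i \<notin> T\<close> by (auto simp: nn_def)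
  qed
  then show ?thesis ..
qed

subsection \<open>Substitution\<close>

text \<open>\<open>nat\<close> truncates negative exponents, so products are respected only for
  elements without negative powers of the variables in \<open>N\<close>, that is under
  \<open>nn (- N)\<close>. The remaining variables may have exponents of any sign.\<close>

definition subst :: "nat set \<Rightarrow> (nat \<Rightarrow> 'a::field laur) \<Rightarrow> 'a laur \<Rightarrow> 'a laur" where
  "subst N f = pm_lift (\<lambda>\<mu>. sg (restr (\<lambda>i. i \<notin> N) \<mu>) 1 * (\<Prod>i\<in>N. f i ^ nat (lk \<mu> i)))"

lemma subst_zero [simp]: "subst N f 0 = 0" by (simp add: subst_def)
lemma subst_add: "subst N f (p + q) = subst N f p + subst N f q" by (simp add: subst_def pm_lift_add)
lemma subst_diff: "subst N f (p - q) = subst N f p - subst N f q" by (simp add: subst_def pm_lift_diff)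
lemma subst_uminus: "subst N f (- p) = - subst N f p" by (simp add: subst_def pm_lift_uminus)
lemma subst_sum: "subst N f (sum g A) = (\<Sum>i\<in>A. subst N f (g i))" by (simp add: subst_def pm_lift_sum)

lemma subst_mult:
  assumes "nn (- N) p" "nn (- N) q"
  shows "subst N f (p * q) = subst N f p * subst N f q"
  unfolding subst_def
proof (rule pm_lift_mult)
  fix \<mu> \<nu> assume \<mu>: "\<mu> \<in> ks p" and \<nu>: "\<nu> \<in> ks q"
  have "(\<Prod>i\<in>N. f i ^ nat (lk (\<mu> + \<nu>) i)) = (\<Prod>i\<in>N. f i ^ nat (lk \<mu> i) * f i ^ nat (lk \<nu> i))"
    using assms \<mu> \<nu>
    by (intro prod.cong refl) (simp add: nn_def lookup_add nat_add_distrib power_add)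
  then show "sg (restr (\<lambda>i. i \<notin> N) (\<mu> + \<nu>)) 1 * (\<Prod>i\<in>N. f i ^ nat (lk (\<mu> + \<nu>) i)) =
       (sg (restr (\<lambda>i. i \<notin> N) \<mu>) 1 * (\<Prod>i\<in>N. f i ^ nat (lk \<mu> i))) *
       (sg (restr (\<lambda>i. i \<notin> N) \<nu>) 1 * (\<Prod>i\<in>N. f i ^ nat (lk \<nu> i)))"
    by (simp add: restr_add prod.distrib mult_single[of _ "1::'a" _ "1::'a", simplified, symmetric]
        mult_ac)
qed

lemma subst_single:
  "subst N f (sg \<mu> a) = sg (restr (\<lambda>i. i \<notin> N) \<mu>) a * (\<Prod>i\<in>N. f i ^ nat (lk \<mu> i))"
  by (simp add: subst_def mult_single mult.assoc[symmetric])

lemma subst_expand: "subst N f p = (\<Sum>\<mu>\<in>ks p. subst N f (sg \<mu> (lk p \<mu>)))"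
  by (subst sum_single_keys[of p, symmetric]) (simp only: subst_sum)

lemma subst_free:
  assumes "\<And>\<mu> i. \<mu> \<in> ks p \<Longrightarrow> i \<in> N \<Longrightarrow> lk \<mu> i = 0"
  shows "subst N f p = p"
proof -
  have "subst N f p = (\<Sum>\<mu>\<in>ks p. subst N f (sg \<mu> (lk p \<mu>)))"
    by (rule subst_expand)
  also have "\<dots> = (\<Sum>\<mu>\<in>ks p. sg \<mu> (lk p \<mu>))"
  proof (rule sum.cong[OF refl])
    fix \<mu> assume \<mu>: "\<mu> \<in> ks p"
    have "restr (\<lambda>i. i \<notin> N) \<mu> = \<mu>" using assms[OF \<mu>] by (intro restr_all) (auto simp: in_keys_iff)
    moreover have "(\<Prod>i\<in>N. f i ^ nat (lk \<mu> i)) = 1" using assms[OF \<mu>] by (intro prod.neutral) auto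
    ultimately show "subst N f (sg \<mu> (lk p \<mu>)) = sg \<mu> (lk p \<mu>)" by (simp add: subst_single)
  qed
  finally show ?thesis by (simp add: sum_single_keys)
qed

lemma subst_xvar: "finite N \<Longrightarrow> subst N f (xvar i) = (if i \<in> N then f i else xvar i)"
proof (cases "i \<in> N")
  case True
  assume N: "finite N"
  have "restr (\<lambda>i. i \<notin> N) (sg i (1::int)) = 0"
    using True by (intro restr_none) auto
  moreover have "(\<Prod>j\<in>N. f j ^ nat (lk (sg i 1) j)) = (\<Prod>j\<in>N. if j = i then f i else 1)"
    by (intro prod.cong) (auto simp: lookup_single when_def)
  ultimately show ?thesis using True N by (simp add: xvar_def subst_single prod.delta)
qed (auto simp: xvar_def lookup_single when_def intro!: subst_free)

lemma subst_power: "nn (- N) p \<Longrightarrow> subst N f (p ^ n) = subst N f p ^ n"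
proof (induction n)
  case 0
  show ?case by (simp, rule subst_free) auto
next
  case (Suc n)
  then show ?case by (simp add: subst_mult nn_power)
qed

text \<open>One factor is exchanged at a time by
  \<open>A * B - A' * B' = (A - A') * B + A' * (B - B')\<close>; the geometric sum \<open>e\<close>
  is the quotient of a difference of powers by the difference of the bases.\<close>

lemma prod_power_diff:
  fixes x y :: "nat \<Rightarrow> 'a::field laur"
  assumes "finite N" "\<And>i. i \<in> N \<Longrightarrow> nn S (x i) \<and> nn S (y i)"
  shows "\<exists>c. (\<Prod>i\<in>N. x i ^ n i) - (\<Prod>i\<in>N. y i ^ n i) = (\<Sum>i\<in>N. (x i - y i) * c i) \<and> (\<forall>i\<in>N. nn S (c i))"
  using assms
proof (induction N rule: finite_induct)
  case empty
  then show ?case by simp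
next
  case (insert j N)
  then obtain c where c: "(\<Prod>i\<in>N. x i ^ n i) - (\<Prod>i\<in>N. y i ^ n i) = (\<Sum>i\<in>N. (x i - y i) * c i)"
    "\<forall>i\<in>N. nn S (c i)" by auto
  define e where "e = (\<Sum>i<n j. y j ^ (n j - Suc i) * x j ^ i)"
  have e: "x j ^ n j - y j ^ n j = (x j - y j) * e"
    unfolding e_def by (rule power_diff_sumr2)
  have "nn S e" unfolding e_def using insert.prems by (auto intro!: nn_intros)
  define c' where "c' i = (if i = j then e * (\<Prod>i\<in>N. x i ^ n i) else y j ^ n j * c i)" for i
  have "(\<Prod>i\<in>insert j N. x i ^ n i) - (\<Prod>i\<in>insert j N. y i ^ n i)
     = (x j ^ n j - y j ^ n j) * (\<Prod>i\<in>N. x i ^ n i) +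
       y j ^ n j * ((\<Prod>i\<in>N. x i ^ n i) - (\<Prod>i\<in>N. y i ^ n i))"
    using insert.hyps by (simp add: algebra_simps)
  also have "\<dots> = (x j - y j) * c' j + (\<Sum>i\<in>N. (x i - y i) * c' i)"
  proof -
    have "(\<Sum>i\<in>N. (x i - y i) * c' i) = (\<Sum>i\<in>N. y j ^ n j * ((x i - y i) * c i))"
      using insert.hyps by (intro sum.cong) (auto simp: c'_def)
    then show ?thesis unfolding c e by (simp add: c'_def sum_distrib_left mult.assoc)
  qed
  also have "\<dots> = (\<Sum>i\<in>insert j N. (x i - y i) * c' i)" using insert.hyps by simp
  finally have "(\<Prod>i\<in>insert j N. x i ^ n i) - (\<Prod>i\<in>insert j N. y i ^ n i)
     = (\<Sum>i\<in>insert j N. (x i - y i) * c' i)" .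
  moreover have "\<forall>i\<in>insert j N. nn S (c' i)"
    using c(2) \<open>nn S e\<close> insert.prems by (auto simp: c'_def intro!: nn_intros)
  ultimately show ?case by blast
qed

lemma power_xvar: "xvar i ^ n = sg (sg i (int n)) 1"
proof (induction n)
  case (Suc n)
  have "sg i 1 + sg i (int n) = sg i (int (Suc n))"
    by (simp only: single_add[symmetric] of_nat_Suc add.commute)
  then show ?case by (simp only: power_Suc Suc.IH) (simp only: xvar_def mult_single mult_1_left)
qed simp

lemma single_factor:
  assumes "finite N" "\<And>i. i \<in> N \<Longrightarrow> 0 \<le> lk \<mu> i"
  shows "sg \<mu> a = sg (restr (\<lambda>i. i \<notin> N) \<mu>) a * (\<Prod>i\<in>N. xvar i ^ nat (lk \<mu> i))"
proof -
  have *: "(\<Prod>i\<in>N. sg (g i) 1) = (sg (\<Sum>i\<in>N. g i) 1 :: 'a laur)" for g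
    using assms(1) by (induction N rule: finite_induct) (auto simp: mult_single)
  have "\<mu> = restr (\<lambda>i. i \<notin> N) \<mu> + (\<Sum>i\<in>N. sg i (int (nat (lk \<mu> i))))"
  proof (rule poly_mapping_eqI)
    fix j
    show "lk \<mu> j = lk (restr (\<lambda>i. i \<notin> N) \<mu> + (\<Sum>i\<in>N. sg i (int (nat (lk \<mu> i))))) j"
      using assms by (simp add: lookup_add lookup_restr lookup_sum lookup_single when_def)
  qed
  then have "sg \<mu> a = sg (restr (\<lambda>i. i \<notin> N) \<mu> + (\<Sum>i\<in>N. sg i (int (nat (lk \<mu> i))))) a"
    by (rule arg_cong)
  also have "\<dots> = sg (restr (\<lambda>i. i \<notin> N) \<mu>) a * (\<Prod>i\<in>N. xvar i ^ nat (lk \<mu> i))"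
  proof -
    have "(\<Prod>i\<in>N. xvar i ^ nat (lk \<mu> i)) = (\<Prod>i\<in>N. sg (sg i (int (nat (lk \<mu> i)))) (1::'a))"
      by (rule prod.cong[OF refl]) (rule power_xvar)
    also have "\<dots> = sg (\<Sum>i\<in>N. sg i (int (nat (lk \<mu> i)))) 1"
      by (rule *)
    finally have P: "(\<Prod>i\<in>N. xvar i ^ nat (lk \<mu> i)) = sg (\<Sum>i\<in>N. sg i (int (nat (lk \<mu> i)))) (1::'a)" .
    have "sg (\<kappa> + \<nu>) a = sg \<kappa> a * sg \<nu> (1::'a)" for \<kappa> \<nu> :: "nat \<Rightarrow>\<^sub>0 int"
      by (simp add: mult_single)
    then show ?thesis unfolding P by blast
  qed
  finally show ?thesis .
qed

text \<open>Taylor expansion to first order. The cofactors stay in the localization \<open>S\<close>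
  that contains \<open>p\<close> and all \<open>f i\<close>; this bounds the denominators in
  \<open>relations_polynomial\<close>.\<close>

lemma subst_congruent:
  assumes N: "finite N" and p: "nn (- N) p"
    and f: "\<And>i. i \<in> N \<Longrightarrow> nn S (f i)" and pS: "nn S p"
  shows "\<exists>c. p - subst N f p = (\<Sum>i\<in>N. (xvar i - f i) * c i) \<and> (\<forall>i\<in>N. nn S (c i))"
proof -
  have "\<exists>c. sg \<mu> (lk p \<mu>) - subst N f (sg \<mu> (lk p \<mu>)) = (\<Sum>i\<in>N. (xvar i - f i) * c i) \<and>
      (\<forall>i\<in>N. nn S (c i))" if \<mu>: "\<mu> \<in> ks p" for \<mu>
  proof -
    obtain c where c: "(\<Prod>i\<in>N. xvar i ^ nat (lk \<mu> i)) - (\<Prod>i\<in>N. f i ^ nat (lk \<mu> i)) = (\<Sum>i\<in>N. (xvar i - f i) * c i)"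
      "\<forall>i\<in>N. nn S (c i)"
      using prod_power_diff[OF N, of S xvar f "\<lambda>i. nat (lk \<mu> i)"] f by (auto intro: nn_xvar)
    let ?m = "sg (restr (\<lambda>i. i \<notin> N) \<mu>) (lk p \<mu>)"
    have "sg \<mu> (lk p \<mu>) = ?m * (\<Prod>i\<in>N. xvar i ^ nat (lk \<mu> i))"
      using p \<mu> by (intro single_factor N) (simp add: nn_def)
    then have "sg \<mu> (lk p \<mu>) - subst N f (sg \<mu> (lk p \<mu>)) = ?m * (\<Sum>i\<in>N. (xvar i - f i) * c i)"
      unfolding subst_single c(1)[symmetric] by (simp add: algebra_simps)
    also have "\<dots> = (\<Sum>i\<in>N. (xvar i - f i) * (?m * c i))"
      by (simp add: sum_distrib_left algebra_simps)
    finally show ?thesis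
    proof (intro exI conjI ballI)
      fix i assume "i \<in> N"
      have "nn S ?m" using pS \<mu> by (auto intro!: nn_single simp: lookup_restr nn_def)
      then show "nn S (?m * c i)" using c(2) \<open>i \<in> N\<close> by (auto intro: nn_mult)
    qed
  qed
  then have "\<forall>\<mu>\<in>ks p. \<exists>c. sg \<mu> (lk p \<mu>) - subst N f (sg \<mu> (lk p \<mu>)) =
      (\<Sum>i\<in>N. (xvar i - f i) * c i) \<and> (\<forall>i\<in>N. nn S (c i))" by blast
  from bchoice[OF this] obtain c where c: "\<And>\<mu>. \<mu> \<in> ks p \<Longrightarrow>
      sg \<mu> (lk p \<mu>) - subst N f (sg \<mu> (lk p \<mu>)) = (\<Sum>i\<in>N. (xvar i - f i) * c \<mu> i) \<and> (\<forall>i\<in>N. nn S (c \<mu> i))"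
    by blast
  have "p - subst N f p = (\<Sum>\<mu>\<in>ks p. sg \<mu> (lk p \<mu>) - subst N f (sg \<mu> (lk p \<mu>)))"
    unfolding sum_subtractf
    by (rule arg_cong2[where f = minus, OF sum_single_keys[symmetric] subst_expand])
  also have "\<dots> = (\<Sum>\<mu>\<in>ks p. \<Sum>i\<in>N. (xvar i - f i) * c \<mu> i)"
    using c by (intro sum.cong) auto
  also have "\<dots> = (\<Sum>i\<in>N. (xvar i - f i) * (\<Sum>\<mu>\<in>ks p. c \<mu> i))"
    by (subst sum.swap) (simp add: sum_distrib_left)
  finally show ?thesis
    using c by (intro exI[of _ "\<lambda>i. \<Sum>\<mu>\<in>ks p. c \<mu> i"]) (auto intro!: nn_sum)
qed

text \<open>Substituting \<open>- m * xvar_inv j\<close> for \<open>xvar i\<close> kills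
  \<open>l2\<close> and fixes \<open>l1\<close>, so by the relation it kills \<open>h\<close>. Then
  \<open>h\<close> is a multiple of \<open>xvar i + m * xvar_inv j\<close>, which is
  \<open>l2\<close> up to a unit. Only divisibility in the full Laurent ring is claimed; the
  cofactor lemmas locate the quotient.\<close>

lemma syzygy_of_two:
  fixes h k l1 m :: "'a::field laur"
  assumes ij: "i \<noteq> j" and l2: "l2 = xvar i * xvar j + m"
    and m: "\<And>\<mu>. \<mu> \<in> ks m \<Longrightarrow> lk \<mu> i = 0" and l1: "\<And>\<mu>. \<mu> \<in> ks l1 \<Longrightarrow> lk \<mu> i = 0" "l1 \<noteq> 0"
    and eq: "l1 * h + l2 * k = 0"
  shows "\<exists>p. h = l2 * p"
proof -
  have fin: "finite {i}" by simp
  have "nn ({i} \<union> - {i}) q" for q :: "'a laur" by (simp add: nn_def)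
  note clear = clear_denominators[OF fin this]
  obtain a b where ab: "nn (- {i}) (xpow {i} (int a) * h)" "nn (- {i}) (xpow {i} (int b) * k)"
    using clear[of h] clear[of k] by blast
  \<comment> \<open>Substitution needs nonnegative exponents of the \<open>i\<close>-th variable;
    one common power of it, a unit, clears both \<open>h\<close> and \<open>k\<close>.\<close>
  define e where "e = int a + int b"
  have h': "nn (- {i}) (xpow {i} e * h)"
    using nn_mult[OF nn_xpow_nonneg[OF fin, of "int b"] ab(1)] by (simp add: e_def xpow_add mult_ac)
  have k': "nn (- {i}) (xpow {i} e * k)"
    using nn_mult[OF nn_xpow_nonneg[OF fin, of "int a"] ab(2)] by (simp add: e_def xpow_add mult_ac)
  define f :: "nat \<Rightarrow> 'a laur" where "f = (\<lambda>_. - m * xvar_inv j)"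
  have nnl1: "nn (- {i}) l1" and nnm: "nn (- {i}) m" using l1 m by (auto simp: nn_def)
  have nnl2: "nn (- {i}) l2" unfolding l2 by (intro nn_intros nnm)
  have sl1: "subst {i} f l1 = l1" by (rule subst_free) (use l1 in auto)
  have sm: "subst {i} f m = m" by (rule subst_free) (use m in auto)
  have "subst {i} f l2 = f i * xvar j + m"
    unfolding l2 using ij by (simp add: subst_add subst_mult nn_xvar subst_xvar sm)
  then have sl2: "subst {i} f l2 = 0" by (simp add: f_def mult.assoc)
  have "l1 * (xpow {i} e * h) + l2 * (xpow {i} e * k) = 0"
    using arg_cong[OF eq, of "\<lambda>z. xpow {i} e * z"] by (simp add: algebra_simps)
  then have "subst {i} f (l1 * (xpow {i} e * h) + l2 * (xpow {i} e * k)) = 0" by simp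
  then have "l1 * subst {i} f (xpow {i} e * h) = 0"
    by (simp add: subst_add subst_mult nnl1 nnl2 h' k' sl1 sl2 del: mult_eq_0_iff)
  then have "subst {i} f (xpow {i} e * h) = 0" using l1(2) by simp
  moreover obtain c where
    "xpow {i} e * h - subst {i} f (xpow {i} e * h) = (\<Sum>i\<in>{i}. (xvar i - f i) * c i)"
    using subst_congruent[OF fin h', of UNIV f] by (auto simp: nn_def)
  ultimately have "xpow {i} e * h = (xvar i - f i) * c i" by simp
  also have "xvar i - f i = xvar_inv j * l2"
  proof -
    have "xvar_inv j * l2 = xvar i * (xvar j * xvar_inv j) + m * xvar_inv j"
      unfolding l2 by (simp only: distrib_left mult_ac)
    then show ?thesis by (simp add: f_def)
  qed
  finally have "xpow {i} (- e) * (xpow {i} e * h) = xpow {i} (- e) * (xvar_inv j * l2 * c i)" by simp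
  then have "h = xpow {i} (- e) * (xvar_inv j * l2 * c i)"
    by (simp add: mult.assoc[symmetric])
  then have "h = l2 * (xpow {i} (- e) * xvar_inv j * c i)" by (simp only: mult_ac)
  then show ?thesis ..
qed

section \<open>The Rees algebra of the ideal of minors\<close>

definition l1 :: "'a::field laur" where "l1 = xvar 0 * xvar 6 + xvar 1 * xvar 7 + xvar 2 * xvar 8"
definition l2 :: "'a::field laur" where "l2 = xvar 3 * xvar 6 + xvar 4 * xvar 7 + xvar 5 * xvar 8"

text \<open>The signs are those of the cofactors of the T_i in the determinant with last row T, so
  \<open>ev l1\<close> and \<open>ev l2\<close> are determinants with a repeated row. All indices
  other than 6 and 7 give the third minor.\<close>

definition minor :: "nat \<Rightarrow> 'a::field laur" where
  "minor i = (if i = 6 then xvar 1 * xvar 5 - xvar 2 * xvar 4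
    else if i = 7 then xvar 2 * xvar 3 - xvar 0 * xvar 5 else xvar 0 * xvar 4 - xvar 1 * xvar 3)"

definition ev :: "'a::field laur \<Rightarrow> 'a laur" where "ev = subst {6, 7, 8} minor"

definition tdeg :: "(nat \<Rightarrow>\<^sub>0 int) \<Rightarrow> int" where "tdeg \<mu> = lk \<mu> 6 + lk \<mu> 7 + lk \<mu> 8"

lemma tdeg_add: "tdeg (\<mu> + \<nu>) = tdeg \<mu> + tdeg \<nu>"
  by (simp add: tdeg_def lookup_add)

text \<open>The part of degree \<open>d\<close> in the \<open>T\<^sub>i\<close> of the polynomial ring in the \<open>T\<^sub>i\<close> over the localization of \<open>R\<close> at
  the product of the indeterminates in \<open>S\<close>. For \<open>d = 0\<close> this is the localization itself.\<close>

definition G :: "nat set \<Rightarrow> int \<Rightarrow> 'a::field laur set" where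
  "G S d = {p. nn S p \<and> (\<forall>\<mu>\<in>ks p. (\<forall>i\<ge>9. lk \<mu> i = 0) \<and> tdeg \<mu> = d)}"

lemma xvar_times_xvar: "xvar i * xvar j = sg (sg i 1 + sg j 1) 1"
  by (simp add: xvar_def mult_single)

lemma neq_lookup: "lk \<mu> i \<noteq> lk \<nu> i \<Longrightarrow> \<mu> \<noteq> \<nu>" by auto

lemma single_pair_neq:
  "a \<noteq> c \<Longrightarrow> a \<noteq> d \<Longrightarrow> sg a (1::int) + sg b 1 \<noteq> sg c 1 + sg d 1"
  by (rule neq_lookup[of _ a]) (auto simp: lookup_add lookup_single when_def)

lemma keys_two:
  assumes "a \<notin> {c, d}"
  shows "ks (xvar a * xvar b + xvar c * xvar d :: 'a::field laur) = {sg a 1 + sg b 1, sg c 1 + sg d 1}"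
  using assms single_pair_neq[of a c d b]
  by (auto simp: xvar_times_xvar in_keys_iff lookup_add lookup_single when_def split: if_splits)

lemma keys_three:
  assumes "a \<notin> {c, d, e, f}" "c \<notin> {a, b, e, f}"
  shows "ks (xvar a * xvar b + xvar c * xvar d + xvar e * xvar f :: 'a::field laur) =
    {sg a 1 + sg b 1, sg c 1 + sg d 1, sg e 1 + sg f 1}"
  using assms single_pair_neq[of a c d b] single_pair_neq[of a e f b] single_pair_neq[of c e f d]
  by (auto simp: xvar_times_xvar in_keys_iff lookup_add lookup_single when_def split: if_splits)

lemma keys_l1: "ks (l1 :: 'a::field laur) = {sg 0 1 + sg 6 1, sg 1 1 + sg 7 1, sg 2 1 + sg 8 1}"
  unfolding l1_def by (rule keys_three) auto

lemma keys_l2: "ks (l2 :: 'a::field laur) = {sg 3 1 + sg 6 1, sg 4 1 + sg 7 1, sg 5 1 + sg 8 1}"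
  unfolding l2_def by (rule keys_three) auto

lemma l1_nz: "(l1 :: 'a::field laur) \<noteq> 0" and l2_nz: "(l2 :: 'a::field laur) \<noteq> 0"
  using keys_l1 keys_l2 by (metis insert_not_empty keys_zero)+

lemma nn_l1: "nn S l1" and nn_l2: "nn S l2"
  unfolding l1_def l2_def by (intro nn_intros)+

lemma nn_minor: "nn S (minor i)"
  unfolding minor_def by (auto intro!: nn_intros)

lemma G_zero [intro]: "0 \<in> G S d" by (simp add: G_def nn_zero)
lemma G_add: "p \<in> G S d \<Longrightarrow> q \<in> G S d \<Longrightarrow> p + q \<in> G S d"
  unfolding G_def using keys_add[of p q] by (auto intro: nn_add)
lemma G_uminus: "p \<in> G S d \<Longrightarrow> - p \<in> G S d"
  unfolding G_def by (auto intro: nn_uminus simp: in_keys_iff)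
lemma G_diff: "p \<in> G S d \<Longrightarrow> q \<in> G S d \<Longrightarrow> p - q \<in> G S d"
  using G_add[of p S d "- q"] G_uminus[of q S d] by simp
lemma G_sum: "(\<And>i. i \<in> A \<Longrightarrow> f i \<in> G S d) \<Longrightarrow> sum f A \<in> G S d"
  by (induction A rule: infinite_finite_induct) (auto intro: G_add)
lemma G_mult: "p \<in> G S d \<Longrightarrow> q \<in> G S e \<Longrightarrow> p * q \<in> G S (d + e)"
  unfolding G_def by (auto intro: nn_mult elim!: keys_timesE simp: lookup_add tdeg_add)
lemma G_mult0: "p \<in> G S 0 \<Longrightarrow> q \<in> G S d \<Longrightarrow> p * q \<in> G S d"
  using G_mult[of p S 0 q d] by simp
lemma G_mono: "p \<in> G S d \<Longrightarrow> S \<subseteq> T \<Longrightarrow> p \<in> G T d"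
  by (auto simp: G_def intro: nn_mono)
lemma G_single:
  "(\<And>i. i \<notin> S \<Longrightarrow> 0 \<le> lk \<mu> i) \<Longrightarrow> (\<And>i. 9 \<le> i \<Longrightarrow> lk \<mu> i = 0) \<Longrightarrow> tdeg \<mu> = d \<Longrightarrow> sg \<mu> a \<in> G S d"
  using nn_single[of S \<mu> a] by (auto simp: G_def)
lemma G_one: "1 \<in> G S 0" by (simp add: G_def nn_one tdeg_def)
lemma G_const: "sg 0 c \<in> G S 0" by (rule G_single) (auto simp: tdeg_def)
lemma G_power: "p \<in> G S 0 \<Longrightarrow> p ^ n \<in> G S 0"
  by (induction n) (auto intro: G_one G_mult0)
lemma G_xvar: "i < 6 \<Longrightarrow> xvar i \<in> G S 0"
  unfolding xvar_def by (rule G_single) (auto simp: tdeg_def lookup_single when_def)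
lemma G_xvar1: "i \<in> {6, 7, 8} \<Longrightarrow> xvar i \<in> G S 1"
  unfolding xvar_def by (rule G_single) (auto simp: tdeg_def lookup_single when_def)
lemma G_minor: "minor i \<in> G S 0"
  unfolding minor_def by (auto intro!: G_diff G_mult0 G_xvar)
lemma G_l1: "l1 \<in> G S 1" and G_l2: "l2 \<in> G S 1"
  unfolding l1_def l2_def by (auto intro!: G_add G_mult0 G_xvar G_xvar1)
lemma G_restr: "p \<in> G S d \<Longrightarrow> restr P p \<in> G S d"
  by (auto simp: G_def nn_def keys_restr)
lemma G_xpow: "finite S \<Longrightarrow> S \<subseteq> {..<6} \<Longrightarrow> xpow S n \<in> G S 0"
  unfolding xpow_def by (rule G_single) (auto simp: lookup_sum_single tdeg_def)

lemma G_nnT: "g \<in> G S d \<Longrightarrow> S \<subseteq> {..<6} \<Longrightarrow> nn (- {6, 7, 8}) g"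
  by (rule nn_mono[of S]) (auto simp: G_def)

lemma ev_add: "ev (p + q) = ev p + ev q" by (simp add: ev_def subst_add)
lemma ev_diff: "ev (p - q) = ev p - ev q" by (simp add: ev_def subst_diff)
lemma ev_uminus: "ev (- p) = - ev p" by (simp add: ev_def subst_uminus)
lemma ev_zero [simp]: "ev 0 = 0" by (simp add: ev_def)
lemma ev_sum: "ev (sum f A) = (\<Sum>i\<in>A. ev (f i))" by (simp add: ev_def subst_sum)
lemma ev_mult: "p \<in> G S d \<Longrightarrow> q \<in> G S e \<Longrightarrow> S \<subseteq> {..<6} \<Longrightarrow> ev (p * q) = ev p * ev q"
  unfolding ev_def by (intro subst_mult G_nnT)
lemma ev_xvar: "ev (xvar i) = (if i \<in> {6, 7, 8} then minor i else xvar i)"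
  by (simp add: ev_def subst_xvar)

text \<open>The exponents of the T_i are nonnegative, since \<open>S\<close> does not invert them,
  and they add up to 0.\<close>

lemma ev_free:
  assumes "p \<in> G S 0" "S \<subseteq> {..<6}"
  shows "ev p = p"
  unfolding ev_def
proof (rule subst_free)
  fix \<mu> i assume \<mu>: "\<mu> \<in> ks p" and i: "i \<in> {6, 7, 8::nat}"
  have "0 \<le> lk \<mu> 6" "0 \<le> lk \<mu> 7" "0 \<le> lk \<mu> 8" "tdeg \<mu> = 0"
    using assms \<mu> by (auto simp: G_def intro!: nnD[of S])
  with i show "lk \<mu> i = 0" by (auto simp: tdeg_def)
qed

lemma ev_l1: "ev l1 = 0"
proof -
  have "ev l1 = xvar 0 * minor 6 + xvar 1 * minor 7 + xvar 2 * minor 8"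
    by (simp add: l1_def ev_def subst_add subst_mult nn_xvar subst_xvar)
  then show ?thesis by (simp add: minor_def algebra_simps)
qed

lemma ev_l2: "ev l2 = 0"
proof -
  have "ev l2 = xvar 3 * minor 6 + xvar 4 * minor 7 + xvar 5 * minor 8"
    by (simp add: l2_def ev_def subst_add subst_mult nn_xvar subst_xvar)
  then show ?thesis by (simp add: minor_def algebra_simps)
qed

lemma ev_in_G:
  assumes "g \<in> G S d" "S \<subseteq> {..<6}"
  shows "ev g \<in> G S 0"
proof -
  have "ev g = (\<Sum>\<mu>\<in>ks g. ev (sg \<mu> (lk g \<mu>)))" unfolding ev_def by (rule subst_expand)
  also have "\<dots> \<in> G S 0"
  proof (rule G_sum)
    fix \<mu> assume \<mu>: "\<mu> \<in> ks g"
    have "sg (restr (\<lambda>i. i \<notin> {6, 7, 8}) \<mu>) (lk g \<mu>) \<in> G S 0"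
      using assms \<mu> by (intro G_single) (auto simp: lookup_restr tdeg_def G_def nn_def)
    moreover have "(\<Prod>i\<in>{6, 7, 8}. minor i ^ nat (lk \<mu> i)) \<in> G S 0"
      by (auto intro!: G_power G_minor G_mult0)
    ultimately show "ev (sg \<mu> (lk g \<mu>)) \<in> G S 0"
      unfolding ev_def subst_single by (rule G_mult0)
  qed
  finally show ?thesis .
qed

text \<open>A monomial of \<open>l\<^sub>2\<close> avoids any given variable, so the valuation of \<open>l\<^sub>2\<close> at it is zero.\<close>

lemma cofactor_l2:
  fixes p :: "'a::field laur"
  assumes "l2 * p \<in> G S d"
  shows "p \<in> G S (d - 1)"
  unfolding G_def
proof (safe)
  have nn: "nn S (l2 * p)" and ext: "\<And>\<mu> i. \<mu> \<in> ks (l2 * p) \<Longrightarrow> 9 \<le> i \<Longrightarrow> lk \<mu> i = 0"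
    and td: "\<And>\<mu>. \<mu> \<in> ks (l2 * p) \<Longrightarrow> tdeg \<mu> = d"
    using assms by (auto simp: G_def)
  show "nn S p"
    unfolding nn_def
  proof (intro ballI allI impI)
    fix \<mu> i assume \<mu>: "\<mu> \<in> ks p" and i: "i \<notin> S"
    obtain \<nu> where \<nu>: "\<nu> \<in> ks (l2 :: 'a laur)" "lk \<nu> i = 0"
    proof (cases "i \<in> {3, 6}")
      case True
      then show ?thesis
        by (intro that[of "sg 4 1 + sg 7 1"]) (auto simp: keys_l2 lookup_add lookup_single when_def)
    next
      case False
      then show ?thesis
        by (intro that[of "sg 3 1 + sg 6 1"]) (auto simp: keys_l2 lookup_add lookup_single when_def)
    qed
    show "0 \<le> lk \<mu> i"
    proof (rule cofactor_valuation[where w = "\<lambda>\<mu>. lk \<mu> i" and l = l2 and p = p])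
      show "0 \<le> lk \<mu> i" if "\<mu> \<in> ks (l2 :: 'a laur)" for \<mu>
        using that nnD[OF nn_l2[of "{}"]] by blast
      show "0 \<le> lk \<mu> i" if "\<mu> \<in> ks (l2 * p)" for \<mu>
        using that nnD[OF nn] i by blast
    qed (use \<nu> \<mu> in \<open>auto simp: lookup_add\<close>)
  qed
  show "lk \<mu> i = 0" if "\<mu> \<in> ks p" "9 \<le> i" for \<mu> i
  proof -
    have "lk \<mu> i = 0 - 0"
    proof (rule cofactor_homogeneous[where w = "\<lambda>\<mu>. lk \<mu> i" and l = l2 and p = p])
      show "lk \<mu> i = 0" if "\<mu> \<in> ks (l2 :: 'a laur)" for \<mu>
        using that \<open>9 \<le> i\<close> by (auto simp: keys_l2 lookup_add lookup_single when_def)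
    qed (use that ext l2_nz in \<open>auto simp: lookup_add\<close>)
    then show ?thesis by simp
  qed
  show "tdeg \<mu> = d - 1" if "\<mu> \<in> ks p" for \<mu>
  proof (rule cofactor_homogeneous[where w = tdeg and l = l2 and p = p])
    show "tdeg \<mu> = 1" if "\<mu> \<in> ks (l2 :: 'a laur)" for \<mu>
      using that by (auto simp: keys_l2 tdeg_def lookup_add lookup_single when_def)
  qed (use that td l2_nz in \<open>auto simp: tdeg_add\<close>)
qed

text \<open>Regularity of the sequence \<open>l1\<close>, \<open>l2\<close> over every localization.
  The choice \<open>i = 3\<close>, \<open>j = 6\<close> works because x occurs in \<open>l2\<close>
  only in the term x T_1 and not at all in \<open>l1\<close>. The quotient \<open>p\<close> has the
  right denominators and degree by \<open>cofactor_l2\<close>, and \<open>k\<close> follows by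
  cancelling \<open>l2\<close>.\<close>

lemma koszul_exact:
  fixes h k :: "'a::field laur"
  assumes "l1 * h + l2 * k = 0" "h \<in> G S d"
  shows "\<exists>p\<in>G S (d - 1). h = l2 * p \<and> k = - l1 * p"
proof -
  have "\<exists>p. h = l2 * p"
  proof (rule syzygy_of_two[where i = 3 and j = 6 and m = "xvar 4 * xvar 7 + xvar 5 * xvar 8" and ?l1.0 = l1])
    show "l2 = xvar 3 * xvar 6 + (xvar 4 * xvar 7 + xvar 5 * xvar 8)" by (simp add: l2_def)
    show "lk \<mu> 3 = 0" if "\<mu> \<in> ks (xvar 4 * xvar 7 + xvar 5 * xvar 8 :: 'a laur)" for \<mu>
      using that by (auto simp: keys_two lookup_add lookup_single when_def)
    show "lk \<mu> 3 = 0" if "\<mu> \<in> ks (l1 :: 'a laur)" for \<mu>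
      using that by (auto simp: keys_l1 lookup_add lookup_single when_def simp del: single_one)
  qed (use assms l1_nz in auto)
  then obtain p where p: "h = l2 * p" ..
  then have "p \<in> G S (d - 1)" using assms(2) by (auto intro: cofactor_l2)
  moreover have "l2 * (k + l1 * p) = 0" using assms(1) p by (simp add: algebra_simps)
  then have "k + l1 * p = 0" by (simp add: l2_nz)
  then have "k = - l1 * p" by (simp add: eq_neg_iff_add_eq_0)
  ultimately show ?thesis using p by blast
qed

subsection \<open>The relations between the minors\<close>

text \<open>T_1 is a nonzerodivisor modulo \<open>l1\<close>, \<open>l2\<close>. At T_1 = 0 the
  relation becomes a syzygy between v T_2 + w T_3 and y T_2 + z T_3, to which
  \<open>syzygy_of_two\<close> applies again. Subtracting the Koszul syzygy with its cofactor
  \<open>p\<close> makes \<open>h\<close> and \<open>k\<close> divisible by T_1.\<close>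

lemma saturation_step:
  fixes g h k :: "'a::field laur"
  assumes g: "nn {} g" and h: "nn {} h" and k: "nn {} k" and eq: "xvar 6 * g = l1 * h + l2 * k"
  shows "\<exists>h' k'. nn {} h' \<and> nn {} k' \<and> g = l1 * h' + l2 * k'"
proof -
  let ?r = "restr (\<lambda>\<mu>. lk \<mu> 6 = 0) :: 'a laur \<Rightarrow> 'a laur"
  let ?m1 = "xvar 1 * xvar 7 + xvar 2 * xvar 8 :: 'a laur" and ?m2 = "xvar 4 * xvar 7 + xvar 5 * xvar 8 :: 'a laur"
  \<comment> \<open>On polynomials \<open>?r\<close> is evaluation at T_1 = 0: it keeps the lowest
    possible degree in T_1 and is therefore multiplicative.\<close>
  have r_mult: "?r (p * q) = ?r p * ?r q" if "nn {} p" "nn {} q" for p q :: "'a laur"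
    using restr_times_lowest[where w = "\<lambda>\<mu>. lk \<mu> 6" and a = 0 and b = 0 and l = p and p = q] that
    by (simp add: lookup_add nn_def)
  have r_XX: "?r (xvar i * xvar j) = (if i = 6 \<or> j = 6 then 0 else xvar i * xvar j)" for i j
  proof (cases "i = 6 \<or> j = 6")
    case True
    then have "lk (sg i 1 + sg j (1::int)) 6 \<noteq> 0" by (auto simp: lookup_add lookup_single when_def)
    then show ?thesis unfolding xvar_times_xvar using True by (auto intro!: restr_none)
  next
    case False
    then show ?thesis unfolding xvar_times_xvar
      by (auto intro!: restr_all simp: lookup_add lookup_single when_def)
  qed
  have rl: "?r l1 = ?m1" "?r l2 = ?m2" by (simp_all add: l1_def l2_def restr_add r_XX)
  have "?r (xvar 6 * g) = 0"
  proof (rule restr_none)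
    fix \<mu> assume "\<mu> \<in> ks (xvar 6 * g)"
    then obtain \<nu> where "\<nu> \<in> ks g" "\<mu> = sg 6 1 + \<nu>"
      unfolding xvar_def keys_single_times by blast
    then show "lk \<mu> 6 \<noteq> 0" using nnD[OF g, of \<nu> 6] by (simp add: lookup_add)
  qed
  then have eq0: "?m1 * ?r h + ?m2 * ?r k = 0"
    unfolding eq restr_add using h k by (simp add: r_mult nn_l1 nn_l2 rl)
  have m1_nz: "?m1 \<noteq> 0" and m2_nz: "?m2 \<noteq> 0"
    using keys_two[of 1 2 8 7, where 'a = 'a] keys_two[of 4 5 8 7, where 'a = 'a] by auto
  have "\<exists>p. ?r h = ?m2 * p"
  proof (rule syzygy_of_two[where i = 4 and j = 7 and m = "xvar 5 * xvar 8" and ?l1.0 = ?m1])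
    show "lk \<mu> 4 = 0" if "\<mu> \<in> ks (xvar 5 * xvar 8 :: 'a laur)" for \<mu>
      using that by (auto simp: xvar_times_xvar lookup_add lookup_single when_def)
    show "lk \<mu> 4 = 0" if "\<mu> \<in> ks ?m1" for \<mu>
      using that by (auto simp: keys_two lookup_add lookup_single when_def)
  qed (use eq0 m1_nz in auto)
  then obtain p where p: "?r h = ?m2 * p" ..
  have km2: "ks ?m2 = {sg 4 1 + sg 7 1, sg 5 1 + sg 8 1}" by (rule keys_two) auto
  have "?m2 * (?r k + ?m1 * p) = 0" using eq0 unfolding p by (simp add: algebra_simps)
  then have "?r k + ?m1 * p = 0" using m2_nz by (simp only: mult_eq_0_iff) simp
  then have rk: "?r k = - (?m1 * p)" by (simp add: eq_neg_iff_add_eq_0)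
  have "nn {} p"
    unfolding nn_def
  proof (intro ballI allI impI)
    fix \<mu> i assume \<mu>: "\<mu> \<in> ks p"
    obtain \<nu> where \<nu>: "\<nu> \<in> ks ?m2" "lk \<nu> i = 0"
    proof (cases "i \<in> {4, 7}")
      case True
      then show ?thesis
        by (intro that[of "sg 5 1 + sg 8 1"]) (auto simp: km2 lookup_add lookup_single when_def)
    next
      case False
      then show ?thesis
        by (intro that[of "sg 4 1 + sg 7 1"]) (auto simp: km2 lookup_add lookup_single when_def)
    qed
    show "0 \<le> lk \<mu> i"
    proof (rule cofactor_valuation[where w = "\<lambda>\<mu>. lk \<mu> i" and l = ?m2 and p = p])
      show "0 \<le> lk \<mu> i" if "\<mu> \<in> ks ?m2" for \<mu>
        using that by (auto simp: km2 lookup_add lookup_single when_def)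
      show "0 \<le> lk \<mu> i" if "\<mu> \<in> ks (?m2 * p)" for \<mu>
        using that h unfolding p[symmetric] by (auto simp: keys_restr nn_def)
    qed (use \<nu> \<mu> in \<open>auto simp: lookup_add\<close>)
  qed
  have "lk \<mu> 6 = 0" if "\<mu> \<in> ks p" for \<mu>
  proof -
    have "lk \<mu> 6 = 0 - 0"
    proof (rule cofactor_homogeneous[where w = "\<lambda>\<mu>. lk \<mu> 6" and l = ?m2 and p = p])
      show "lk \<mu> 6 = 0" if "\<mu> \<in> ks (?m2 * p)" for \<mu>
        using that unfolding p[symmetric] by (auto simp: keys_restr)
      show "lk \<mu> 6 = 0" if "\<mu> \<in> ks ?m2" for \<mu>
        using that by (auto simp: km2 lookup_add lookup_single when_def)
    qed (use that m2_nz in \<open>auto simp: lookup_add\<close>)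
    then show ?thesis by simp
  qed
  then have rp: "?r p = p" by (intro restr_all) auto
  have div: "nn {} (xvar_inv 6 * q)" if "nn {} q" "?r q = 0" for q :: "'a laur"
    unfolding nn_def
  proof (intro ballI allI impI)
    fix \<mu> i assume "\<mu> \<in> ks (xvar_inv 6 * q)"
    then obtain \<nu> where \<nu>: "\<nu> \<in> ks q" "\<mu> = sg 6 (- 1) + \<nu>"
      by (auto simp: xvar_inv_def keys_single_times)
    then have "lk \<nu> 6 \<noteq> 0" "\<forall>i. 0 \<le> lk \<nu> i"
      using that by (auto simp: nn_def restr_eq_zero_iff)
    then show "0 \<le> lk \<mu> i" using \<nu>(2)
      by (cases "i = 6") (auto simp: lookup_add lookup_single order_less_le)
  qed
  define h' where "h' = xvar_inv 6 * (h - l2 * p)"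
  define k' where "k' = xvar_inv 6 * (k + l1 * p)"
  have "nn {} h'" unfolding h'_def
    by (intro div nn_intros h nn_l2 \<open>nn {} p\<close>) (simp add: restr_diff r_mult nn_l2 \<open>nn {} p\<close> rl rp p)
  moreover have "nn {} k'" unfolding k'_def
    by (intro div nn_intros k nn_l1 \<open>nn {} p\<close>) (simp add: restr_add r_mult nn_l1 \<open>nn {} p\<close> rl rp rk)
  moreover have "l1 * h' + l2 * k' = xvar_inv 6 * (xvar 6 * g)"
    unfolding eq h'_def k'_def by (simp add: algebra_simps)
  then have "g = l1 * h' + l2 * k'" by (simp add: mult.assoc[symmetric])
  ultimately show ?thesis by blast
qed

lemma saturation:
  fixes g h k :: "'a::field laur"
  assumes "nn {} g" "nn {} h" "nn {} k" "xvar 6 ^ n * g = l1 * h + l2 * k"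
  shows "\<exists>h' k'. nn {} h' \<and> nn {} k' \<and> g = l1 * h' + l2 * k'"
  using assms
proof (induction n arbitrary: h k)
  case (Suc n)
  have "\<exists>h' k'. nn {} h' \<and> nn {} k' \<and> xvar 6 ^ n * g = l1 * h' + l2 * k'"
    by (rule saturation_step[of _ h k]) (use Suc.prems in \<open>auto intro!: nn_intros simp: mult.assoc\<close>)
  then show ?case using Suc.IH Suc.prems(1) by blast
qed auto

text \<open>Eliminating \<open>u\<close> and \<open>x\<close> by \<open>l\<^sub>1 = l\<^sub>2 = 0\<close> turns the minors into the \<open>T\<^sub>i\<close>, up to a common
  factor.\<close>

definition elim_ux :: "nat \<Rightarrow> 'a::field laur" where
  "elim_ux i = (if i = 0 then - (xvar 1 * xvar 7 + xvar 2 * xvar 8) * xvar_inv 6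
     else - (xvar 4 * xvar 7 + xvar 5 * xvar 8) * xvar_inv 6)"

abbreviation rho :: "'a::field laur \<Rightarrow> 'a laur" where "rho \<equiv> subst {0, 3} elim_ux"

lemma xvar6_cancel: "xvar 6 * (xvar_inv 6 * p) = p" by (simp add: mult.assoc[symmetric])

text \<open>Once \<open>l1\<close> and \<open>l2\<close> vanish, both rows are orthogonal to the
  vector T, so their cross product, the vector of minors, is proportional to T. The first coordinate
  gives the factor, which does not involve u and x.\<close>

lemma rho_minor:
  assumes "i \<in> {6, 7, 8}"
  shows "rho (minor i) = xvar i * (minor 6 * xvar_inv 6)"
  using assms
  by (auto simp: minor_def subst_diff subst_mult nn_xvar subst_xvar elim_ux_def algebra_simps xvar6_cancel)

lemma minor6_nz: "(minor 6 :: 'a::field laur) \<noteq> 0"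
proof
  assume "(minor 6 :: 'a laur) = 0"
  then have "lk (minor 6 :: 'a laur) (sg 1 1 + sg 5 1) = 0" by simp
  moreover have "sg 2 1 + sg 4 1 \<noteq> sg 1 1 + sg (5::nat) (1::int)"
    by (rule single_pair_neq) auto
  ultimately show False by (simp add: minor_def xvar_times_xvar lookup_minus lookup_single when_def)
qed

text \<open>Homogeneity of degree \<open>d\<close> collects the common factor of the minors as a
  \<open>d\<close>-th power. As that factor is nonzero, an element of fixed degree killed by
  \<open>ev\<close> is killed by \<open>rho\<close>.\<close>

lemma rho_ev:
  fixes g :: "'a::field laur"
  assumes nn: "nn {} g" and d: "\<And>\<mu>. \<mu> \<in> ks g \<Longrightarrow> tdeg \<mu> = int d"
  shows "rho (ev g) = rho g * (minor 6 * xvar_inv 6) ^ d"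
proof -
  have "rho (ev (sg \<mu> a)) = rho (sg \<mu> a) * (minor 6 * xvar_inv 6) ^ d" if \<mu>: "\<mu> \<in> ks g" for \<mu> and a :: 'a
  proof -
    let ?e = "\<lambda>i. nat (lk \<mu> i)" and ?m = "sg (restr (\<lambda>i. i \<notin> {6, 7, 8}) \<mu>) a"
    have nnm: "nn (- {0, 3}) ?m" using nn \<mu> by (intro nn_single) (auto simp: nn_def lookup_restr)
    have p: "nn (- {0, 3}) (xvar i ^ n :: 'a laur)" "nn (- {0, 3}) (minor i ^ n :: 'a laur)" for i n
      by (intro nn_intros nn_minor)+
    have prods: "nn (- {0, 3}) (\<Prod>i\<in>{6, 7, 8}. xvar i ^ ?e i :: 'a laur)"
      "nn (- {0, 3}) (\<Prod>i\<in>{6, 7, 8}. minor i ^ ?e i :: 'a laur)"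
      by (intro nn_prod p)+
    have T: "0 \<le> lk \<mu> 6" "0 \<le> lk \<mu> 7" "0 \<le> lk \<mu> 8" using nn \<mu> by (auto simp: nn_def)
    then have de: "d = ?e 6 + ?e 7 + ?e 8" using d[OF \<mu>] by (simp add: tdeg_def)
    have "sg \<mu> a = ?m * (\<Prod>i\<in>{6, 7, 8}. xvar i ^ ?e i)"
      by (rule single_factor) (use T in auto)
    then have "rho (sg \<mu> a) = rho (?m * (\<Prod>i\<in>{6, 7, 8}. xvar i ^ ?e i))" by simp
    also have "\<dots> = rho ?m * rho (xvar 6 ^ ?e 6 * (xvar 7 ^ ?e 7 * xvar 8 ^ ?e 8))"
      using subst_mult[OF nnm prods(1), of elim_ux] by simp
    also have "\<dots> = rho ?m * (xvar 6 ^ ?e 6 * (xvar 7 ^ ?e 7 * xvar 8 ^ ?e 8))"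
      by (simp add: subst_mult subst_power p nn_mult nn_xvar subst_xvar)
    finally have 1: "rho (sg \<mu> a) = rho ?m * (xvar 6 ^ ?e 6 * (xvar 7 ^ ?e 7 * xvar 8 ^ ?e 8))" .
    have "rho (ev (sg \<mu> a)) = rho (?m * (\<Prod>i\<in>{6, 7, 8}. minor i ^ ?e i))"
      unfolding ev_def subst_single ..
    also have "\<dots> = rho ?m * rho (minor 6 ^ ?e 6 * (minor 7 ^ ?e 7 * minor 8 ^ ?e 8))"
      using subst_mult[OF nnm prods(2), of elim_ux] by simp
    also have "\<dots> = rho ?m * (rho (minor 6) ^ ?e 6 * (rho (minor 7) ^ ?e 7 * rho (minor 8) ^ ?e 8))"
      by (simp add: subst_mult subst_power p nn_mult nn_minor)
    also have "\<dots> = rho (sg \<mu> a) * (minor 6 * xvar_inv 6) ^ d"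
      unfolding 1 de by (simp add: rho_minor power_mult_distrib power_add)
    finally show ?thesis .
  qed
  then have "rho (\<Sum>\<mu>\<in>ks g. ev (sg \<mu> (lk g \<mu>))) =
      (\<Sum>\<mu>\<in>ks g. rho (sg \<mu> (lk g \<mu>))) * (minor 6 * xvar_inv 6) ^ d"
    by (simp add: subst_sum sum_distrib_right)
  moreover have "ev g = (\<Sum>\<mu>\<in>ks g. ev (sg \<mu> (lk g \<mu>)))" unfolding ev_def by (rule subst_expand)
  moreover have "rho g = (\<Sum>\<mu>\<in>ks g. rho (sg \<mu> (lk g \<mu>)))" by (rule subst_expand)
  ultimately show ?thesis by simp
qed

lemma xvar_inv_nz: "xvar_inv i \<noteq> 0"
  by (metis xvar_inverse(1) mult_zero_right zero_neq_one)

text \<open>By \<open>subst_congruent\<close>, an element killed by \<open>rho\<close> is a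
  combination of \<open>xvar 0 - elim_ux 0\<close> and \<open>xvar 3 - elim_ux 3\<close>, which are
  \<open>l1\<close> and \<open>l2\<close> divided by T_1. Then \<open>saturation\<close> removes the
  powers of T_1 from the denominators.\<close>

lemma relations_polynomial:
  fixes g :: "'a::field laur"
  assumes nn: "nn {} g" and d: "\<And>\<mu>. \<mu> \<in> ks g \<Longrightarrow> tdeg \<mu> = d" and ev: "ev g = 0"
  shows "\<exists>h k. nn {} h \<and> nn {} k \<and> g = l1 * h + l2 * k"
proof (cases "g = 0")
  case True
  then show ?thesis by (intro exI[of _ 0]) (auto intro: nn_zero)
next
  case False
  then obtain \<mu> where "\<mu> \<in> ks g" by (metis keys_eq_empty ex_in_conv)
  then have "0 \<le> d" using nn d[of \<mu>] by (auto simp: tdeg_def nn_def)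
  then have d': "\<And>\<mu>. \<mu> \<in> ks g \<Longrightarrow> tdeg \<mu> = int (nat d)" using d by simp
  have "rho g * (minor 6 * xvar_inv 6) ^ nat d = 0"
    using rho_ev[OF nn d'] by (simp add: ev)
  then have rho0: "rho g = 0" by (simp add: minor6_nz xvar_inv_nz)
  have nn6: "nn {6} (elim_ux i :: 'a laur)" for i
    unfolding elim_ux_def by (auto intro!: nn_intros nn_xvar_inv)
  obtain c where c: "g - rho g = (\<Sum>i\<in>{0, 3}. (xvar i - elim_ux i) * c i)" "\<forall>i\<in>{0, 3}. nn {6} (c i)"
    using subst_congruent[of "{0, 3}" g "{6}" elim_ux] nn nn6 by (auto intro: nn_mono)
  have "xvar 0 - elim_ux 0 = xvar_inv 6 * (l1 :: 'a laur)" "xvar 3 - elim_ux 3 = xvar_inv 6 * (l2 :: 'a laur)"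
    by (simp_all add: elim_ux_def l1_def l2_def algebra_simps xvar6_cancel)
  then have g: "g = l1 * (xvar_inv 6 * c 0) + l2 * (xvar_inv 6 * c 3)"
    using c(1) rho0 by (simp add: mult_ac)
  have "nn ({6} \<union> {}) (xvar_inv 6 * c 0)" "nn ({6} \<union> {}) (xvar_inv 6 * c 3)"
    using c(2) by (auto intro!: nn_mult nn_xvar_inv)
  then obtain a b where ab: "nn {} (xpow {6} (int a) * (xvar_inv 6 * c 0))"
    "nn {} (xpow {6} (int b) * (xvar_inv 6 * c 3))"
    using clear_denominators[of "{6}" "{}"] by blast
  have xp: "xpow {6} (int n) = xvar 6 ^ n" for n by (simp add: xpow_def power_xvar)
  have "nn {} (xvar 6 ^ b * (xvar 6 ^ a * (xvar_inv 6 * c 0)))" "nn {} (xvar 6 ^ a * (xvar 6 ^ b * (xvar_inv 6 * c 3)))"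
    using ab by (auto simp: xp intro!: nn_mult nn_power nn_xvar)
  then show ?thesis
    by (intro saturation[OF nn, of _ _ "a + b"]) (auto simp: g power_add algebra_simps)
qed

text \<open>Denominators in \<open>S\<close> are cleared to reach
  \<open>relations_polynomial\<close> and put back as a unit. The cofactors obtained there need be
  neither homogeneous nor confined to the nine variables, so they are cut down to the parts that
  are.\<close>

lemma relations_exact:
  fixes g :: "'a::field laur"
  assumes S: "S \<subseteq> {..<6}" and g: "g \<in> G S d" and ev: "ev g = 0"
  shows "\<exists>h\<in>G S (d - 1). \<exists>k\<in>G S (d - 1). g = l1 * h + l2 * k"
proof -
  have fin: "finite S" using S finite_subset by blast
  obtain N where N: "nn {} (xpow S (int N) * g)"
    using clear_denominators[OF fin, of "{}" g] g by (auto simp: G_def)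
  let ?g = "xpow S (int N) * g"
  have gG: "?g \<in> G {} d"
    using G_mult[OF G_xpow[OF fin S, of "int N"] g] N by (auto simp: G_def)
  have "ev ?g = ev (xpow S (int N)) * ev g" by (rule ev_mult[OF G_xpow[OF fin S] g S])
  then have "ev ?g = 0" using ev by simp
  then obtain h k where hk: "nn {} h" "nn {} k" "?g = l1 * h + l2 * k"
    using relations_polynomial[OF N, of d] gG by (auto simp: G_def)
  let ?r = "restr (\<lambda>\<mu>. tdeg \<mu> = d - 1) :: 'a laur \<Rightarrow> 'a laur"
  \<comment> \<open>The degree in the variables of index at least 9, which the type
    \<open>laur\<close> also provides. It vanishes on \<open>l1\<close>, \<open>l2\<close> and
    \<open>?g\<close>, and a monomial with nonnegative exponents and \<open>w = 0\<close> contains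
    none of these variables.\<close>
  define w :: "(nat \<Rightarrow>\<^sub>0 int) \<Rightarrow> int" where "w \<mu> = (\<Sum>i\<in>ks \<mu> \<inter> {9..}. lk \<mu> i)" for \<mu>
  have w_sup: "w \<mu> = (\<Sum>i\<in>A \<inter> {9..}. lk \<mu> i)" if "finite A" "ks \<mu> \<subseteq> A" for \<mu> A
    unfolding w_def using that by (intro sum.mono_neutral_left) (auto simp: in_keys_iff)
  have w_add: "w (\<mu> + \<nu>) = w \<mu> + w \<nu>" for \<mu> \<nu>
    using keys_add[of \<mu> \<nu>]
    by (simp add: w_sup[of "ks \<mu> \<union> ks \<nu>"] lookup_add sum.distrib)
  have w_pair: "w (sg i 1 + sg j 1) = 0" if "i < 9" "j < 9" for i j
    unfolding w_def using that by (intro sum.neutral) (auto simp: lookup_add lookup_single when_def)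
  let ?s = "restr (\<lambda>\<mu>. w \<mu> = 0) :: 'a laur \<Rightarrow> 'a laur"
  have l1w: "w \<mu> = 0" "tdeg \<mu> = 1" if "\<mu> \<in> ks (l1 :: 'a laur)" for \<mu>
    using that by (auto simp: keys_l1 w_pair tdeg_def lookup_add lookup_single when_def simp del: single_one)
  have l2w: "w \<mu> = 0" "tdeg \<mu> = 1" if "\<mu> \<in> ks (l2 :: 'a laur)" for \<mu>
    using that by (auto simp: keys_l2 w_pair tdeg_def lookup_add lookup_single when_def)
  have gk: "tdeg \<mu> = d" "w \<mu> = 0" if "\<mu> \<in> ks ?g" for \<mu>
    using that gG unfolding G_def w_def by (auto intro!: sum.neutral)
  have "?g = restr (\<lambda>\<mu>. w \<mu> = 0) (restr (\<lambda>\<mu>. tdeg \<mu> = d) ?g)"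
    using gk by (subst (2) restr_all) (auto intro!: restr_all[symmetric])
  also have "\<dots> = restr (\<lambda>\<mu>. w \<mu> = 0) (l1 * ?r h + l2 * ?r k)"
    unfolding hk(3) restr_add
    by (simp add: restr_times_homogeneous[where w = tdeg and b = 1, OF tdeg_add] l1w l2w)
  also have "\<dots> = l1 * ?s (?r h) + l2 * ?s (?r k)"
    unfolding restr_add
    by (simp add: restr_times_homogeneous[where w = w and b = 0, OF w_add] l1w l2w)
  finally have eq: "?g = l1 * ?s (?r h) + l2 * ?s (?r k)" .
  have inG: "?s (?r q) \<in> G S (d - 1)" if "nn {} q" for q
  proof -
    have "lk \<mu> i = 0" if \<mu>: "\<mu> \<in> ks (?s (?r q))" and "9 \<le> i" for \<mu> i
    proof -
      have "\<mu> \<in> ks q" "w \<mu> = 0" using \<mu> by (auto simp: keys_restr)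
      then have "\<forall>i\<in>ks \<mu> \<inter> {9..}. lk \<mu> i = 0"
        using \<open>nn {} q\<close> unfolding w_def by (subst (asm) sum_nonneg_eq_0_iff) (auto simp: nn_def)
      then show ?thesis using \<open>9 \<le> i\<close> by (cases "i \<in> ks \<mu>") (auto simp: in_keys_iff)
    qed
    then show ?thesis using that by (auto simp: G_def nn_def keys_restr)
  qed
  have "xpow S (- int N) * ?s (?r h) \<in> G S (0 + (d - 1))" "xpow S (- int N) * ?s (?r k) \<in> G S (0 + (d - 1))"
    by (intro G_mult G_xpow fin S inG hk)+
  moreover have "g = xpow S (- int N) * ?g" by (simp add: mult.assoc[symmetric])
  then have "g = l1 * (xpow S (- int N) * ?s (?r h)) + l2 * (xpow S (- int N) * ?s (?r k))"
    by (subst (asm) eq) (simp add: algebra_simps)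
  ultimately show ?thesis by auto
qed

section \<open>The Cech complex with Laurent polynomial coefficients\<close>

definition esg :: "nat set \<Rightarrow> nat \<Rightarrow> 'b::comm_ring_1" where
  "esg T j = (-1) ^ card {i \<in> T. i < j}"

text \<open>The Cech differential inside one Laurent ring: the localization maps are inclusions and
  leave no trace, and the signs agree with those of \<open>cech_diff\<close>.\<close>

definition delta :: "(nat set \<Rightarrow> 'b::comm_ring_1) \<Rightarrow> nat set \<Rightarrow> 'b" where
  "delta c T = (\<Sum>j\<in>T. esg T j * c (T - {j}))"

lemma esg_cases: "esg T j = (1 :: 'b::comm_ring_1) \<or> esg T j = (-1 :: 'b)"
  unfolding esg_def by (metis neg_one_even_power neg_one_odd_power)

lemma esg_square [simp]:
  fixes x :: "'b::comm_ring_1"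
  shows "esg T j * esg T j = (1 :: 'b)" "esg T j * (esg T j * x) = x"
  using esg_cases[of T j, where 'b = 'b] by auto

lemma esg_swap:
  assumes "finite T" "i \<in> T" "j \<in> T" "i \<noteq> j"
  shows "esg T j * esg (T - {j}) i = - (esg T i * esg (T - {i}) j :: 'b::comm_ring_1)"
proof -
  have *: "esg T j * esg (T - {j}) i = - (esg T i * esg (T - {i}) j :: 'b)"
    if "i \<in> T" "j \<in> T" "i < j" for i j
  proof -
    have "{k \<in> T - {j}. k < i} = {k \<in> T. k < i}" using that by auto
    moreover have "{k \<in> T. k < j} = insert i {k \<in> T - {i}. k < j}" using that by auto
    then have "card {k \<in> T. k < j} = Suc (card {k \<in> T - {i}. k < j})" using assms(1) by simp
    ultimately show ?thesis by (simp add: esg_def mult_ac)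
  qed
  show ?thesis
  proof (cases "i < j")
    case True
    then show ?thesis using * assms by blast
  next
    case False
    then have "esg T i * esg (T - {i}) j = - (esg T j * esg (T - {j}) i :: 'b)"
      using * assms by (metis nat_neq_iff)
    then show ?thesis by simp
  qed
qed

text \<open>The summand is antisymmetric in the two removed indices, so the double sum equals its
  own negative; 2 is then cancelled in each coefficient.\<close>

lemma delta_delta:
  fixes c :: "nat set \<Rightarrow> 'a::field_char_0 laur"
  assumes "finite T"
  shows "delta (delta c) T = 0"
proof -
  let ?F = "\<lambda>j i. esg T j * (esg (T - {j}) i * c (T - {j} - {i}))"
  \<comment> \<open>Zero on the diagonal, so that both indices run over all of \<open>T\<close> and
    the sums can be swapped.\<close>
  let ?H = "\<lambda>j i. if i = j then 0 else ?F j i"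
  have anti: "?H j i = - ?H i j" if "i \<in> T" "j \<in> T" for i j
  proof (cases "i = j")
    case False
    have "T - {j} - {i} = T - {i} - {j}" by auto
    moreover have "esg T j * esg (T - {j}) i = - (esg T i * esg (T - {i}) j :: 'a laur)"
      using esg_swap[OF assms that False] .
    ultimately show ?thesis using False by (simp add: mult.assoc[symmetric])
  qed simp
  have "delta (delta c) T = (\<Sum>j\<in>T. \<Sum>i\<in>T. ?H j i)"
    unfolding delta_def sum_distrib_left
  proof (rule sum.cong[OF refl])
    fix j assume "j \<in> T"
    have "(\<Sum>i\<in>T. ?H j i) = (\<Sum>i\<in>T - {j}. ?H j i)"
      using assms \<open>j \<in> T\<close> by (intro sum.mono_neutral_right) auto
    also have "\<dots> = (\<Sum>i\<in>T - {j}. ?F j i)" by (rule sum.cong) auto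
    finally show "(\<Sum>i\<in>T - {j}. ?F j i) = (\<Sum>i\<in>T. ?H j i)" ..
  qed
  moreover have "(\<Sum>j\<in>T. \<Sum>i\<in>T. ?H j i) = - (\<Sum>j\<in>T. \<Sum>i\<in>T. ?H j i)"
  proof -
    have "(\<Sum>j\<in>T. \<Sum>i\<in>T. ?H j i) = (\<Sum>j\<in>T. \<Sum>i\<in>T. - ?H i j)"
      by (intro sum.cong refl anti)
    also have "\<dots> = - (\<Sum>j\<in>T. \<Sum>i\<in>T. ?H i j)" by (simp only: sum_negf)
    also have "(\<Sum>j\<in>T. \<Sum>i\<in>T. ?H i j) = (\<Sum>j\<in>T. \<Sum>i\<in>T. ?H j i)" by (rule sum.swap)
    finally show ?thesis .
  qed
  ultimately have "delta (delta c) T = - delta (delta c) T" by simp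
  then have "lk (delta (delta c) T) k = - lk (delta (delta c) T) k" for k
    by (metis lookup_uminus)
  then have "lk (delta (delta c) T) k = 0" for k
    using eq_neg_iff_add_eq_0 by (metis double_zero mult_2 mult_eq_0_iff zero_neq_numeral)
  then show ?thesis by (intro poly_mapping_eqI) simp
qed

lemma delta_cong:
  "(\<And>j. j \<in> T \<Longrightarrow> c (T - {j}) = d (T - {j})) \<Longrightarrow> delta c T = delta d T"
  unfolding delta_def by (rule sum.cong) auto

lemma delta_additive:
  assumes "\<And>p q. f (p + q) = f p + (f q :: 'b::comm_ring_1)"
  shows "delta (\<lambda>S. f (c S)) T = f (delta c T)"
proof -
  have f0: "f 0 = 0" using assms[of 0 0] by simp
  have fm: "f (- p) = - f p" for p using assms[of p "- p"] f0 by (simp add: eq_neg_iff_add_eq_0 add.commute)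
  have fe: "esg T j * f p = f (esg T j * p)" for j p
  proof (cases "even (card {i \<in> T. i < j})")
  qed (simp_all add: esg_def fm)
  have fs: "f (sum g A) = (\<Sum>a\<in>A. f (g a))" for g :: "nat \<Rightarrow> 'a" and A
    by (induction A rule: infinite_finite_induct) (auto simp: f0 assms)
  show ?thesis by (simp add: delta_def fe fs)
qed

lemma delta_add: "delta (\<lambda>S. c S + d S) T = delta c T + delta d T"
  by (simp add: delta_def distrib_left sum.distrib)
lemma delta_diff: "delta (\<lambda>S. c S - d S) T = delta c T - delta d T"
  by (simp add: delta_def right_diff_distrib sum_subtractf)
lemma delta_mult: "delta (\<lambda>S. l * c S) T = l * delta c T"
  by (rule delta_additive) (simp add: distrib_left)
lemma delta_restr: "delta (\<lambda>S. restr P (c S)) T = restr P (delta c T)" for c :: "nat set \<Rightarrow> 'a::field laur"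
  by (rule delta_additive) (rule restr_add)
lemma delta_ev: "delta (\<lambda>S. ev (c S)) T = ev (delta c T)"
  by (rule delta_additive) (rule ev_add)

section \<open>Cochains on the six indeterminates and vanishing below the top degree\<close>

abbreviation V :: "nat set" where "V \<equiv> {..<6}"

lemma finite_subV: "S \<subseteq> V \<Longrightarrow> finite S" using finite_subset by blast

text \<open>Values at other sets are left free, so pointwise formulas such as
  \<open>\<lambda>S. l1 * h S\<close> define cochains without restriction to an index set.\<close>

definition co :: "nat \<Rightarrow> int \<Rightarrow> (nat set \<Rightarrow> 'a::field laur) \<Rightarrow> bool" where
  "co k d c \<longleftrightarrow> (\<forall>S. S \<subseteq> V \<longrightarrow> card S = k \<longrightarrow> c S \<in> G S d)"

lemma coD: "co k d c \<Longrightarrow> S \<subseteq> V \<Longrightarrow> card S = k \<Longrightarrow> c S \<in> G S d" by (simp add: co_def)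

lemma G_esg:
  fixes p :: "'a::field laur"
  shows "p \<in> G S d \<Longrightarrow> esg T j * p \<in> G S d"
  using esg_cases[of T j, where 'b = "'a laur"] by (auto intro: G_uminus)

lemma card_remove_subV: "S \<subseteq> V \<Longrightarrow> j \<in> S \<Longrightarrow> card S = Suc k \<Longrightarrow> card (S - {j}) = k"
  using finite_subV by simp

lemma co_delta: "co k d c \<Longrightarrow> co (Suc k) d (delta c)"
  unfolding co_def delta_def
  by (auto intro!: G_sum G_esg intro: G_mono simp: card_remove_subV)
     (metis Diff_subset G_mono card_remove_subV diff_Suc_1 order_trans)

text \<open>The top cohomology of the Cech complex of \<open>R\<close> is spanned by the monomials all of whose six
  exponents are negative; \<open>negl q\<close> says that \<open>q\<close> represents zero there.\<close>

definition negl :: "'a::field laur \<Rightarrow> bool" where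
  "negl q \<longleftrightarrow> (\<forall>\<mu>\<in>ks q. \<exists>i<6. 0 \<le> lk \<mu> i)"

lemma negl_add: "negl p \<Longrightarrow> negl q \<Longrightarrow> negl (p + q)"
  unfolding negl_def using keys_add[of p q] by blast
lemma negl_uminus: "negl p \<Longrightarrow> negl (- p)"
  by (simp add: negl_def in_keys_iff)
lemma negl_zero: "negl 0" by (simp add: negl_def)
lemma negl_sum: "(\<And>i. i \<in> A \<Longrightarrow> negl (f i)) \<Longrightarrow> negl (sum f A)"
  by (induction A rule: infinite_finite_induct) (auto intro: negl_add simp: negl_zero)
lemma negl_G: "p \<in> G S d \<Longrightarrow> S \<subset> V \<Longrightarrow> negl p"
  unfolding G_def negl_def nn_def by blast
lemma negl_esg:
  fixes p :: "'a::field laur"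
  shows "negl p \<Longrightarrow> negl (esg T j * p)"
  using esg_cases[of T j, where 'b = "'a laur"] by (auto intro: negl_uminus)

lemma negl_delta: "co 5 d c \<Longrightarrow> negl (delta c V)"
  unfolding delta_def
proof (rule negl_sum)
  fix j assume "co 5 d c" "j \<in> V"
  then have "c (V - {j}) \<in> G (V - {j}) d" by (intro coD) auto
  with \<open>j \<in> V\<close> show "negl (esg V j * c (V - {j}))" by (intro negl_esg negl_G) auto
qed

text \<open>The minimum is over all of \<open>nat\<close>, where it exists because supports are
  finite; \<open>negl\<close> is what forces it below 6.\<close>

definition first :: "(nat \<Rightarrow>\<^sub>0 int) \<Rightarrow> nat" where "first \<mu> = (LEAST i. 0 \<le> lk \<mu> i)"

text \<open>On the monomials \<open>\<mu>\<close> with \<open>first \<mu> = j\<close> the Cech complex does not change when \<open>j\<close> is removed from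
  or added to the index set, so toggling \<open>j\<close> contracts it.\<close>

definition homotopy :: "(nat set \<Rightarrow> 'a::field laur) \<Rightarrow> nat set \<Rightarrow> 'a laur" where
  "homotopy c S = (\<Sum>j\<in>V - S. esg (insert j S) j * restr (\<lambda>\<mu>. first \<mu> = j) (c (insert j S)))"

lemma ex_nonneg_exponent: "\<exists>i. 0 \<le> lk (\<mu> :: nat \<Rightarrow>\<^sub>0 int) i"
proof -
  have "\<exists>i. i \<notin> ks \<mu>" by (metis finite_keys infinite_UNIV_nat UNIV_I subsetI finite_subset)
  then show ?thesis by (metis in_keys_iff order_refl)
qed

lemma first_nonneg: "0 \<le> lk \<mu> (first \<mu>)"
  unfolding first_def by (rule LeastI_ex) (rule ex_nonneg_exponent)

lemma first_le: "0 \<le> lk \<mu> i \<Longrightarrow> first \<mu> \<le> i"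
  unfolding first_def by (rule Least_le)

lemma co_homotopy:
  assumes "co (Suc k) d c"
  shows "co k d (homotopy c)"
  unfolding co_def homotopy_def
proof (intro allI impI G_sum G_esg)
  fix S j assume S: "S \<subseteq> V" "card S = k" and j: "j \<in> V - S"
  have "c (insert j S) \<in> G (insert j S) d"
    using S j finite_subV by (intro coD[OF assms]) auto
  moreover have "0 \<le> lk \<mu> j" if "first \<mu> = j" for \<mu>
    using that first_nonneg[of \<mu>] by simp
  ultimately show "restr (\<lambda>\<mu>. first \<mu> = j) (c (insert j S)) \<in> G S d"
    by (auto simp: G_def nn_def keys_restr) (metis insertE)
qed

lemma sum_first:
  assumes "negl q"
  shows "(\<Sum>j<6. restr (\<lambda>\<mu>. first \<mu> = j) q) = q"
proof (rule poly_mapping_eqI)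
  fix \<mu>
  have "(\<Sum>j<6. if first \<mu> = j then lk q \<mu> else 0) = lk q \<mu>"
  proof (cases "\<mu> \<in> ks q")
    case True
    then obtain i where "i < 6" "0 \<le> lk \<mu> i" using assms by (auto simp: negl_def)
    then have "first \<mu> < 6" using first_le[of \<mu> i] by simp
    then show ?thesis by (simp add: sum.delta)
  qed (simp add: in_keys_iff)
  then show "lk (\<Sum>j<6. restr (\<lambda>\<mu>. first \<mu> = j) q) \<mu> = lk q \<mu>"
    by (simp add: lookup_sum lookup_restr)
qed

text \<open>Toggling \<open>i \<in> S\<close> yields the component of \<open>c S\<close> at
  \<open>i\<close> directly (\<open>A\<close>). The mixed terms, with \<open>j\<close> outside
  \<open>S\<close>, are evaluated by the cocycle condition on \<open>insert j S\<close> and yield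
  the component at \<open>j\<close> (\<open>B\<close>).\<close>

lemma delta_homotopy:
  fixes c :: "nat set \<Rightarrow> 'a::field laur"
  assumes S: "S \<subseteq> V" and c: "\<And>j. j \<in> V - S \<Longrightarrow> delta c (insert j S) = 0"
  shows "delta (homotopy c) S = (\<Sum>j<6. restr (\<lambda>\<mu>. first \<mu> = j) (c S))"
proof -
  let ?\<pi> = "\<lambda>j. restr (\<lambda>\<mu>. first \<mu> = j) :: 'a laur \<Rightarrow> 'a laur"
  have fin: "finite S" using S finite_subV by blast
  have A: "esg S i * homotopy c (S - {i}) = ?\<pi> i (c S) +
      (\<Sum>j\<in>V - S. esg S i * (esg (insert j S - {i}) j * ?\<pi> j (c (insert j S - {i}))))"
    if i: "i \<in> S" for i
  proof -
    have eq: "V - (S - {i}) = insert i (V - S)" using i S by auto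
    have "homotopy c (S - {i}) = esg S i * ?\<pi> i (c S) +
        (\<Sum>j\<in>V - S. esg (insert j (S - {i})) j * ?\<pi> j (c (insert j (S - {i}))))"
      unfolding homotopy_def eq using i by (simp add: insert_absorb)
    also have "(\<Sum>j\<in>V - S. esg (insert j (S - {i})) j * ?\<pi> j (c (insert j (S - {i})))) =
        (\<Sum>j\<in>V - S. esg (insert j S - {i}) j * ?\<pi> j (c (insert j S - {i})))"
    proof (rule sum.cong[OF refl])
      fix j assume "j \<in> V - S"
      then have "insert j (S - {i}) = insert j S - {i}" using i by auto
      then show "esg (insert j (S - {i})) j * ?\<pi> j (c (insert j (S - {i}))) =
        esg (insert j S - {i}) j * ?\<pi> j (c (insert j S - {i}))" by simp
    qed
    finally show ?thesis by (simp add: distrib_left sum_distrib_left)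
  qed
  have B: "(\<Sum>i\<in>S. esg S i * (esg (insert j S - {i}) j * ?\<pi> j (c (insert j S - {i})))) = ?\<pi> j (c S)"
    if j: "j \<in> V - S" for j
  proof -
    let ?T = "insert j S"
    have Tj: "?T - {j} = S" using j by auto
    have "?\<pi> j (delta c ?T) = 0" using c[OF j] by simp
    then have "delta (\<lambda>S. ?\<pi> j (c S)) ?T = 0" by (simp add: delta_restr)
    then have z: "esg ?T j * ?\<pi> j (c S) + (\<Sum>i\<in>S. esg ?T i * ?\<pi> j (c (?T - {i}))) = 0"
      using j fin Tj unfolding delta_def by simp
    have "(\<Sum>i\<in>S. esg S i * (esg (?T - {i}) j * ?\<pi> j (c (?T - {i})))) =
      (\<Sum>i\<in>S. - (esg ?T j * (esg ?T i * ?\<pi> j (c (?T - {i})))))"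
    proof (rule sum.cong[OF refl])
      fix i assume i: "i \<in> S"
      have "esg ?T j * esg S i = - (esg ?T i * esg (?T - {i}) j :: 'a laur)"
        using esg_swap[of ?T i j] i j fin Tj by auto
      then have "esg ?T j * (esg ?T j * esg S i) * (esg (?T - {i}) j) =
          esg ?T j * (- (esg ?T i * esg (?T - {i}) j)) * (esg (?T - {i}) j :: 'a laur)" by simp
      then have "esg S i * esg (?T - {i}) j = - (esg ?T j * esg ?T i :: 'a laur)"
        by (simp add: mult.assoc)
      then show "esg S i * (esg (?T - {i}) j * ?\<pi> j (c (?T - {i}))) =
        - (esg ?T j * (esg ?T i * ?\<pi> j (c (?T - {i}))))"
        by (simp add: mult.assoc[symmetric])
    qed
    also have "\<dots> = - (esg ?T j * (\<Sum>i\<in>S. esg ?T i * ?\<pi> j (c (?T - {i}))))"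
      by (simp add: sum_negf sum_distrib_left)
    also have "(\<Sum>i\<in>S. esg ?T i * ?\<pi> j (c (?T - {i}))) = - (esg ?T j * ?\<pi> j (c S))"
      using z by (simp add: eq_neg_iff_add_eq_0 add.commute)
    finally show ?thesis by simp
  qed
  have "delta (homotopy c) S = (\<Sum>i\<in>S. ?\<pi> i (c S)) +
      (\<Sum>i\<in>S. \<Sum>j\<in>V - S. esg S i * (esg (insert j S - {i}) j * ?\<pi> j (c (insert j S - {i}))))"
    unfolding delta_def using A by (simp add: sum.distrib)
  also have "(\<Sum>i\<in>S. \<Sum>j\<in>V - S. esg S i * (esg (insert j S - {i}) j * ?\<pi> j (c (insert j S - {i})))) =
      (\<Sum>j\<in>V - S. ?\<pi> j (c S))"
    by (subst sum.swap) (rule sum.cong[OF refl B])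
  also have "(\<Sum>i\<in>S. ?\<pi> i (c S)) + (\<Sum>j\<in>V - S. ?\<pi> j (c S)) = (\<Sum>j\<in>V. ?\<pi> j (c S))"
    using sum.subset_diff[OF S, of "\<lambda>j. ?\<pi> j (c S)"] by (simp add: add.commute)
  finally show ?thesis .
qed

text \<open>A set of fewer than six indices leaves some indeterminate uninverted, so
  \<open>c S\<close> is negligible and its components by \<open>first\<close> add up to all of
  it.\<close>

lemma cech_exact:
  assumes c: "co (Suc k) d c" and k: "Suc k < 6"
    and z: "\<And>T. T \<subseteq> V \<Longrightarrow> card T = Suc (Suc k) \<Longrightarrow> delta c T = 0"
  shows "\<exists>b. co k d b \<and> (\<forall>S. S \<subseteq> V \<longrightarrow> card S = Suc k \<longrightarrow> c S = delta b S)"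
proof (intro exI conjI allI impI)
  show "co k d (homotopy c)" by (rule co_homotopy[OF c])
  fix S assume S: "S \<subseteq> V" "card S = Suc k"
  have "S \<noteq> V" using S k by auto
  then have "negl (c S)" using coD[OF c S] S(1) by (intro negl_G) auto
  moreover have "delta c (insert j S) = 0" if "j \<in> V - S" for j
    using that S finite_subV by (intro z) auto
  ultimately show "c S = delta (homotopy c) S"
    using S(1) by (subst delta_homotopy) (simp_all add: sum_first)
qed

text \<open>Only \<open>V\<close> has six elements, so \<open>q\<close> may serve as a constant
  cochain, and there is no larger subset of \<open>V\<close> on which to ask for a cocycle
  condition.\<close>

lemma cech_exact_top:
  assumes q: "q \<in> G V d" "negl q"
  shows "\<exists>b. co 5 d b \<and> delta b V = q"
proof (intro exI conjI)
  have "co (Suc 5) d (\<lambda>_. q)"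
  proof -
    have "S = V" if "S \<subseteq> V" "card S = 6" for S using that by (intro card_subset_eq) auto
    then show ?thesis using q(1) by (auto simp: co_def)
  qed
  then show "co 5 d (homotopy (\<lambda>_. q))" by (rule co_homotopy)
  show "delta (homotopy (\<lambda>_. q)) V = q" using q(2) by (subst delta_homotopy) (auto simp: sum_first)
qed

section \<open>The zigzag to the top cohomology\<close>

text \<open>\<open>c\<close> is a lift of a \<open>3\<close>-cocycle with values in \<open>R / I\<^sup>t\<close>, and \<open>q\<close> is its image under the
  iterated connecting homomorphism of the resolution of \<open>R / I\<^sup>t\<close> by graded pieces of the Koszul
  complex on \<open>l\<^sub>1\<close> and \<open>l\<^sub>2\<close>.\<close>

definition zigzag :: "int \<Rightarrow> (nat set \<Rightarrow> 'a::field laur) \<Rightarrow> 'a laur \<Rightarrow> bool" where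
  "zigzag t c q \<longleftrightarrow> (\<exists>g h k. co 4 t g \<and> co 5 (t - 1) h \<and> co 5 (t - 1) k \<and> q \<in> G V (t - 2) \<and>
     (\<forall>T. T \<subseteq> V \<longrightarrow> card T = 4 \<longrightarrow> delta c T = ev (g T)) \<and>
     (\<forall>U. U \<subseteq> V \<longrightarrow> card U = 5 \<longrightarrow> delta g U = l1 * h U + l2 * k U) \<and>
     delta h V = l2 * q \<and> delta k V = - l1 * q)"

lemma zigzagI:
  assumes "co 4 t g" "co 5 (t - 1) h" "co 5 (t - 1) k" "q \<in> G V (t - 2)"
    "\<And>T. T \<subseteq> V \<Longrightarrow> card T = 4 \<Longrightarrow> delta c T = ev (g T)"
    "\<And>U. U \<subseteq> V \<Longrightarrow> card U = 5 \<Longrightarrow> delta g U = l1 * h U + l2 * k U"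
    "delta h V = l2 * q" "delta k V = - l1 * q"
  shows "zigzag t c q"
  unfolding zigzag_def using assms by blast

lemma G_l1_mult: "p \<in> G S (d - 1) \<Longrightarrow> l1 * p \<in> G S d"
  and G_l2_mult: "p \<in> G S (d - 1) \<Longrightarrow> l2 * p \<in> G S d"
  using G_mult[OF G_l1, of p S "d - 1"] G_mult[OF G_l2, of p S "d - 1"] by auto

lemma V_eq: "S \<subseteq> V \<Longrightarrow> card S = 6 \<Longrightarrow> S = V"
  by (intro card_subset_eq) auto

lemma co_choice:
  assumes "\<And>S. S \<subseteq> V \<Longrightarrow> card S = k \<Longrightarrow> \<exists>x\<in>G S d. P S x"
  shows "\<exists>c. co k d c \<and> (\<forall>S. S \<subseteq> V \<longrightarrow> card S = k \<longrightarrow> P S (c S))"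
proof -
  have "\<forall>S\<in>{S. S \<subseteq> V \<and> card S = k}. \<exists>x. x \<in> G S d \<and> P S x" using assms by blast
  from bchoice[OF this] show ?thesis by (auto simp: co_def)
qed

text \<open>\<open>ev\<close> kills \<open>delta g\<close> because \<open>delta\<close> squares to
  zero, so \<open>relations_exact\<close> supplies \<open>h\<close> and \<open>k\<close>; applying
  \<open>delta\<close> once more leaves a Koszul relation on \<open>V\<close>, which yields
  \<open>q\<close>.\<close>

lemma zigzag_exists:
  fixes c :: "nat set \<Rightarrow> 'a::field_char_0 laur"
  assumes c: "co 3 0 c" and z: "\<And>T. T \<subseteq> V \<Longrightarrow> card T = 4 \<Longrightarrow> delta c T \<in> ev ` G T t"
  shows "\<exists>q. zigzag t c q"
proof -
  have "\<exists>x\<in>G T t. delta c T = ev x" if "T \<subseteq> V" "card T = 4" for T using z[OF that] by auto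
  from co_choice[OF this, simplified] obtain g where
    g: "co 4 t g" "\<And>T. T \<subseteq> V \<Longrightarrow> card T = 4 \<Longrightarrow> delta c T = ev (g T)" by blast
  have "\<exists>h\<in>G U (t - 1). \<exists>k\<in>G U (t - 1). delta g U = l1 * h + l2 * k"
    if U: "U \<subseteq> V" "card U = 5" for U
  proof (rule relations_exact)
    show "U \<subseteq> V" by fact
    show "delta g U \<in> G U t" using co_delta[OF g(1)] U by (auto intro: coD)
    have "ev (delta g U) = delta (\<lambda>T. ev (g T)) U" by (simp add: delta_ev)
    also have "\<dots> = delta (delta c) U"
    proof (rule delta_cong)
      fix j assume "j \<in> U"
      then have "card (U - {j}) = 4" "U - {j} \<subseteq> V" using U card_remove_subV[of U j 4] by auto
      then show "ev (g (U - {j})) = delta c (U - {j})" using g(2) by metis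
    qed
    also have "\<dots> = 0" using U finite_subV by (intro delta_delta) auto
    finally show "ev (delta g U) = 0" .
  qed
  from co_choice[OF this, simplified] obtain h where h: "co 5 (t - 1) h"
    "\<And>U. U \<subseteq> V \<Longrightarrow> card U = 5 \<Longrightarrow> \<exists>k\<in>G U (t - 1). delta g U = l1 * h U + l2 * k" by blast
  from co_choice[OF h(2), simplified] obtain k where k: "co 5 (t - 1) k"
    "\<And>U. U \<subseteq> V \<Longrightarrow> card U = 5 \<Longrightarrow> delta g U = l1 * h U + l2 * k U" by blast
  have "delta (delta g) V = delta (\<lambda>U. l1 * h U + l2 * k U) V"
    by (intro delta_cong k(2)) auto
  then have "l1 * delta h V + l2 * delta k V = 0"
    by (simp add: delta_delta delta_add delta_mult)
  moreover have "delta h V \<in> G V (t - 1)" using co_delta[OF h(1)] by (auto intro: coD)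
  ultimately obtain q where "q \<in> G V (t - 1 - 1)" "delta h V = l2 * q" "delta k V = - l1 * q"
    using koszul_exact by blast
  then have "zigzag t c q" unfolding zigzag_def
    using g h(1) k by (intro exI[of _ g] exI[of _ h] exI[of _ k]) (simp add: algebra_simps)
  then show ?thesis ..
qed

text \<open>The zigzag run backwards. The negligibility hypotheses make \<open>l2 * q\<close> and
  \<open>- l1 * q\<close> coboundaries in the top degree; the other preimages exist because
  cohomology vanishes in degrees 5 and 4.\<close>

lemma zigzag_realizes:
  fixes q :: "'a::field_char_0 laur"
  assumes q: "q \<in> G V (t - 2)" and n1: "negl (l1 * q)" and n2: "negl (l2 * q)"
  shows "\<exists>c. co 3 0 c \<and> zigzag t c q"
proof -
  have "l2 * q \<in> G V (t - 1)" "- l1 * q \<in> G V (t - 1)"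
    using q G_l2_mult[of q V "t - 1"] G_uminus[OF G_l1_mult[of q V "t - 1"]] by auto
  then obtain h k where h: "co 5 (t - 1) h" "delta h V = l2 * q"
    and k: "co 5 (t - 1) k" "delta k V = - l1 * q"
    using cech_exact_top[of "l2 * q" "t - 1"] cech_exact_top[of "- l1 * q" "t - 1"] n1 n2
      negl_uminus[OF n1] by auto
  let ?g = "\<lambda>U. l1 * h U + l2 * k U"
  have "co (Suc 4) t ?g"
    using h(1) k(1) by (auto simp: co_def intro!: G_add G_l1_mult G_l2_mult)
  moreover have "delta ?g T = 0" if "T \<subseteq> V" "card T = Suc (Suc 4)" for T
    using V_eq[of T] that by (simp add: delta_add delta_mult h k)
  ultimately obtain g where g: "co 4 t g" "\<And>U. U \<subseteq> V \<Longrightarrow> card U = 5 \<Longrightarrow> ?g U = delta g U"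
    using cech_exact[of 4 t ?g] by auto
  let ?c = "\<lambda>T. ev (g T)"
  have "co (Suc 3) 0 ?c" using g(1) by (auto simp: co_def intro: ev_in_G)
  moreover have "delta ?c U = 0" if "U \<subseteq> V" "card U = Suc (Suc 3)" for U
  proof -
    have G5: "h U \<in> G U (t - 1)" "k U \<in> G U (t - 1)"
      using coD[OF h(1)] coD[OF k(1)] that by auto
    have "delta ?c U = ev (l1 * h U + l2 * k U)" using that g(2)[of U] by (simp add: delta_ev)
    also have "\<dots> = 0"
      using ev_mult[OF G_l1 G5(1) that(1)] ev_mult[OF G_l2 G5(2) that(1)]
      by (simp add: ev_add ev_l1 ev_l2)
    finally show ?thesis .
  qed
  ultimately obtain c where c: "co 3 0 c" "\<And>T. T \<subseteq> V \<Longrightarrow> card T = 4 \<Longrightarrow> ?c T = delta c T"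
    using cech_exact[of 3 0 ?c] by auto
  have "zigzag t c q" unfolding zigzag_def
    using g h k c q by (intro exI[of _ g] exI[of _ h] exI[of _ k]) simp
  with c(1) show ?thesis by blast
qed

lemma zigzag_negl:
  assumes "zigzag t c q"
  shows "negl (l1 * q)" "negl (l2 * q)"
proof -
  obtain h k where "co 5 (t - 1) h" "co 5 (t - 1) k" "delta h V = l2 * q" "delta k V = - l1 * q"
    using assms by (auto simp: zigzag_def)
  then have "negl (l2 * q)" "negl (- l1 * q)" using negl_delta by metis+
  then show "negl (l1 * q)" "negl (l2 * q)" using negl_uminus[of "- l1 * q"] by auto
qed

text \<open>With \<open>q = delta p V\<close>, the Koszul images of \<open>p\<close> turn
  \<open>h\<close> and \<open>k\<close> into cocycles. Their primitives correct \<open>g\<close> by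
  an element killed by \<open>ev\<close>, and a primitive of the result corrects \<open>c\<close> by
  an element of the image of \<open>ev\<close>. The primitives exist by vanishing in degrees 5, 4
  and 3.\<close>

lemma zigzag_injective:
  fixes c :: "nat set \<Rightarrow> 'a::field_char_0 laur"
  assumes c: "co 3 0 c" and zz: "zigzag t c q" and q: "negl q"
  shows "\<exists>b. co 2 0 b \<and> (\<forall>S. S \<subseteq> V \<longrightarrow> card S = 3 \<longrightarrow> c S - delta b S \<in> ev ` G S t)"
proof -
  obtain g h k where g: "co 4 t g" "\<And>T. T \<subseteq> V \<Longrightarrow> card T = 4 \<Longrightarrow> delta c T = ev (g T)"
    and h: "co 5 (t - 1) h" and k: "co 5 (t - 1) k" and qG: "q \<in> G V (t - 2)"
    and gU: "\<And>U. U \<subseteq> V \<Longrightarrow> card U = 5 \<Longrightarrow> delta g U = l1 * h U + l2 * k U"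
    and hV: "delta h V = l2 * q" and kV: "delta k V = - l1 * q"
    using zz unfolding zigzag_def by blast
  obtain p where p: "co 5 (t - 2) p" "delta p V = q" using cech_exact_top[OF qG q] by blast
  have l1p: "co 5 (t - 1) (\<lambda>U. l1 * p U)" and l2p: "co 5 (t - 1) (\<lambda>U. l2 * p U)"
    using p(1) by (auto simp: co_def intro!: G_l1_mult G_l2_mult)
  have "co (Suc 4) (t - 1) (\<lambda>U. h U - l2 * p U)"
    using h l2p by (auto simp: co_def intro: G_diff)
  moreover have "delta (\<lambda>U. h U - l2 * p U) T = 0" if "T \<subseteq> V" "card T = Suc (Suc 4)" for T
    using V_eq[of T] that by (simp add: delta_diff delta_mult hV p)
  ultimately obtain h' where h': "co 4 (t - 1) h'"
    "\<And>U. U \<subseteq> V \<Longrightarrow> card U = 5 \<Longrightarrow> h U - l2 * p U = delta h' U"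
    using cech_exact[of 4 "t - 1" "\<lambda>U. h U - l2 * p U"] by auto
  have "co (Suc 4) (t - 1) (\<lambda>U. k U + l1 * p U)"
    using k l1p by (auto simp: co_def intro: G_add)
  moreover have "delta (\<lambda>U. k U + l1 * p U) T = 0" if "T \<subseteq> V" "card T = Suc (Suc 4)" for T
    using V_eq[of T] that by (simp add: delta_add delta_mult kV p)
  ultimately obtain k' where k': "co 4 (t - 1) k'"
    "\<And>U. U \<subseteq> V \<Longrightarrow> card U = 5 \<Longrightarrow> k U + l1 * p U = delta k' U"
    using cech_exact[of 4 "t - 1" "\<lambda>U. k U + l1 * p U"] by auto
  let ?g = "\<lambda>T. g T - (l1 * h' T + l2 * k' T)"
  have "co (Suc 3) t ?g"
    using g(1) h'(1) k'(1)
    by (auto simp: co_def intro!: G_add G_diff G_l1_mult G_l2_mult)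
  moreover have "delta ?g U = 0" if U: "U \<subseteq> V" "card U = Suc (Suc 3)" for U
  proof -
    have "delta h' U = h U - l2 * p U" "delta k' U = k U + l1 * p U"
      using U h'(2)[of U] k'(2)[of U] by auto
    then show ?thesis
      using U by (simp add: delta_diff delta_add delta_mult gU) (simp add: algebra_simps)
  qed
  ultimately obtain g' where g': "co 3 t g'" "\<And>T. T \<subseteq> V \<Longrightarrow> card T = 4 \<Longrightarrow> ?g T = delta g' T"
    using cech_exact[of 3 t ?g] by auto
  have evg: "ev (g T) = ev (delta g' T)" if T: "T \<subseteq> V" "card T = 4" for T
  proof -
    have G4: "h' T \<in> G T (t - 1)" "k' T \<in> G T (t - 1)"
      using coD[OF h'(1)] coD[OF k'(1)] T by auto
    have "ev (g T) = ev (delta g' T + (l1 * h' T + l2 * k' T))"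
      using g'(2)[OF T, symmetric] by simp
    then show ?thesis
      using ev_mult[OF G_l1 G4(1) T(1)] ev_mult[OF G_l2 G4(2) T(1)]
      by (simp add: ev_add ev_l1 ev_l2)
  qed
  let ?c = "\<lambda>S. c S - ev (g' S)"
  have "co (Suc 2) 0 ?c" using c g'(1) by (auto simp: co_def eval_nat_numeral intro!: G_diff ev_in_G)
  moreover have "delta ?c T = 0" if "T \<subseteq> V" "card T = Suc (Suc 2)" for T
    using that by (simp add: delta_diff g(2) evg delta_ev)
  ultimately obtain b where b: "co 2 0 b" "\<And>S. S \<subseteq> V \<Longrightarrow> card S = 3 \<Longrightarrow> ?c S = delta b S"
    using cech_exact[of 2 0 ?c] by auto
  have "c S - delta b S \<in> ev ` G S t" if S: "S \<subseteq> V" "card S = 3" for S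
    using b(2)[OF S, symmetric] coD[OF g'(1) S] by simp
  with b(1) show ?thesis by blast
qed

text \<open>A second ladder one degree lower: \<open>j\<close> lifts \<open>c - delta b\<close>, the
  pair \<open>h'\<close>, \<open>k'\<close> expresses \<open>g - delta j\<close> by
  \<open>l1\<close> and \<open>l2\<close>, and \<open>p\<close> expresses
  \<open>h - delta h'\<close> by \<open>l2\<close>. Cancelling \<open>l2\<close> on \<open>V\<close>
  gives \<open>q = delta p V\<close>.\<close>

lemma zigzag_well_defined:
  fixes c :: "nat set \<Rightarrow> 'a::field_char_0 laur"
  assumes zz: "zigzag t c q"
    and cb: "\<And>S. S \<subseteq> V \<Longrightarrow> card S = 3 \<Longrightarrow> c S - delta b S \<in> ev ` G S t"
  shows "negl q"
proof -
  obtain g h k where g: "co 4 t g" "\<And>T. T \<subseteq> V \<Longrightarrow> card T = 4 \<Longrightarrow> delta c T = ev (g T)"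
    and h: "co 5 (t - 1) h" and k: "co 5 (t - 1) k" and qG: "q \<in> G V (t - 2)"
    and gU: "\<And>U. U \<subseteq> V \<Longrightarrow> card U = 5 \<Longrightarrow> delta g U = l1 * h U + l2 * k U"
    and hV: "delta h V = l2 * q" and kV: "delta k V = - l1 * q"
    using zz unfolding zigzag_def by blast
  have "\<exists>x\<in>G S t. c S - delta b S = ev x" if "S \<subseteq> V" "card S = 3" for S using cb[OF that] by auto
  from co_choice[OF this, simplified] obtain j where
    j: "co 3 t j" "\<And>S. S \<subseteq> V \<Longrightarrow> card S = 3 \<Longrightarrow> c S - delta b S = ev (j S)" by blast
  have "\<exists>h\<in>G T (t - 1). \<exists>k\<in>G T (t - 1). g T - delta j T = l1 * h + l2 * k"
    if T: "T \<subseteq> V" "card T = 4" for T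
  proof (rule relations_exact)
    show "T \<subseteq> V" by fact
    show "g T - delta j T \<in> G T t"
      using coD[OF g(1) T] co_delta[OF j(1)] T by (auto intro: coD G_diff)
    have "ev (delta j T) = delta (\<lambda>S. ev (j S)) T" by (simp add: delta_ev)
    also have "\<dots> = delta (\<lambda>S. c S - delta b S) T"
    proof (rule delta_cong)
      fix i assume "i \<in> T"
      then have "card (T - {i}) = 3" "T - {i} \<subseteq> V" using T card_remove_subV[of T i 3] by auto
      then show "ev (j (T - {i})) = c (T - {i}) - delta b (T - {i})" using j(2) by metis
    qed
    also have "\<dots> = delta c T" using T finite_subV by (simp add: delta_diff delta_delta)
    finally show "ev (g T - delta j T) = 0" using T by (simp add: ev_diff g(2))
  qed
  from co_choice[OF this, simplified] obtain h' where h': "co 4 (t - 1) h'"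
    "\<And>T. T \<subseteq> V \<Longrightarrow> card T = 4 \<Longrightarrow> \<exists>k\<in>G T (t - 1). g T - delta j T = l1 * h' T + l2 * k" by blast
  from co_choice[OF h'(2), simplified] obtain k' where k': "co 4 (t - 1) k'"
    "\<And>T. T \<subseteq> V \<Longrightarrow> card T = 4 \<Longrightarrow> g T - delta j T = l1 * h' T + l2 * k' T" by blast
  have ex_p: "\<exists>p\<in>G U (t - 2). h U - delta h' U = l2 * p" if U: "U \<subseteq> V" "card U = 5" for U
  proof -
    have "h U - delta h' U \<in> G U (t - 1)"
      using coD[OF h U] co_delta[OF h'(1)] U by (auto intro: coD G_diff)
    have "delta g U = delta (\<lambda>T. g T - delta j T) U"
      using U finite_subV by (simp add: delta_diff delta_delta)
    also have "\<dots> = delta (\<lambda>T. l1 * h' T + l2 * k' T) U"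
    proof (rule delta_cong)
      fix i assume "i \<in> U"
      then have "card (U - {i}) = 4" "U - {i} \<subseteq> V" using U card_remove_subV[of U i 4] by auto
      then show "g (U - {i}) - delta j (U - {i}) = l1 * h' (U - {i}) + l2 * k' (U - {i})"
        using k'(2) by metis
    qed
    finally have "l1 * (h U - delta h' U) + l2 * (k U - delta k' U) = 0"
      using gU[OF U] by (simp add: delta_add delta_mult algebra_simps)
    from koszul_exact[OF this \<open>h U - delta h' U \<in> G U (t - 1)\<close>] show ?thesis by auto
  qed
  have "\<exists>p. co 5 (t - 2) p \<and> (\<forall>U. U \<subseteq> V \<longrightarrow> card U = 5 \<longrightarrow> h U - delta h' U = l2 * p U)"
    by (rule co_choice[OF ex_p])
  then obtain p where p: "co 5 (t - 2) p"
    "\<And>U. U \<subseteq> V \<Longrightarrow> card U = 5 \<Longrightarrow> h U - delta h' U = l2 * p U" by blast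
  have "l2 * q = delta (\<lambda>U. h U - delta h' U) V" by (simp add: delta_diff delta_delta hV)
  also have "\<dots> = delta (\<lambda>U. l2 * p U) V" by (intro delta_cong p(2)) auto
  finally have "q = delta p V" using l2_nz[where 'a = 'a] by (simp add: delta_mult)
  then show ?thesis using negl_delta[OF p(1)] by simp
qed

section \<open>Linearity and homogeneity of the zigzag\<close>

lemma co_diff_scale: "co k d c \<Longrightarrow> co k d c' \<Longrightarrow> co k d (\<lambda>S. c S - sg 0 a * c' S)"
  unfolding co_def by (auto intro!: G_diff G_mult0[OF G_const])

text \<open>This form covers two uses: subtracting a multiple of the generator and, with both
  cochains equal, scaling.\<close>

lemma zigzag_diff_scale:
  assumes "zigzag t c q" "zigzag t c' q'"
  shows "zigzag t (\<lambda>S. c S - sg 0 a * c' S) (q - sg 0 a * q')"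
proof -
  obtain g h k where 1: "co 4 t g" "co 5 (t - 1) h" "co 5 (t - 1) k" "q \<in> G V (t - 2)"
     "\<And>T. T \<subseteq> V \<Longrightarrow> card T = 4 \<Longrightarrow> delta c T = ev (g T)"
     "\<And>U. U \<subseteq> V \<Longrightarrow> card U = 5 \<Longrightarrow> delta g U = l1 * h U + l2 * k U"
     "delta h V = l2 * q" "delta k V = - l1 * q" using assms(1) unfolding zigzag_def by blast
  obtain g' h' k' where 2: "co 4 t g'" "co 5 (t - 1) h'" "co 5 (t - 1) k'" "q' \<in> G V (t - 2)"
     "\<And>T. T \<subseteq> V \<Longrightarrow> card T = 4 \<Longrightarrow> delta c' T = ev (g' T)"
     "\<And>U. U \<subseteq> V \<Longrightarrow> card U = 5 \<Longrightarrow> delta g' U = l1 * h' U + l2 * k' U"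
     "delta h' V = l2 * q'" "delta k' V = - l1 * q'" using assms(2) unfolding zigzag_def by blast
  show ?thesis
  proof (rule zigzagI)
    show "co 4 t (\<lambda>S. g S - sg 0 a * g' S)" by (rule co_diff_scale[OF 1(1) 2(1)])
    show "co 5 (t - 1) (\<lambda>S. h S - sg 0 a * h' S)" by (rule co_diff_scale[OF 1(2) 2(2)])
    show "co 5 (t - 1) (\<lambda>S. k S - sg 0 a * k' S)" by (rule co_diff_scale[OF 1(3) 2(3)])
    show "q - sg 0 a * q' \<in> G V (t - 2)" using 1(4) 2(4) by (intro G_diff G_mult0[OF G_const])
    show "delta (\<lambda>S. c S - sg 0 a * c' S) T = ev (g T - sg 0 a * g' T)" if T: "T \<subseteq> V" "card T = 4" for T
    proof -
      have "ev (sg 0 a * g' T) = ev (sg 0 a) * ev (g' T)"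
        by (rule ev_mult[OF G_const coD[OF 2(1) T] T(1)])
      moreover have "ev (sg 0 a) = sg 0 a" by (rule ev_free[OF G_const T(1)])
      ultimately show ?thesis by (simp add: delta_diff delta_mult ev_diff 1(5)[OF T] 2(5)[OF T])
    qed
    show "delta (\<lambda>S. g S - sg 0 a * g' S) U =
        l1 * (h U - sg 0 a * h' U) + l2 * (k U - sg 0 a * k' U)" if U: "U \<subseteq> V" "card U = 5" for U
      by (simp add: delta_diff delta_mult 1(6)[OF U] 2(6)[OF U]) (simp add: algebra_simps)
    show "delta (\<lambda>S. h S - sg 0 a * h' S) V = l2 * (q - sg 0 a * q')"
      by (simp add: delta_diff delta_mult 1(7) 2(7)) (simp add: algebra_simps)
    show "delta (\<lambda>S. k S - sg 0 a * k' S) V = - l1 * (q - sg 0 a * q')"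
      by (simp add: delta_diff delta_mult 1(8) 2(8)) (simp add: algebra_simps)
  qed
qed

text \<open>The total degree, in which each \<open>T\<^sub>i\<close> has the degree of the minor it stands for.\<close>

definition wdeg :: "(nat \<Rightarrow>\<^sub>0 int) \<Rightarrow> int" where "wdeg \<mu> = (\<Sum>i<6. lk \<mu> i) + 2 * tdeg \<mu>"

lemma wdeg_add: "wdeg (\<mu> + \<nu>) = wdeg \<mu> + wdeg \<nu>"
  by (simp add: wdeg_def lookup_add sum.distrib tdeg_add)

abbreviation homog :: "int \<Rightarrow> 'a::field laur \<Rightarrow> 'a laur" where
  "homog e \<equiv> restr (\<lambda>\<mu>. wdeg \<mu> = e)"

lemma lessThan_6: "{..<6::nat} = {0, 1, 2, 3, 4, 5}" by auto

lemma homog_mult: "(\<And>\<mu>. \<mu> \<in> ks l \<Longrightarrow> wdeg \<mu> = e') \<Longrightarrow> homog e (l * p) = l * homog (e - e') p"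
  by (rule restr_times_homogeneous[OF wdeg_add])

lemma wdeg_l1: "\<mu> \<in> ks (l1 :: 'a::field laur) \<Longrightarrow> wdeg \<mu> = 3"
  and wdeg_l2: "\<mu> \<in> ks (l2 :: 'a::field laur) \<Longrightarrow> wdeg \<mu> = 3"
  by (auto simp: keys_l1 keys_l2 wdeg_def tdeg_def lessThan_6 lookup_add lookup_single when_def
      simp del: single_one)

lemma wdeg_minor: "\<mu> \<in> ks (minor i :: 'a::field laur) \<Longrightarrow> wdeg \<mu> = 2"
proof -
  assume \<mu>: "\<mu> \<in> ks (minor i :: 'a laur)"
  have "wdeg \<mu> = 2" if "\<mu> \<in> ks (xvar a * xvar b - xvar c * xvar d :: 'a laur)" "a < 6" "b < 6" "c < 6" "d < 6" for a b c d
  proof -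
    have "\<mu> = sg a 1 + sg b 1 \<or> \<mu> = sg c 1 + sg d 1"
      using that(1) by (auto simp: xvar_times_xvar in_keys_iff lookup_minus lookup_single when_def split: if_splits)
    then show ?thesis using that(2-5)
      by (auto simp: wdeg_def tdeg_def lookup_add lookup_single when_def sum.distrib)
  qed
  then show ?thesis using \<mu> unfolding minor_def by (auto split: if_splits)
qed

lemma wdeg_power: "(\<And>\<mu>. \<mu> \<in> ks (p :: 'a::field laur) \<Longrightarrow> wdeg \<mu> = e) \<Longrightarrow> \<mu> \<in> ks (p ^ n) \<Longrightarrow> wdeg \<mu> = e * int n"
proof (induction n arbitrary: \<mu>)
  case (Suc n)
  then show ?case by (auto elim!: keys_timesE simp: wdeg_add algebra_simps)
qed (auto simp: wdeg_def tdeg_def)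

text \<open>Each T_i has the weight of the minor that replaces it, so \<open>ev\<close> preserves
  weights monomial by monomial.\<close>

lemma ev_homog:
  fixes g :: "'a::field laur"
  assumes g: "g \<in> G S d" and S: "S \<subseteq> V"
  shows "ev (homog e g) = homog e (ev g)"
proof -
  have d: "wdeg \<nu> = wdeg \<mu>" if \<mu>: "\<mu> \<in> ks g" and \<nu>: "\<nu> \<in> ks (ev (sg \<mu> a))" for \<mu> \<nu> and a :: 'a
  proof -
    have T: "0 \<le> lk \<mu> 6" "0 \<le> lk \<mu> 7" "0 \<le> lk \<mu> 8"
      using nnD[OF G_nnT[OF g S] \<mu>] by auto
    obtain x y where x: "x \<in> ks (sg (restr (\<lambda>i. i \<notin> {6, 7, 8}) \<mu>) a)"
      and y: "y \<in> ks (\<Prod>i\<in>{6, 7, 8}. minor i ^ nat (lk \<mu> i) :: 'a laur)" and \<nu>: "\<nu> = x + y"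
      using \<nu> unfolding ev_def subst_single by (rule keys_timesE)
    have "wdeg y = 2 * tdeg \<mu>"
      using y T by (auto elim!: keys_timesE dest!: wdeg_power[OF wdeg_minor, rotated] simp: wdeg_add tdeg_def)
    moreover have "wdeg x = (\<Sum>i<6. lk \<mu> i)"
      using x by (auto simp: wdeg_def tdeg_def lookup_restr split: if_splits)
    ultimately show ?thesis unfolding \<nu> wdeg_add by (simp add: wdeg_def[of \<mu>])
  qed
  have "homog e (ev (sg \<mu> (lk g \<mu>))) = ev (sg \<mu> (lk (homog e g) \<mu>))" if \<mu>: "\<mu> \<in> ks g" for \<mu>
  proof (cases "wdeg \<mu> = e")
    case True
    then show ?thesis using d[OF \<mu>] by (auto simp: lookup_restr intro!: restr_all)
  next
    case False
    then show ?thesis using d[OF \<mu>] by (auto simp: lookup_restr intro!: restr_none)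
  qed
  then have "(\<Sum>\<mu>\<in>ks g. homog e (ev (sg \<mu> (lk g \<mu>)))) = ev (\<Sum>\<mu>\<in>ks g. sg \<mu> (lk (homog e g) \<mu>))"
    by (simp add: ev_sum)
  moreover have "ev g = (\<Sum>\<mu>\<in>ks g. ev (sg \<mu> (lk g \<mu>)))" unfolding ev_def by (rule subst_expand)
  moreover have "(\<Sum>\<mu>\<in>ks g. sg \<mu> (lk (homog e g) \<mu>)) = homog e g"
    by (rule sum_single_superset) (auto simp: keys_restr)
  ultimately show ?thesis by (simp add: restr_sum)
qed

lemma co_homog: "co k d c \<Longrightarrow> co k d (\<lambda>S. homog e (c S))"
  by (auto simp: co_def intro: G_restr)

text \<open>The weights are 0 for \<open>c\<close> and \<open>g\<close>, -3 for \<open>h\<close> and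
  \<open>k\<close>, and -6 for \<open>q\<close>: each division by \<open>l1\<close> or
  \<open>l2\<close> costs their weight 3.\<close>

lemma zigzag_homog:
  assumes "zigzag t c q"
  shows "zigzag t (\<lambda>S. homog 0 (c S)) (homog (-6) q)"
proof -
  obtain g h k where 1: "co 4 t g" "co 5 (t - 1) h" "co 5 (t - 1) k" "q \<in> G V (t - 2)"
     "\<And>T. T \<subseteq> V \<Longrightarrow> card T = 4 \<Longrightarrow> delta c T = ev (g T)"
     "\<And>U. U \<subseteq> V \<Longrightarrow> card U = 5 \<Longrightarrow> delta g U = l1 * h U + l2 * k U"
     "delta h V = l2 * q" "delta k V = - l1 * q" using assms(1) unfolding zigzag_def by blast
  have m1: "homog e (l1 * p) = l1 * homog (e - 3) p" for e and p :: "'a laur"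
    by (rule homog_mult[OF wdeg_l1])
  have m2: "homog e (l2 * p) = l2 * homog (e - 3) p" for e and p :: "'a laur"
    by (rule homog_mult[OF wdeg_l2])
  show ?thesis
  proof (rule zigzagI)
    show "co 4 t (\<lambda>S. homog 0 (g S))" by (rule co_homog[OF 1(1)])
    show "co 5 (t - 1) (\<lambda>S. homog (-3) (h S))" by (rule co_homog[OF 1(2)])
    show "co 5 (t - 1) (\<lambda>S. homog (-3) (k S))" by (rule co_homog[OF 1(3)])
    show "homog (-6) q \<in> G V (t - 2)" by (rule G_restr[OF 1(4)])
    show "delta (\<lambda>S. homog 0 (c S)) T = ev (homog 0 (g T))" if T: "T \<subseteq> V" "card T = 4" for T
      using ev_homog[OF coD[OF 1(1) T] T(1), of 0] by (simp add: delta_restr 1(5)[OF T])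
    show "delta (\<lambda>S. homog 0 (g S)) U = l1 * homog (-3) (h U) + l2 * homog (-3) (k U)"
      if U: "U \<subseteq> V" "card U = 5" for U
      by (simp add: delta_restr restr_add 1(6)[OF U] m1 m2)
    show "delta (\<lambda>S. homog (-3) (h S)) V = l2 * homog (-6) q"
      by (simp add: delta_restr 1(7) m2)
    show "delta (\<lambda>S. homog (-3) (k S)) V = - l1 * homog (-6) q"
      by (simp add: delta_restr 1(8) restr_uminus m1)
  qed
qed

section \<open>Invariants under translation by \<open>T\<close>\<close>

text \<open>Otherwise an exponent \<open>sg 0 1\<close> would be rewritten to the unit of a ring of exponents.\<close>

declare single_one [simp del] add_2_eq_Suc [simp del] add_2_eq_Suc' [simp del]

definition pd :: "nat \<Rightarrow> 'a::field laur \<Rightarrow> 'a laur" where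
  "pd i p = (\<Sum>\<mu>\<in>ks p. sg (\<mu> - sg i 1) (of_int (lk \<mu> i) * lk p \<mu>))"

lemma lookup_pd: "lk (pd i p) \<nu> = of_int (lk \<nu> i + 1) * lk p (\<nu> + sg i 1)"
proof -
  have "lk (pd i p) \<nu> = (\<Sum>\<mu>\<in>ks p. if \<mu> = \<nu> + sg i 1 then of_int (lk \<nu> i + 1) * lk p (\<nu> + sg i 1) else 0)"
    unfolding pd_def lookup_sum lookup_single when_def
    by (intro sum.cong) (auto simp: lookup_add algebra_simps)
  also have "\<dots> = of_int (lk \<nu> i + 1) * lk p (\<nu> + sg i 1)"
    by (auto simp: sum.delta in_keys_iff)
  finally show ?thesis .
qed

lemma pd_add: "pd i (p + q) = pd i p + pd i q"
  by (rule poly_mapping_eqI) (simp add: lookup_pd lookup_add algebra_simps)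

lemma pd_zero [simp]: "pd i 0 = 0"
  by (rule poly_mapping_eqI) (simp add: lookup_pd)

lemma pd_diff: "pd i (p - q) = pd i p - pd i q"
  by (rule poly_mapping_eqI) (simp add: lookup_pd lookup_minus algebra_simps)

lemma pd_sum: "pd i (sum f A) = (\<Sum>a\<in>A. pd i (f a))"
  by (induction A rule: infinite_finite_induct) (auto simp: pd_add)

lemma pd_single: "pd i (sg \<mu> a) = sg (\<mu> - sg i 1) (of_int (lk \<mu> i) * a)"
  by (cases "a = 0") (simp_all add: pd_def)

lemma pd_mult_single:
  "pd i (sg \<mu> a * sg \<nu> b) = pd i (sg \<mu> a) * sg \<nu> b + sg \<mu> a * pd i (sg \<nu> b)"
proof -
  have e: "\<mu> - sg i 1 + \<nu> = \<mu> + \<nu> - sg i 1" "\<mu> + (\<nu> - sg i 1) = \<mu> + \<nu> - sg i 1" by simp_all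
  have "of_int (lk (\<mu> + \<nu>) i) * (a * b) = of_int (lk \<mu> i) * a * b + a * (of_int (lk \<nu> i) * b)"
    by (simp add: lookup_add algebra_simps)
  then show ?thesis
    unfolding mult_single pd_single e by (simp only: single_add)
qed

lemma pd_mult: "pd i (p * q) = pd i p * q + p * pd i q"
proof -
  let ?p = "\<lambda>\<mu>. sg \<mu> (lk p \<mu>)" and ?q = "\<lambda>\<nu>. sg \<nu> (lk q \<nu>)"
  have "pd i ((\<Sum>\<mu>\<in>ks p. ?p \<mu>) * (\<Sum>\<nu>\<in>ks q. ?q \<nu>)) =
      (\<Sum>\<mu>\<in>ks p. \<Sum>\<nu>\<in>ks q. pd i (?p \<mu>) * ?q \<nu> + ?p \<mu> * pd i (?q \<nu>))"
    unfolding sum_product pd_sum pd_mult_single ..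
  also have "\<dots> = (\<Sum>\<mu>\<in>ks p. pd i (?p \<mu>)) * (\<Sum>\<nu>\<in>ks q. ?q \<nu>) +
      (\<Sum>\<mu>\<in>ks p. ?p \<mu>) * (\<Sum>\<nu>\<in>ks q. pd i (?q \<nu>))"
    unfolding sum_product sum.distrib ..
  finally show ?thesis unfolding pd_sum[symmetric] sum_single_keys .
qed

lemma pd_xvar: "pd i (xvar j) = (if i = j then 1 else 0)"
  by (auto simp: xvar_def pd_single lookup_single when_def single_one)

lemma pd_xvar_mult: "pd i (xvar j * p) = (if i = j then p else 0) + xvar j * pd i p"
  by (simp add: pd_mult pd_xvar)

lemma pd_commute: "pd i (pd j p) = pd j (pd i p)"
  by (rule poly_mapping_eqI) (auto simp: lookup_pd lookup_add lookup_single when_def algebra_simps)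

lemma pd_one [simp]: "pd i 1 = 0"
  by (rule poly_mapping_eqI) (auto simp: lookup_pd lookup_one when_def add_eq_0_iff lookup_add
      dest: arg_cong[of _ _ "\<lambda>\<mu>. lk \<mu> i"])

lemma pd_power: "pd i (p ^ Suc n) = of_nat (Suc n) * p ^ n * pd i p"
proof (induction n)
  case (Suc n)
  have "pd i (p ^ Suc (Suc n)) = pd i p * p ^ Suc n + p * pd i (p ^ Suc n)"
    by (simp only: power_Suc[of p "Suc n"] pd_mult)
  also have "\<dots> = of_nat (Suc (Suc n)) * p ^ Suc n * pd i p"
    unfolding Suc.IH by (simp add: algebra_simps)
  finally show ?case .
qed simp

text \<open>The rows \<open>(u, v, w)\<close>, \<open>(x, y, z)\<close> and \<open>(T\<^sub>1, T\<^sub>2, T\<^sub>3)\<close> of the \<open>3 \<times> 3\<close> matrix start at the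
  indices \<open>0\<close>, \<open>3\<close> and \<open>6\<close>; \<open>pol r s\<close> is the infinitesimal row operation that adds row \<open>r\<close> to row \<open>s\<close>.\<close>

definition pol :: "nat \<Rightarrow> nat \<Rightarrow> 'a::field laur \<Rightarrow> 'a laur" where
  "pol r s p = xvar r * pd s p + xvar (r + 1) * pd (s + 1) p + xvar (r + 2) * pd (s + 2) p"

lemma lookup_xvar_mult: "lk (xvar i * p) \<mu> = lk p (\<mu> - sg i 1)"
  by (simp add: xvar_def lookup_single_times)

lemma pol_zero [simp]: "pol r s 0 = 0" by (simp add: pol_def)
lemma pol_diff: "pol r s (p - q) = pol r s p - pol r s q"
  by (simp add: pol_def pd_diff algebra_simps)
lemma pol_const: "pol r s (sg 0 a * p) = sg 0 a * pol r s p"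
proof -
  have "pd i (sg 0 a) = 0" for i by (simp add: pd_single)
  then show ?thesis by (simp add: pol_def pd_mult algebra_simps)
qed
lemma pol_of_int: "pol r s (of_int a * p) = of_int a * pol r s p"
proof -
  have "(of_int a :: 'a laur) = sg 0 (of_int a)" by simp
  then show ?thesis by (simp only: pol_const)
qed

section \<open>Row degrees and the action of sl_2\<close>

definition rdeg :: "nat \<Rightarrow> (nat \<Rightarrow>\<^sub>0 int) \<Rightarrow> int" where
  "rdeg r \<mu> = lk \<mu> r + lk \<mu> (r + 1) + lk \<mu> (r + 2)"

lemma rdeg_add: "rdeg r (\<mu> + \<nu>) = rdeg r \<mu> + rdeg r \<nu>"
  by (simp add: rdeg_def lookup_add)

lemma euler:
  assumes "\<And>\<mu>. \<mu> \<in> ks p \<Longrightarrow> rdeg r \<mu> = d"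
  shows "pol r r p = of_int d * p"
proof (rule poly_mapping_eqI)
  fix \<mu>
  have "(of_int d :: 'a laur) = sg 0 (of_int d)" by simp
  then have "lk (of_int d * p) \<mu> = of_int d * lk p \<mu>"
    by (simp only: lookup_single_times diff_zero)
  moreover have "lk (pol r r p) \<mu> = of_int (rdeg r \<mu>) * lk p \<mu>"
    by (simp add: pol_def lookup_add lookup_xvar_mult lookup_pd lookup_minus rdeg_def algebra_simps)
  ultimately show "lk (pol r r p) \<mu> = lk (of_int d * p) \<mu>"
    using assms[of \<mu>] by (cases "\<mu> \<in> ks p") (auto simp: in_keys_iff)
qed

text \<open>Stated for six separate indices, so that the hypotheses decide which of them coincide.
  The second-order terms agree because partial derivatives commute; the first-order terms leave the
  difference of the two Euler operators.\<close>

lemma commutator_aux: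
  assumes "a \<notin> {d, e, f}" "b \<notin> {d, e, f}" "c \<notin> {d, e, f}" "a \<notin> {b, c}" "b \<noteq> c" "d \<notin> {e, f}" "e \<noteq> f"
  shows "xvar a * pd d (xvar d * pd a p + xvar e * pd b p + xvar f * pd c p) +
      xvar b * pd e (xvar d * pd a p + xvar e * pd b p + xvar f * pd c p) +
      xvar c * pd f (xvar d * pd a p + xvar e * pd b p + xvar f * pd c p) =
    xvar d * pd a (xvar a * pd d p + xvar b * pd e p + xvar c * pd f p) +
      xvar e * pd b (xvar a * pd d p + xvar b * pd e p + xvar c * pd f p) +
      xvar f * pd c (xvar a * pd d p + xvar b * pd e p + xvar c * pd f p) +
    ((xvar a * pd a p + xvar b * pd b p + xvar c * pd c p) - (xvar d * pd d p + xvar e * pd e p + xvar f * pd f p))"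
proof -
  note swap = pd_commute[of d a] pd_commute[of d b] pd_commute[of d c] pd_commute[of e a]
    pd_commute[of e b] pd_commute[of e c] pd_commute[of f a] pd_commute[of f b] pd_commute[of f c]
  show ?thesis
    unfolding pd_add pd_xvar_mult using assms by (auto simp: swap algebra_simps)
qed

lemma pol_commutator:
  assumes "\<And>k l. k < 3 \<Longrightarrow> l < 3 \<Longrightarrow> r + k \<noteq> s + l"
  shows "pol r s (pol s r p) = pol s r (pol r s p) + (pol r r p - pol s s p)"
  unfolding pol_def
  by (rule commutator_aux)
    (use assms[of 0 0] assms[of 0 1] assms[of 0 2] assms[of 1 0] assms[of 1 1] assms[of 1 2]
      assms[of 2 0] assms[of 2 1] assms[of 2 2] in auto)

text \<open>The last conclusion records that the exponent lowered by the derivative was nonzero, so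
  that \<open>nn_pol\<close> can keep exponents nonnegative.\<close>

lemma keys_pol:
  assumes "\<mu> \<in> ks (pol r s p)"
  obtains k \<nu> where "k < 3" "\<nu> \<in> ks p" "\<mu> = \<nu> + sg (r + k) 1 - sg (s + k) 1" "lk \<nu> (s + k) \<noteq> 0"
proof -
  have "lk (xvar (r + 0) * pd (s + 0) p) \<mu> + lk (xvar (r + 1) * pd (s + 1) p) \<mu> +
      lk (xvar (r + 2) * pd (s + 2) p) \<mu> \<noteq> 0"
    using assms by (simp add: pol_def in_keys_iff lookup_add)
  then have "\<exists>k<3. lk (xvar (r + k) * pd (s + k) p) \<mu> \<noteq> 0"
  proof (rule contrapos_np)
    assume "\<not> (\<exists>k<3. lk (xvar (r + k) * pd (s + k) p) \<mu> \<noteq> 0)"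
    then have "lk (xvar (r + k) * pd (s + k) p) \<mu> = 0" if "k < 3" for k using that by blast
    from this[of 0] this[of 1] this[of 2]
    show "lk (xvar (r + 0) * pd (s + 0) p) \<mu> + lk (xvar (r + 1) * pd (s + 1) p) \<mu> +
      lk (xvar (r + 2) * pd (s + 2) p) \<mu> = 0" by simp
  qed
  then obtain k where k: "k < 3" "lk (xvar (r + k) * pd (s + k) p) \<mu> \<noteq> 0" by blast
  show ?thesis
  proof (rule that[OF k(1)])
    show "\<mu> - sg (r + k) 1 + sg (s + k) 1 \<in> ks p"
      using k(2) by (auto simp: lookup_xvar_mult lookup_pd in_keys_iff)
    show "lk (\<mu> - sg (r + k) 1 + sg (s + k) 1) (s + k) \<noteq> 0"
    proof
      assume "lk (\<mu> - sg (r + k) 1 + sg (s + k) 1) (s + k) = 0"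
      then have z: "lk (\<mu> - sg (r + k) 1) (s + k) + 1 = 0" by (simp add: lookup_add)
      show False using k(2) unfolding lookup_xvar_mult lookup_pd z by simp
    qed
  qed simp
qed

lemma nn_pol: "nn {} p \<Longrightarrow> nn {} (pol r s p)"
  unfolding nn_def
proof (intro ballI allI impI)
  fix \<mu> i assume p: "\<forall>\<mu>\<in>ks p. \<forall>i. i \<notin> {} \<longrightarrow> 0 \<le> lk \<mu> i" and "\<mu> \<in> ks (pol r s p)"
  then obtain k \<nu> where "\<nu> \<in> ks p" "\<mu> = \<nu> + sg (r + k) 1 - sg (s + k) 1" "lk \<nu> (s + k) \<noteq> 0"
    by (auto elim: keys_pol)
  moreover have "0 \<le> lk \<nu> i" "0 \<le> lk \<nu> (s + k)" using p \<open>\<nu> \<in> ks p\<close> by auto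
  ultimately show "0 \<le> lk \<mu> i"
    by (auto simp: lookup_add lookup_minus lookup_single when_def)
qed

lemma rdeg_single: "rdeg r (sg i 1) = (if i = r \<or> i = r + 1 \<or> i = r + 2 then 1 else 0)"
  by (auto simp: rdeg_def lookup_single when_def)

lemma rdeg_diff: "rdeg r (\<mu> - \<nu>) = rdeg r \<mu> - rdeg r \<nu>"
  by (simp add: rdeg_def lookup_minus)

definition disjoint_rows :: "nat \<Rightarrow> nat \<Rightarrow> bool" where
  "disjoint_rows r s \<longleftrightarrow> (\<forall>k<3. \<forall>l<3. r + k \<noteq> s + l)"

lemma rdeg_shift:
  assumes "disjoint_rows r s" "k < 3" "\<mu> = \<nu> + sg (r + k) 1 - sg (s + k) (1::int)"
  shows "rdeg r \<mu> = rdeg r \<nu> + 1" "rdeg s \<mu> = rdeg s \<nu> - 1"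
proof -
  have "r + k \<noteq> s + l" "s + k \<noteq> r + l" if "l < 3" for l
    using assms that unfolding disjoint_rows_def by metis+
  from this[of 0] this[of 1] this[of 2]
  have "r + k \<noteq> s" "r + k \<noteq> s + 1" "r + k \<noteq> s + 2" "s + k \<noteq> r" "s + k \<noteq> r + 1" "s + k \<noteq> r + 2"
    by auto
  moreover have "k = 0 \<or> k = 1 \<or> k = 2" using assms(2) by auto
  ultimately show "rdeg r \<mu> = rdeg r \<nu> + 1" "rdeg s \<mu> = rdeg s \<nu> - 1"
    by (auto simp: assms(3) rdeg_add rdeg_diff rdeg_single)
qed

text \<open>\<open>pol r s\<close>, \<open>pol s r\<close> and their commutator form an \<open>sl\<^sub>2\<close>-triple, so its highest weight vectors have
  nonnegative weight, and those of weight zero are invariant.\<close>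

lemma sl2_lowering:
  fixes p :: "'a::field_char_0 laur"
  assumes rs: "disjoint_rows r s" and R: "\<And>\<mu>. \<mu> \<in> ks p \<Longrightarrow> rdeg r \<mu> = R" and S: "\<And>\<mu>. \<mu> \<in> ks p \<Longrightarrow> rdeg s \<mu> = S"
    and e: "pol r s p = 0"
  defines "f \<equiv> pol s r"
  shows "pol r s ((f ^^ Suc k) p) = of_int (int (Suc k) * (R - S - int k)) * (f ^^ k) p"
    and "\<mu> \<in> ks ((f ^^ k) p) \<Longrightarrow> rdeg r \<mu> = R - int k \<and> rdeg s \<mu> = S + int k"
proof -
  have sr: "disjoint_rows s r" using rs unfolding disjoint_rows_def by metis
  have dg: "\<mu> \<in> ks ((f ^^ k) p) \<Longrightarrow> rdeg r \<mu> = R - int k \<and> rdeg s \<mu> = S + int k" for \<mu> k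
  proof (induction k arbitrary: \<mu>)
    case (Suc k)
    then have "\<mu> \<in> ks (pol s r ((f ^^ k) p))" by (simp add: f_def)
    then obtain l \<nu> where l: "l < 3" "\<nu> \<in> ks ((f ^^ k) p)" "\<mu> = \<nu> + sg (s + l) 1 - sg (r + l) 1"
      by (rule keys_pol)
    then show ?case using rdeg_shift[OF sr l(1,3)] Suc.IH[OF l(2)] by simp
  qed (use R S in auto)
  show "\<mu> \<in> ks ((f ^^ k) p) \<Longrightarrow> rdeg r \<mu> = R - int k \<and> rdeg s \<mu> = S + int k" by (rule dg)
  show "pol r s ((f ^^ Suc k) p) = of_int (int (Suc k) * (R - S - int k)) * (f ^^ k) p"
  proof (induction k)
    case 0
    have "pol r s (f p) = pol s r (pol r s p) + (pol r r p - pol s s p)"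
      unfolding f_def using rs by (intro pol_commutator) (auto simp: disjoint_rows_def)
    also have "pol r r p = of_int R * p" by (rule euler) (rule R)
    also have "pol s s p = of_int S * p" by (rule euler) (rule S)
    finally show ?case by (simp add: e algebra_simps)
  next
    case (Suc k)
    let ?q = "(f ^^ Suc k) p"
    have "pol r s (f ?q) = pol s r (pol r s ?q) + (pol r r ?q - pol s s ?q)"
      unfolding f_def using rs by (intro pol_commutator) (auto simp: disjoint_rows_def)
    also have "pol r r ?q = of_int (R - int (Suc k)) * ?q" by (rule euler) (use dg in blast)
    also have "pol s s ?q = of_int (S + int (Suc k)) * ?q" by (rule euler) (use dg in blast)
    also have "pol s r (pol r s ?q) = of_int (int (Suc k) * (R - S - int k)) * ?q"
      unfolding Suc.IH pol_of_int by (simp add: f_def)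
    also have "of_int (int (Suc k) * (R - S - int k)) * ?q +
        (of_int (R - int (Suc k)) * ?q - of_int (S + int (Suc k)) * ?q) =
      of_int (int (Suc k) * (R - S - int k) + ((R - int (Suc k)) - (S + int (Suc k)))) * ?q"
      by (simp only: of_int_add of_int_diff algebra_simps)
    also have "int (Suc k) * (R - S - int k) + ((R - int (Suc k)) - (S + int (Suc k))) =
        int (Suc (Suc k)) * (R - S - int (Suc k))"
      by (simp add: algebra_simps)
    finally show ?case by simp
  qed
qed

text \<open>The lowering operator decreases the degree in row \<open>r\<close>, so its power
  \<open>nat (R + 1)\<close> kills \<open>p\<close>. By \<open>sl2_lowering\<close>, vanishing
  passes from one power of it to the previous one, the \<open>k\<close>-th, as long as
  \<open>R - S - int k\<close> is nonzero: down to \<open>k = 0\<close> if \<open>R < S\<close>, and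
  down to \<open>k = 1\<close> if \<open>R = S\<close>.\<close>

lemma sl2_highest_weight:
  fixes p :: "'a::field_char_0 laur"
  assumes nn: "nn {} p" and rs: "disjoint_rows r s"
    and R: "\<And>\<mu>. \<mu> \<in> ks p \<Longrightarrow> rdeg r \<mu> = R" and S: "\<And>\<mu>. \<mu> \<in> ks p \<Longrightarrow> rdeg s \<mu> = S"
    and e: "pol r s p = 0"
  shows "R < S \<Longrightarrow> p = 0" and "R = S \<Longrightarrow> pol s r p = 0"
proof -
  let ?f = "pol s r :: 'a laur \<Rightarrow> 'a laur"
  have low1: "pol r s ((?f ^^ Suc k) p) = of_int (int (Suc k) * (R - S - int k)) * (?f ^^ k) p" for k
    by (rule sl2_lowering(1)[OF rs _ _ e]) (use R S in auto)
  have low2: "rdeg r \<mu> = R - int k" if "\<mu> \<in> ks ((?f ^^ k) p)" for \<mu> k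
    using sl2_lowering(2)[OF rs _ _ e, of R S \<mu> k] R S that by auto
  have nnf: "nn {} ((?f ^^ k) p)" for k by (induction k) (auto intro: nn_pol nn)
  define N where "N = nat (R + 1)"
  have "(?f ^^ N) p = 0"
  proof (rule ccontr)
    assume "(?f ^^ N) p \<noteq> 0"
    then obtain \<mu> where \<mu>: "\<mu> \<in> ks ((?f ^^ N) p)" by (metis keys_eq_empty ex_in_conv)
    then have "rdeg r \<mu> < 0" using low2[OF \<mu>] by (simp add: N_def)
    moreover have "0 \<le> rdeg r \<mu>" using nnD[OF nnf \<mu>] by (simp add: rdeg_def)
    ultimately show False by simp
  qed
  have step: "(?f ^^ k) p = 0" if "(?f ^^ Suc k) p = 0" "R - S - int k \<noteq> 0" for k
  proof -
    have "of_int (int (Suc k) * (R - S - int k)) * (?f ^^ k) p = 0"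
      using low1[of k] that(1) by simp
    moreover have "(of_int (int (Suc k) * (R - S - int k)) :: 'a laur) \<noteq> 0"
      using that(2) by (simp only: of_int_eq_0_iff) auto
    ultimately show ?thesis by (simp only: mult_eq_0_iff) simp
  qed
  have down: "(?f ^^ m) p = 0" if "\<And>k. m \<le> k \<Longrightarrow> R - S - int k \<noteq> 0" for m
  proof -
    have "(?f ^^ (m + (N - m))) p = 0"
    proof (cases "N \<le> m")
      case True
      have "(?f ^^ (j + N)) p = 0" for j by (induction j) (simp_all add: \<open>(?f ^^ N) p = 0\<close>)
      from this[of "m - N"] True show ?thesis by simp
    qed (simp add: \<open>(?f ^^ N) p = 0\<close>)
    then show ?thesis
    proof (induction "N - m")
      case (Suc j)
      have "(?f ^^ (m + i)) p = 0 \<Longrightarrow> (?f ^^ m) p = 0" for i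
      proof (induction i)
        case (Suc i)
        then have "(?f ^^ Suc (m + i)) p = 0" by simp
        then have "(?f ^^ (m + i)) p = 0" by (rule step) (rule that, simp)
        then show ?case by (rule Suc.IH)
      qed simp
      with Suc.prems show ?case by blast
    qed simp
  qed
  show "R < S \<Longrightarrow> p = 0" using down[of 0] by simp
  show "R = S \<Longrightarrow> pol s r p = 0" using down[of 1] by simp
qed

lemma restr_pd:
  "restr (\<lambda>\<mu>. rdeg r \<mu> = d) (pd i p) = pd i (restr (\<lambda>\<mu>. rdeg r \<mu> = d + rdeg r (sg i 1)) p)"
  by (rule poly_mapping_eqI) (auto simp: lookup_restr lookup_pd rdeg_add)

lemma restr_xvar_mult:
  "restr (\<lambda>\<mu>. rdeg r \<mu> = d) (xvar i * p) = xvar i * restr (\<lambda>\<mu>. rdeg r \<mu> = d - rdeg r (sg i 1)) p"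
  by (rule restr_times_homogeneous[OF rdeg_add]) (auto simp: xvar_def)

definition matpoly :: "nat \<Rightarrow> 'a::field laur \<Rightarrow> bool" where
  "matpoly n p \<longleftrightarrow> nn {} p \<and> (\<forall>\<mu>\<in>ks p. (\<forall>i\<ge>9. lk \<mu> i = 0) \<and> rdeg 6 \<mu> = int n \<and> rdeg 0 \<mu> + rdeg 3 \<mu> = 2 * int n)"

lemma matpoly_diff: "matpoly n p \<Longrightarrow> matpoly n q \<Longrightarrow> matpoly n (p - q)"
  unfolding matpoly_def using keys_diff[of p q] by (auto intro: nn_diff)

lemma matpoly_const: "matpoly n p \<Longrightarrow> matpoly n (sg 0 a * p)"
  unfolding matpoly_def by (auto intro!: nn_mult nn_single elim!: keys_timesE split: if_splits)

lemma disjoint_rows_numeral: "disjoint_rows 0 3" "disjoint_rows 3 0" "disjoint_rows 0 6" "disjoint_rows 6 0" "disjoint_rows 3 6" "disjoint_rows 6 3"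
  by (auto simp: disjoint_rows_def)

text \<open>Both operators are homogeneous for the degree in row 0, so they kill each piece of
  \<open>p\<close> of degree \<open>a\<close> there. Such a piece has degrees \<open>n\<close>,
  \<open>a\<close>, \<open>2 * n - a\<close> in the rows 6, 0, 3. For \<open>a \<noteq> n\<close>
  one of the last two exceeds \<open>n\<close>, and the piece would be a highest weight vector of
  negative weight. Hence all weights are zero.\<close>

lemma translation_invariant:
  fixes p :: "'a::field_char_0 laur"
  assumes p: "matpoly n p" and p0: "pol 6 0 p = 0" and p3: "pol 6 3 p = 0"
  shows "\<And>\<mu>. \<mu> \<in> ks p \<Longrightarrow> rdeg 0 \<mu> = int n \<and> rdeg 3 \<mu> = int n"
    and "pol 0 6 p = 0" "pol 3 6 p = 0" "pol 0 3 p = 0" "pol 3 0 p = 0"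
proof -
  have nn: "nn {} p" using p by (simp add: matpoly_def)
  have zero: "restr (\<lambda>\<mu>. rdeg 0 \<mu> = a) p = 0" if a: "a \<noteq> int n" for a
  proof -
    let ?p = "restr (\<lambda>\<mu>. rdeg 0 \<mu> = a) p"
    have nn': "nn {} ?p" using nn by (simp add: nn_def keys_restr)
    have "pol 6 0 ?p = restr (\<lambda>\<mu>. rdeg 0 \<mu> = a - 1) (pol 6 0 p)"
      by (simp add: pol_def restr_add restr_xvar_mult restr_pd rdeg_single)
    then have e0: "pol 6 0 ?p = 0" using p0 by simp
    have "pol 6 3 ?p = restr (\<lambda>\<mu>. rdeg 0 \<mu> = a) (pol 6 3 p)"
      by (simp add: pol_def restr_add restr_xvar_mult restr_pd rdeg_single)
    then have e3: "pol 6 3 ?p = 0" using p3 by simp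
    have d: "rdeg 6 \<mu> = int n" "rdeg 0 \<mu> = a" "rdeg 3 \<mu> = 2 * int n - a" if "\<mu> \<in> ks ?p" for \<mu>
      using that p by (auto simp: keys_restr matpoly_def)
    show ?thesis
    proof (cases "int n < a")
      case True
      show ?thesis
        by (rule sl2_highest_weight(1)[OF nn' disjoint_rows_numeral(4) _ _ e0 True]) (use d in auto)
    next
      case False
      then have "int n < 2 * int n - a" using a by simp
      show ?thesis
        by (rule sl2_highest_weight(1)[OF nn' disjoint_rows_numeral(6) _ _ e3 \<open>int n < 2 * int n - a\<close>])
          (use d in auto)
    qed
  qed
  show dg: "rdeg 0 \<mu> = int n \<and> rdeg 3 \<mu> = int n" if "\<mu> \<in> ks p" for \<mu>
  proof -
    have "rdeg 0 \<mu> = int n" using zero[of "rdeg 0 \<mu>"] that by (auto simp: restr_eq_zero_iff)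
    then show ?thesis using p that by (auto simp: matpoly_def)
  qed
  have d6: "rdeg 6 \<mu> = int n" if "\<mu> \<in> ks p" for \<mu> using p that by (auto simp: matpoly_def)
  show p06: "pol 0 6 p = 0"
    by (rule sl2_highest_weight(2)[OF nn disjoint_rows_numeral(4) d6 _ p0]) (use dg in auto)
  show p36: "pol 3 6 p = 0"
    by (rule sl2_highest_weight(2)[OF nn disjoint_rows_numeral(6) d6 _ p3]) (use dg in auto)
  \<comment> \<open>Operations between the first two rows are commutators of operations passing
    through the last row.\<close>
  have "pol 0 6 (pol 6 3 p) = pol 6 3 (pol 0 6 p) + pol 0 3 p"
    unfolding pol_def pd_add pd_xvar_mult
    by (simp add: pd_commute[of 6] pd_commute[of 7] pd_commute[of 8] algebra_simps)
  then show "pol 0 3 p = 0" by (simp add: p3 p06)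
  have "pol 3 6 (pol 6 0 p) = pol 6 0 (pol 3 6 p) + pol 3 0 p"
    unfolding pol_def pd_add pd_xvar_mult
    by (simp add: pd_commute[of 6] pd_commute[of 7] pd_commute[of 8] algebra_simps)
  then show "pol 3 0 p = 0" by (simp add: p0 p36)
qed

definition diag :: "nat \<Rightarrow> (nat \<Rightarrow>\<^sub>0 int)" where
  "diag n = sg 0 (int n) + sg 4 (int n) + sg 8 (int n)"

lemma lookup_pol:
  assumes "disjoint_rows r s"
  shows "lk (pol r s p) \<nu> =
    of_int (lk \<nu> s + 1) * lk p (\<nu> - sg r 1 + sg s 1) +
    of_int (lk \<nu> (s + 1) + 1) * lk p (\<nu> - sg (r + 1) 1 + sg (s + 1) 1) +
    of_int (lk \<nu> (s + 2) + 1) * lk p (\<nu> - sg (r + 2) 1 + sg (s + 2) 1)"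
proof -
  have "r + k \<noteq> s + k" if "k < 3" for k
    using assms that unfolding disjoint_rows_def by metis
  from this[of 0] have "r \<noteq> s" by simp
  then show ?thesis
    by (simp add: pol_def lookup_add lookup_xvar_mult lookup_pd lookup_minus lookup_single when_def)
qed

text \<open>Among the monomials of \<open>p\<close> pick one whose exponent of \<open>u\<close>, and then of \<open>y\<close>, is maximal. Each
  polarization identity, read off at a neighbouring monomial, then has a single possibly nonzero
  term, which forces all off-diagonal exponents to vanish.\<close>

lemma diagonal_coefficient:
  fixes p :: "'a::field_char_0 laur"
  assumes p: "matpoly n p" and p0: "pol 6 0 p = 0" and p3: "pol 6 3 p = 0" and nz: "p \<noteq> 0"
  shows "lk p (diag n) \<noteq> 0"
proof -
  note inv = translation_invariant[OF p p0 p3]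
  define a where "a = Max ((\<lambda>\<mu>. lk \<mu> 0) ` ks p)"
  have ne: "ks p \<noteq> {}" using nz by simp
  have a_le: "lk \<mu> 0 \<le> a" if "\<mu> \<in> ks p" for \<mu> unfolding a_def using that by simp
  have "a \<in> (\<lambda>\<mu>. lk \<mu> 0) ` ks p" unfolding a_def using ne by (intro Max_in) auto
  then obtain \<mu>' where \<mu>': "\<mu>' \<in> ks p" "lk \<mu>' 0 = a" by auto
  let ?A = "{\<mu> \<in> ks p. lk \<mu> 0 = a}"
  define b where "b = Max ((\<lambda>\<mu>. lk \<mu> 4) ` ?A)"
  have b_le: "lk \<mu> 4 \<le> b" if "\<mu> \<in> ks p" "lk \<mu> 0 = a" for \<mu> unfolding b_def using that by simp
  have "b \<in> (\<lambda>\<mu>. lk \<mu> 4) ` ?A" unfolding b_def using \<mu>' by (intro Max_in) auto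
  then obtain \<mu> where \<mu>: "\<mu> \<in> ks p" "lk \<mu> 0 = a" "lk \<mu> 4 = b" by auto
  have nnp: "nn {} p" using p by (simp add: matpoly_def)
  have neg: "lk p \<nu> = 0" if "lk \<nu> i < 0" for \<nu> i
    using that nnD[OF nnp, of \<nu> i] by (cases "\<nu> \<in> ks p") (auto simp: in_keys_iff)
  have gta: "lk p \<nu> = 0" if "a < lk \<nu> 0" for \<nu>
    using that a_le[of \<nu>] by (cases "\<nu> \<in> ks p") (auto simp: in_keys_iff)
  have gtb: "lk p \<nu> = 0" if "lk \<nu> 0 = a" "b < lk \<nu> 4" for \<nu>
    using that b_le[of \<nu>] by (cases "\<nu> \<in> ks p") (auto simp: in_keys_iff)
  have pz: "lk p \<mu> \<noteq> 0" using \<mu>(1) by (simp add: in_keys_iff)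
  note look = lookup_add lookup_minus lookup_single when_def
  have m3: "lk \<mu> 3 = 0"
  proof -
    have "lk (pol 0 3 p) (\<mu> + sg 0 1 - sg 3 1) = of_int (lk \<mu> 3) * lk p \<mu>"
      using \<mu> by (simp add: lookup_pol disjoint_rows_numeral gta look)
    then show ?thesis using inv(4) pz by simp
  qed
  have m6: "lk \<mu> 6 = 0"
  proof -
    have "lk (pol 0 6 p) (\<mu> + sg 0 1 - sg 6 1) = of_int (lk \<mu> 6) * lk p \<mu>"
      using \<mu> by (simp add: lookup_pol disjoint_rows_numeral gta look)
    then show ?thesis using inv(2) pz by simp
  qed
  \<comment> \<open>The other two terms have a negative exponent of x, by \<open>m3\<close>, or an
    exponent of y above \<open>b\<close>.\<close>
  have m7: "lk \<mu> 7 = 0"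
  proof -
    have "lk (pol 3 6 p) (\<mu> + sg 4 1 - sg 7 1) = of_int (lk \<mu> 7) * lk p \<mu>"
      using \<mu> m3 by (simp add: lookup_pol disjoint_rows_numeral gtb neg[where i = 3] look)
    then show ?thesis using inv(3) pz by simp
  qed
  have m1: "lk \<mu> 1 = 0"
  proof -
    have "lk (pol 3 0 p) (\<mu> + sg 4 1 - sg 1 1) = of_int (lk \<mu> 1) * lk p \<mu>"
      using \<mu> m3 by (simp add: lookup_pol disjoint_rows_numeral gtb neg[where i = 3] look)
    then show ?thesis using inv(5) pz by simp
  qed
  have m2: "lk \<mu> 2 = 0"
  proof -
    have "lk (pol 6 0 p) (\<mu> + sg 8 1 - sg 2 1) = of_int (lk \<mu> 2) * lk p \<mu>"
      using m6 m7 by (simp add: lookup_pol disjoint_rows_numeral neg[where i = 6] neg[where i = 7] look)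
    then show ?thesis using p0 pz by simp
  qed
  have m5: "lk \<mu> 5 = 0"
  proof -
    have "lk (pol 6 3 p) (\<mu> + sg 8 1 - sg 5 1) = of_int (lk \<mu> 5) * lk p \<mu>"
      using m6 m7 by (simp add: lookup_pol disjoint_rows_numeral neg[where i = 6] neg[where i = 7] look)
    then show ?thesis using p3 pz by simp
  qed
  have d: "rdeg 0 \<mu> = int n" "rdeg 3 \<mu> = int n" "rdeg 6 \<mu> = int n" "\<And>i. 9 \<le> i \<Longrightarrow> lk \<mu> i = 0"
    using inv(1)[OF \<mu>(1)] p \<mu>(1) by (auto simp: matpoly_def)
  have "\<mu> = diag n"
  proof (rule poly_mapping_eqI)
    fix i :: nat
    consider "9 \<le> i" | "i = 0" | "i = 1" | "i = 2" | "i = 3" | "i = 4" | "i = 5" | "i = 6" | "i = 7" | "i = 8"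
      by linarith
    then show "lk \<mu> i = lk (diag n) i"
      using d m1 m2 m3 m5 m6 m7 by cases (auto simp: diag_def look rdeg_def simp del: single_of_nat)
  qed
  with pz show ?thesis by simp
qed

section \<open>Powers of the determinant as invariants\<close>

definition det3 :: "'a::field laur" where
  "det3 = xvar 0 * (xvar 4 * xvar 8 - xvar 5 * xvar 7) - xvar 1 * (xvar 3 * xvar 8 - xvar 5 * xvar 6) + xvar 2 * (xvar 3 * xvar 7 - xvar 4 * xvar 6)"

text \<open>Replacing a row by the last one produces a determinant with two equal rows.\<close>

lemma pol_det3: "pol 6 0 det3 = 0" "pol 6 3 det3 = 0"
  by (simp_all add: pol_def det3_def pd_add pd_diff pd_xvar_mult pd_xvar algebra_simps)

lemma pol_power: "pol r s (p ^ Suc n) = of_nat (Suc n) * p ^ n * pol r s p"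
  unfolding pol_def pd_power by (simp add: algebra_simps)

lemma pol_det3_power: "pol 6 0 (det3 ^ n) = 0" "pol 6 3 (det3 ^ n) = 0"
  by (cases n; simp add: pol_power pol_det3 del: power_Suc; simp add: pol_def)+

lemma matpoly_mult: "matpoly m p \<Longrightarrow> matpoly n q \<Longrightarrow> matpoly (m + n) (p * q)"
  unfolding matpoly_def
  by (auto intro!: nn_mult elim!: keys_timesE simp: lookup_add rdeg_add algebra_simps)

lemma matpoly_det3: "matpoly 1 (det3 :: 'a::field laur)"
proof -
  have *: "matpoly 1 (xvar i * (xvar j * xvar k) :: 'a laur)" if "i < 3" "3 \<le> j" "j < 6" "6 \<le> k" "k < 9" for i j k
  proof -
    have eq: "xvar i * (xvar j * xvar k) = (sg (sg i 1 + (sg j 1 + sg k 1)) 1 :: 'a laur)"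
      by (simp add: xvar_def mult_single)
    have "i = 0 \<or> i = 1 \<or> i = 2" "j = 3 \<or> j = 4 \<or> j = 5" "k = 6 \<or> k = 7 \<or> k = 8" using that by auto
    then show ?thesis
      unfolding eq matpoly_def using that
      by (auto simp: rdeg_add rdeg_single lookup_add lookup_single when_def intro!: nn_single)
  qed
  have add: "matpoly 1 (p + q)" if "matpoly 1 p" "matpoly 1 q" for p q :: "'a laur"
    using that keys_add[of p q] unfolding matpoly_def by (auto intro: nn_add)
  have "det3 = xvar 0 * (xvar 4 * xvar 8) - xvar 0 * (xvar 5 * xvar 7) + (xvar 1 * (xvar 5 * xvar 6) - xvar 1 * (xvar 3 * xvar 8)) +
      (xvar 2 * (xvar 3 * xvar 7) - xvar 2 * (xvar 4 * xvar 6) :: 'a laur)"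
    by (simp add: det3_def algebra_simps)
  also have "matpoly 1 \<dots>" by (intro add matpoly_diff *) auto
  finally show ?thesis .
qed

lemma matpoly_one: "matpoly 0 1"
  by (auto simp: matpoly_def nn_one rdeg_def)

lemma matpoly_det3_power: "matpoly n (det3 ^ n)"
proof (induction n)
  case (Suc n)
  then show ?case using matpoly_mult[OF matpoly_det3 Suc] by simp
qed (simp add: matpoly_one)

lemma det3_nz: "(det3 :: 'a::field laur) \<noteq> 0"
proof
  let ?\<mu> = "sg 0 1 + (sg 4 1 + sg 8 1) :: nat \<Rightarrow>\<^sub>0 int"
  assume z: "(det3 :: 'a laur) = 0"
  have ne: "sg i 1 + (sg j 1 + sg k 1) \<noteq> ?\<mu>" if "i \<noteq> 0 \<or> j \<noteq> 4" "i < 3" "3 \<le> j" "j < 6" "6 \<le> k"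
    for i j k :: nat
  proof (cases "i = 0")
    case True
    then show ?thesis using that by (intro neq_lookup[of _ 4]) (auto simp: lookup_add lookup_single when_def)
  next
    case False
    then show ?thesis using that by (intro neq_lookup[of _ 0]) (auto simp: lookup_add lookup_single when_def)
  qed
  have eq: "det3 = xvar 0 * (xvar 4 * xvar 8) - xvar 0 * (xvar 5 * xvar 7) + (xvar 1 * (xvar 5 * xvar 6) - xvar 1 * (xvar 3 * xvar 8)) +
      (xvar 2 * (xvar 3 * xvar 7) - xvar 2 * (xvar 4 * xvar 6) :: 'a laur)"
    by (simp add: det3_def algebra_simps)
  have "lk (det3 :: 'a laur) ?\<mu> = 1"
    unfolding eq xvar_def mult_single using ne[of 0 5 7] ne[of 1 5 6] ne[of 1 3 8] ne[of 2 3 7] ne[of 2 4 6]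
    by (simp add: lookup_add lookup_minus lookup_single when_def)
  with z show False by simp
qed

text \<open>The coefficient at \<open>diag n\<close> is an injective functional on these invariants
  by \<open>diagonal_coefficient\<close>, so subtracting the multiple of \<open>det3 ^ n\<close>
  that matches it leaves zero.\<close>

theorem invariants_spanned:
  fixes p :: "'a::field_char_0 laur"
  assumes p: "matpoly n p" and p0: "pol 6 0 p = 0" and p3: "pol 6 3 p = 0"
  shows "\<exists>a. p = sg 0 a * det3 ^ n"
proof -
  have dn: "lk (det3 ^ n :: 'a laur) (diag n) \<noteq> 0"
    by (rule diagonal_coefficient[OF matpoly_det3_power pol_det3_power]) (simp add: det3_nz)
  define a where "a = lk p (diag n) / lk (det3 ^ n) (diag n)"
  let ?p = "p - sg 0 a * det3 ^ n"
  have "lk ?p (diag n) = 0" using dn by (simp add: lookup_minus lookup_single_times a_def)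
  moreover have "matpoly n ?p" by (intro matpoly_diff p matpoly_const matpoly_det3_power)
  moreover have "pol 6 0 ?p = 0" "pol 6 3 ?p = 0"
    by (simp_all add: pol_diff pol_const p0 p3 pol_det3_power)
  ultimately have "?p = 0" using diagonal_coefficient by blast
  then show ?thesis by (intro exI[of _ a]) simp
qed

subsection \<open>Inverse polynomials\<close>

text \<open>\<open>flip\<close> exchanges \<open>x\<^sup>A\<close> and \<open>x\<^bsup>-1-A\<^esup>\<close> in the six indeterminates. Dividing the coefficients by
  \<open>A!\<close> turns multiplication by an indeterminate on inverse polynomials into differentiation.\<close>

definition flip :: "(nat \<Rightarrow>\<^sub>0 int) \<Rightarrow> (nat \<Rightarrow>\<^sub>0 int)" where
  "flip \<mu> = restr (\<lambda>i. 6 \<le> i) \<mu> + (\<Sum>i<6. sg i (-1 - lk \<mu> i))"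

definition wt :: "(nat \<Rightarrow>\<^sub>0 int) \<Rightarrow> 'a::field_char_0" where
  "wt \<mu> = (\<Prod>i<6. fact (nat (lk \<mu> i)))"

lemma lookup_flip: "lk (flip \<mu>) i = (if i < 6 then -1 - lk \<mu> i else lk \<mu> i)"
  by (simp add: flip_def lookup_add lookup_restr lookup_sum lookup_single when_def)

lemma flip_flip [simp]: "flip (flip \<mu>) = \<mu>"
  by (rule poly_mapping_eqI) (simp add: lookup_flip)

lemma wt_nz: "wt \<mu> \<noteq> 0"
  by (simp add: wt_def)

lemma wt_Suc:
  assumes "j < 6" "0 \<le> lk \<mu> j" "6 \<le> i"
  shows "wt (\<mu> - sg i 1 + sg j 1) = (of_int (lk \<mu> j + 1) * wt \<mu> :: 'a::field_char_0)"
proof -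
  let ?\<nu> = "\<mu> - sg i 1 + sg j 1"
  have l: "lk ?\<nu> k = lk \<mu> k + (if k = j then 1 else 0)" if "k < 6" for k
    using that assms(3) by (auto simp: lookup_add lookup_minus lookup_single when_def)
  have "wt ?\<nu> = fact (nat (lk \<mu> j + 1)) * (\<Prod>k\<in>{..<6} - {j}. fact (nat (lk \<mu> k)) :: 'a)"
    unfolding wt_def using assms(1) l by (subst prod.remove[of _ j]) (auto intro!: prod.cong)
  also have "fact (nat (lk \<mu> j + 1)) = (of_int (lk \<mu> j + 1) * fact (nat (lk \<mu> j)) :: 'a)"
  proof -
    have "nat (lk \<mu> j + 1) = Suc (nat (lk \<mu> j))" using assms(2) by simp
    then have "fact (nat (lk \<mu> j + 1)) = (of_nat (Suc (nat (lk \<mu> j))) * fact (nat (lk \<mu> j)) :: 'a)"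
      by (simp only: fact_Suc)
    also have "(of_nat (Suc (nat (lk \<mu> j))) :: 'a) = of_int (lk \<mu> j + 1)"
      using assms(2) by (simp add: of_nat_nat)
    finally show ?thesis .
  qed
  also have "of_int (lk \<mu> j + 1) * fact (nat (lk \<mu> j)) * (\<Prod>k\<in>{..<6} - {j}. fact (nat (lk \<mu> k))) =
      (of_int (lk \<mu> j + 1) * wt \<mu> :: 'a)"
    unfolding wt_def using assms(1) by (subst (2) prod.remove[of _ j]) (auto simp: mult.assoc)
  finally show ?thesis .
qed

lemma lookup_reflect:
  "finite A \<Longrightarrow> lk (\<Sum>\<nu>\<in>A. sg (flip \<nu>) (g \<nu>)) \<mu> = (if flip \<mu> \<in> A then g (flip \<mu>) else 0)"
proof -
  assume A: "finite A"
  have "lk (\<Sum>\<nu>\<in>A. sg (flip \<nu>) (g \<nu>)) \<mu> = (\<Sum>\<nu>\<in>A. if \<nu> = flip \<mu> then g (flip \<mu>) else 0)"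
    unfolding lookup_sum by (rule sum.cong) (auto simp: lookup_single when_def)
  then show ?thesis using A by (simp add: sum.delta)
qed

text \<open>Monomials that are zero in the top cohomology are dropped, so the result depends only on
  the class of \<open>q\<close> there.\<close>

definition of_inv :: "'a::field_char_0 laur \<Rightarrow> 'a laur" where
  "of_inv q = (\<Sum>\<nu>\<in>{\<nu> \<in> ks q. \<forall>i<6. lk \<nu> i < 0}. sg (flip \<nu>) (lk q \<nu> / wt (flip \<nu>)))"

lemma lookup_of_inv:
  "lk (of_inv q) \<mu> = (if \<forall>i<6. 0 \<le> lk \<mu> i then lk q (flip \<mu>) / wt \<mu> else 0)"
  unfolding of_inv_def by (subst lookup_reflect) (auto simp: lookup_flip in_keys_iff)

lemma lookup_of_inv_pos: "\<forall>i<6. 0 \<le> lk \<mu> i \<Longrightarrow> lk (of_inv q) \<mu> = lk q (flip \<mu>) / wt \<mu>"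
  and lookup_of_inv_neg: "\<not> (\<forall>i<6. 0 \<le> lk \<mu> i) \<Longrightarrow> lk (of_inv q) \<mu> = 0"
  unfolding lookup_of_inv by (rule if_P if_not_P, assumption)+

lemma negl_iff_of_inv: "negl q \<longleftrightarrow> of_inv q = 0"
proof
  assume q: "negl q"
  show "of_inv q = 0"
  proof (rule poly_mapping_eqI)
    fix \<mu>
    show "lk (of_inv q) \<mu> = lk 0 \<mu>"
    proof (cases "\<forall>i<6. 0 \<le> lk \<mu> i")
      case True
      then have "flip \<mu> \<notin> ks q" using q by (force simp: negl_def lookup_flip)
      then show ?thesis by (simp add: lookup_of_inv in_keys_iff)
    next
      case False
      from lookup_of_inv_neg[OF this] show ?thesis by simp
    qed
  qed
next
  assume z: "of_inv q = 0"
  show "negl q" unfolding negl_def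
  proof (rule ballI, rule ccontr)
    fix \<nu> assume \<nu>: "\<nu> \<in> ks q" "\<not> (\<exists>i<6. 0 \<le> lk \<nu> i)"
    then have "lk (of_inv q) (flip \<nu>) = lk q \<nu> / wt (flip \<nu>)"
      by (auto simp: lookup_of_inv lookup_flip not_le)
    with z \<nu>(1) show False by (simp add: wt_nz in_keys_iff)
  qed
qed

lemma of_inv_diff_scale: "of_inv (q - sg 0 a * q') = of_inv q - sg 0 a * of_inv q'"
proof (rule poly_mapping_eqI)
  fix \<mu>
  show "lk (of_inv (q - sg 0 a * q')) \<mu> = lk (of_inv q - sg 0 a * of_inv q') \<mu>"
  proof (cases "\<forall>i<6. 0 \<le> lk \<mu> i")
    case True
    then show ?thesis
      by (simp only: lookup_of_inv_pos lookup_minus lookup_single_times diff_divide_distrib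
          diff_zero times_divide_eq_right)
  next
    case False
    show ?thesis by (simp add: lookup_of_inv_neg[OF False] lookup_minus lookup_single_times)
  qed
qed

lemma nn_of_inv: "q \<in> G V d \<Longrightarrow> nn {} (of_inv q)"
  unfolding nn_def
proof (intro ballI allI impI)
  fix \<mu> i assume q: "q \<in> G V d" and "\<mu> \<in> ks (of_inv q)"
  then have "\<forall>i<6. 0 \<le> lk \<mu> i" "flip \<mu> \<in> ks q"
    by (auto simp: in_keys_iff lookup_of_inv split: if_splits)
  moreover from this have "6 \<le> i \<Longrightarrow> 0 \<le> lk (flip \<mu>) i" using q by (auto simp: G_def nn_def)
  ultimately show "0 \<le> lk \<mu> i" by (cases "i < 6") (auto simp: lookup_flip)
qed

text \<open>Exponents -1 - A in the six indeterminates add up to -6 - |A|; weight -6 together with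
  degree \<open>n\<close> in the T_i forces |A| = 2 n.\<close>

lemma matpoly_of_inv:
  assumes q: "q \<in> G V (int n)" and dg: "\<And>\<nu>. \<nu> \<in> ks q \<Longrightarrow> wdeg \<nu> = - 6"
  shows "matpoly n (of_inv q)"
  unfolding matpoly_def
proof (intro conjI ballI allI impI)
  show "nn {} (of_inv q)" using q by (rule nn_of_inv)
  fix \<mu> assume "\<mu> \<in> ks (of_inv q)"
  then have f: "flip \<mu> \<in> ks q" by (auto simp: in_keys_iff lookup_of_inv split: if_splits)
  then have "\<forall>i\<ge>9. lk (flip \<mu>) i = 0" and t: "tdeg (flip \<mu>) = int n" using q by (auto simp: G_def)
  then show "9 \<le> i \<Longrightarrow> lk \<mu> i = 0" for i by (simp add: lookup_flip)
  show "rdeg 6 \<mu> = int n" using t by (simp add: tdeg_def rdeg_def lookup_flip)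
  show "rdeg 0 \<mu> + rdeg 3 \<mu> = 2 * int n"
    using dg[OF f] t by (simp add: wdeg_def lessThan_6 rdeg_def lookup_flip)
qed

text \<open>On inverse monomials, multiplication by x_j lowers the exponent A_j by one, and the
  ratio of consecutive factorials turns this into differentiation in x_j. So x_j T_i acts as T_i
  times a derivative, which is one summand of \<open>pol 6 s\<close>.\<close>

lemma lookup_linear_times:
  fixes q :: "'a::field_char_0 laur"
  assumes s: "s \<in> {0, 3}" and \<mu>: "\<forall>i<6. 0 \<le> lk \<mu> i"
  shows "lk ((xvar s * xvar 6 + xvar (s + 1) * xvar 7 + xvar (s + 2) * xvar 8) * q) (flip \<mu>) =
    wt \<mu> * lk (pol 6 s (of_inv q)) \<mu>"
proof -
  have rs: "disjoint_rows 6 s" using s by (auto simp: disjoint_rows_numeral)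
  have *: "lk (xvar j * xvar i * q) (flip \<mu>) =
      wt \<mu> * (of_int (lk \<mu> j + 1) * lk (of_inv q) (\<mu> - sg i 1 + sg j 1))"
    if ij: "j < 6" "6 \<le> i" for i j
  proof -
    have e: "flip \<mu> - sg j 1 - sg i 1 = flip (\<mu> - sg i 1 + sg j 1)"
      using ij by (intro poly_mapping_eqI)
        (auto simp: lookup_flip lookup_minus lookup_add lookup_single when_def)
    have nn: "\<forall>k<6. 0 \<le> lk (\<mu> - sg i 1 + sg j 1) k"
      using \<mu> ij by (auto simp: lookup_minus lookup_add lookup_single when_def)
    have "lk (xvar j * xvar i * q) (flip \<mu>) = lk q (flip (\<mu> - sg i 1 + sg j 1))"
      unfolding e[symmetric] by (simp add: mult.assoc lookup_xvar_mult)
    also have "\<dots> = wt (\<mu> - sg i 1 + sg j 1) * lk (of_inv q) (\<mu> - sg i 1 + sg j 1)"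
      using nn by (simp add: lookup_of_inv wt_nz)
    also have "wt (\<mu> - sg i 1 + sg j 1) = (of_int (lk \<mu> j + 1) * wt \<mu> :: 'a)"
      using \<mu> ij by (intro wt_Suc) auto
    finally show ?thesis by (simp only: mult_ac)
  qed
  have "s < 6" "s + 1 < 6" "s + 2 < 6" using s by auto
  then show ?thesis
    using *[of s 6] *[of "s + 1" 7] *[of "s + 2" 8]
    by (simp add: distrib_right lookup_add lookup_pol[OF rs] distrib_left)
qed

lemma negl_linear_iff:
  fixes q :: "'a::field_char_0 laur"
  assumes s: "s \<in> {0, 3}" and q: "q \<in> G V d"
  shows "negl ((xvar s * xvar 6 + xvar (s + 1) * xvar 7 + xvar (s + 2) * xvar 8) * q) \<longleftrightarrow> pol 6 s (of_inv q) = 0"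
    (is "negl (?l * q) \<longleftrightarrow> _")
proof
  assume n: "negl (?l * q)"
  show "pol 6 s (of_inv q) = 0"
  proof (rule poly_mapping_eqI)
    fix \<mu>
    show "lk (pol 6 s (of_inv q)) \<mu> = lk 0 \<mu>"
    proof (cases "\<forall>i<6. 0 \<le> lk \<mu> i")
      case True
      have "flip \<mu> \<notin> ks (?l * q)" using n True by (force simp: negl_def lookup_flip)
      then show ?thesis using lookup_linear_times[OF s True, of q] by (simp add: in_keys_iff wt_nz)
    next
      case False
      then show ?thesis using nn_pol[OF nn_of_inv[OF q], of 6 s] by (auto simp: nn_def in_keys_iff)
    qed
  qed
next
  assume z: "pol 6 s (of_inv q) = 0"
  show "negl (?l * q)" unfolding negl_def
  proof (rule ballI, rule ccontr)
    fix \<nu> assume \<nu>: "\<nu> \<in> ks (?l * q)" "\<not> (\<exists>i<6. 0 \<le> lk \<nu> i)"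
    have "\<forall>i<6. 0 \<le> lk (flip \<nu>) i" using \<nu>(2) by (auto simp: lookup_flip not_le)
    from lookup_linear_times[OF s this, of q] z have "lk (?l * q) \<nu> = 0" by simp
    with \<nu>(1) show False by (simp add: in_keys_iff)
  qed
qed

lemma negl_l1_iff: "q \<in> G V d \<Longrightarrow> negl (l1 * q) \<longleftrightarrow> pol 6 0 (of_inv q) = 0"
  and negl_l2_iff: "q \<in> G V d \<Longrightarrow> negl (l2 * q) \<longleftrightarrow> pol 6 3 (of_inv q) = 0"
  for q :: "'a::field_char_0 laur"
  using negl_linear_iff[of 0 q d] negl_linear_iff[of 3 q d] by (simp_all add: l1_def l2_def)

text \<open>\<open>of_inv\<close> is inverted on \<open>det3 ^ n\<close> by multiplying with the
  factorials and reflecting the exponents; the conditions on \<open>l1\<close> and \<open>l2\<close>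
  then express the translation invariance of the determinant.\<close>

lemma socle_generator:
  "\<exists>q :: 'a::field_char_0 laur. q \<in> G V (int n) \<and> (\<forall>\<nu>\<in>ks q. wdeg \<nu> = - 6) \<and>
     negl (l1 * q) \<and> negl (l2 * q) \<and> of_inv q = det3 ^ n"
proof -
  let ?P = "det3 ^ n :: 'a laur"
  have P: "matpoly n ?P" by (rule matpoly_det3_power)
  then have nnP: "nn {} ?P" by (simp add: matpoly_def)
  define q where "q = (\<Sum>\<mu>\<in>ks ?P. sg (flip \<mu>) (lk ?P \<mu> * wt \<mu>))"
  have lq: "lk q \<nu> = lk ?P (flip \<nu>) * wt (flip \<nu>)" for \<nu>
    unfolding q_def by (subst lookup_reflect) (auto simp: in_keys_iff)
  have qG: "q \<in> G V (int n)"
    unfolding G_def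
  proof (safe)
    show "nn V q" unfolding nn_def
    proof (intro ballI allI impI)
      fix \<mu> i assume "\<mu> \<in> ks q" "i \<notin> V"
      then have "0 \<le> lk (flip \<mu>) i" using nnP by (auto simp: in_keys_iff lq nn_def)
      then show "0 \<le> lk \<mu> i" using \<open>i \<notin> V\<close> by (simp add: lookup_flip)
    qed
    fix \<mu> assume "\<mu> \<in> ks q"
    then have f: "flip \<mu> \<in> ks ?P" by (auto simp: in_keys_iff lq)
    then have "rdeg 6 (flip \<mu>) = int n" "\<forall>i\<ge>9. lk (flip \<mu>) i = 0" using P by (auto simp: matpoly_def)
    then show "tdeg \<mu> = int n" "9 \<le> i \<Longrightarrow> lk \<mu> i = 0" for i
      by (auto simp: rdeg_def tdeg_def lookup_flip)
  qed
  have "of_inv q = ?P"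
  proof (rule poly_mapping_eqI)
    fix \<mu>
    show "lk (of_inv q) \<mu> = lk ?P \<mu>"
      using nnP by (cases "\<mu> \<in> ks ?P") (auto simp: lookup_of_inv lq wt_nz nn_def in_keys_iff)
  qed
  moreover have "wdeg \<nu> = - 6" if "\<nu> \<in> ks q" for \<nu>
  proof -
    have "flip \<nu> \<in> ks ?P" using that by (auto simp: in_keys_iff lq)
    then have "rdeg 6 (flip \<nu>) = int n" "rdeg 0 (flip \<nu>) + rdeg 3 (flip \<nu>) = 2 * int n"
      using P by (auto simp: matpoly_def)
    then show ?thesis by (simp add: wdeg_def tdeg_def lessThan_6 rdeg_def lookup_flip)
  qed
  ultimately show ?thesis
    using qG by (intro exI[of _ q]) (simp add: negl_l1_iff negl_l2_iff pol_det3_power)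
qed

section \<open>Polynomials as Laurent polynomials\<close>

fun pos :: "indet \<Rightarrow> nat" where
  "pos Var_u = 0" | "pos Var_v = 1" | "pos Var_w = 2" | "pos Var_x = 3" | "pos Var_y = 4" | "pos Var_z = 5"

lemma pos_less: "pos i < 6" by (cases i) auto
lemma pos_inj: "pos i = pos j \<longleftrightarrow> i = j" by (cases i; cases j) auto
lemma pos_surj: "j < 6 \<Longrightarrow> \<exists>i. pos i = j"
proof -
  assume "j < 6"
  then consider "j = 0" | "j = 1" | "j = 2" | "j = 3" | "j = 4" | "j = 5" by linarith
  then show ?thesis using pos.simps by cases metis+
qed

definition ex :: "(indet \<Rightarrow>\<^sub>0 nat) \<Rightarrow> (nat \<Rightarrow>\<^sub>0 int)" where
  "ex \<mu> = (\<Sum>i\<in>ks \<mu>. sg (pos i) (int (lk \<mu> i)))"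

lemma lookup_ex: "lk (ex \<mu>) (pos i) = int (lk \<mu> i)"
proof -
  have "lk (ex \<mu>) (pos i) = (\<Sum>k\<in>ks \<mu>. if k = i then int (lk \<mu> i) else 0)"
    unfolding ex_def lookup_sum by (rule sum.cong) (auto simp: lookup_single when_def pos_inj)
  then show ?thesis by (auto simp: sum.delta in_keys_iff)
qed

lemma lookup_ex_ge: "6 \<le> j \<Longrightarrow> lk (ex \<mu>) j = 0"
  unfolding ex_def lookup_sum
  using pos_less by (intro sum.neutral) (auto simp: lookup_single when_def dest: not_less[THEN iffD2])

lemma lookup_ex_nonneg: "0 \<le> lk (ex \<mu>) j"
proof (cases "j < 6")
  case True
  then obtain i where "pos i = j" using pos_surj by blast
  then show ?thesis using lookup_ex[of \<mu> i] by simp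
qed (simp add: lookup_ex_ge)

lemma ex_eqI:
  assumes "\<And>i. lk \<nu> (pos i) = int (lk \<mu> i)" "\<And>j. 6 \<le> j \<Longrightarrow> lk \<nu> j = 0"
  shows "ex \<mu> = \<nu>"
proof (rule poly_mapping_eqI)
  fix j
  show "lk (ex \<mu>) j = lk \<nu> j"
  proof (cases "j < 6")
    case True
    then obtain i where "pos i = j" using pos_surj by blast
    then show ?thesis using lookup_ex[of \<mu> i] assms(1)[of i] by simp
  qed (simp add: lookup_ex_ge assms(2))
qed

lemma ex_add: "ex (\<mu> + \<nu>) = ex \<mu> + ex \<nu>"
  by (rule ex_eqI) (simp_all add: lookup_ex lookup_ex_ge lookup_add)

lemma ex_zero [simp]: "ex 0 = 0" by (simp add: ex_def)

lemma ex_inj: "ex \<mu> = ex \<nu> \<longleftrightarrow> \<mu> = \<nu>"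
  by (metis lookup_ex of_nat_eq_iff poly_mapping_eqI)

lemma ex_surj:
  assumes "\<And>j. 0 \<le> lk \<nu> j" "\<And>j. 6 \<le> j \<Longrightarrow> lk \<nu> j = 0"
  shows "\<exists>\<mu>. ex \<mu> = \<nu>"
proof -
  have "finite (UNIV :: indet set)"
  proof (rule finite_imageD)
    show "finite (range pos)" by (rule finite_subset[of _ "{..<6}"]) (auto simp: pos_less)
    show "inj pos" by (simp add: inj_on_def pos_inj)
  qed
  define \<mu> :: "indet \<Rightarrow>\<^sub>0 nat" where "\<mu> = (\<Sum>i\<in>UNIV. sg i (nat (lk \<nu> (pos i))))"
  have "lk \<mu> i = nat (lk \<nu> (pos i))" for i
    using \<open>finite (UNIV :: indet set)\<close>
    by (simp add: \<mu>_def lookup_sum lookup_single when_def)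
  then have "ex \<mu> = \<nu>" using assms by (intro ex_eqI) auto
  then show ?thesis ..
qed

definition emb :: "'a::field_char_0 poly6 \<Rightarrow> 'a laur" where
  "emb = pm_lift (\<lambda>\<mu>. sg (ex \<mu>) 1)"

lemma emb_zero [simp]: "emb 0 = 0" by (simp add: emb_def)
lemma emb_add: "emb (p + q) = emb p + emb q" by (simp add: emb_def pm_lift_add)
lemma emb_diff: "emb (p - q) = emb p - emb q" by (simp add: emb_def pm_lift_diff)
lemma emb_uminus: "emb (- p) = - emb p" by (simp add: emb_def pm_lift_uminus)
lemma emb_sum: "emb (sum f A) = (\<Sum>i\<in>A. emb (f i))" by (simp add: emb_def pm_lift_sum)
lemma emb_mult: "emb (p * q) = emb p * emb q"
  unfolding emb_def by (rule pm_lift_mult) (simp add: ex_add mult_single)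
lemma emb_single: "emb (sg \<mu> c) = sg (ex \<mu>) c"
  by (simp add: emb_def mult_single)
lemma emb_one [simp]: "emb 1 = 1"
  using emb_single[of 0 1] by (simp add: single_one)
lemma emb_const: "emb (const_poly c) = sg 0 c"
  by (simp add: const_poly_def emb_single)
lemma emb_var: "emb (var i) = xvar (pos i)"
proof -
  have "ex (sg i 1) = sg (pos i) 1"
    using pos_less by (intro ex_eqI) (auto simp: lookup_single when_def pos_inj dest: not_less[THEN iffD2])
  then show ?thesis by (simp add: var_def emb_single xvar_def)
qed
lemma emb_power: "emb (p ^ n) = emb p ^ n"
  by (induction n) (simp_all add: emb_mult)

lemma emb_expand: "emb p = (\<Sum>\<mu>\<in>ks p. sg (ex \<mu>) (lk p \<mu>))"
  by (simp add: emb_def pm_lift_def mult_single)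

lemma lookup_emb: "lk (emb p) (ex \<mu>) = lk p \<mu>"
proof -
  have "lk (emb p) (ex \<mu>) = (\<Sum>\<nu>\<in>ks p. if \<nu> = \<mu> then lk p \<mu> else 0)"
    unfolding emb_expand lookup_sum by (rule sum.cong) (auto simp: lookup_single when_def ex_inj)
  then show ?thesis by (auto simp: sum.delta in_keys_iff)
qed

lemma keys_emb: "ks (emb p) = ex ` ks p"
proof
  show "ks (emb p) \<subseteq> ex ` ks p"
    unfolding emb_expand using keys_sum[of "\<lambda>\<mu>. sg (ex \<mu>) (lk p \<mu>)" "ks p"] by auto
  show "ex ` ks p \<subseteq> ks (emb p)" by (auto simp: in_keys_iff lookup_emb)
qed

lemma emb_inj: "emb p = emb q \<longleftrightarrow> p = q"
  by (metis lookup_emb poly_mapping_eqI)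

lemma emb_in_G: "emb p \<in> G S 0"
  unfolding emb_expand
  by (intro G_sum G_single) (auto simp: lookup_ex_nonneg lookup_ex_ge tdeg_def)

lemma emb_surj:
  assumes "l \<in> G {} 0"
  shows "\<exists>p. emb p = l"
proof -
  have "\<exists>\<mu>. ex \<mu> = \<nu>" if \<nu>: "\<nu> \<in> ks l" for \<nu>
  proof (rule ex_surj)
    show nn: "0 \<le> lk \<nu> j" for j using assms \<nu> by (auto simp: G_def nn_def)
    show "lk \<nu> j = 0" if "6 \<le> j" for j
    proof (cases "9 \<le> j")
      case True
      then show ?thesis using assms \<nu> by (auto simp: G_def)
    next
      case False
      then have "j = 6 \<or> j = 7 \<or> j = 8" using that by auto
      moreover have "tdeg \<nu> = 0" using assms \<nu> by (auto simp: G_def)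
      ultimately show ?thesis using nn[of 6] nn[of 7] nn[of 8] by (auto simp: tdeg_def)
    qed
  qed
  then obtain u where u: "\<And>\<nu>. \<nu> \<in> ks l \<Longrightarrow> ex (u \<nu>) = \<nu>" by metis
  have "emb (\<Sum>\<nu>\<in>ks l. sg (u \<nu>) (lk l \<nu>)) = (\<Sum>\<nu>\<in>ks l. sg \<nu> (lk l \<nu>))"
    unfolding emb_sum emb_single by (rule sum.cong) (simp_all add: u)
  then show ?thesis unfolding sum_single_keys by blast
qed

lemma poly_grading_iff: "p \<in> poly_grading j \<longleftrightarrow> (\<forall>\<nu>\<in>ks (emb p). wdeg \<nu> = j)"
proof -
  have "int (\<Sum>i\<in>ks \<mu>. lk \<mu> i) = wdeg (ex \<mu>)" for \<mu> :: "indet \<Rightarrow>\<^sub>0 nat"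
  proof -
    have "(\<Sum>j<6. lk (ex \<mu>) j) = (\<Sum>j\<in>pos ` ks \<mu>. lk (ex \<mu>) j)"
    proof (rule sum.mono_neutral_right)
      show "\<forall>j\<in>{..<6} - pos ` ks \<mu>. lk (ex \<mu>) j = 0"
      proof
        fix j assume j: "j \<in> {..<6} - pos ` ks \<mu>"
        then obtain i where "pos i = j" using pos_surj by auto
        then show "lk (ex \<mu>) j = 0" using j by (auto simp: lookup_ex in_keys_iff)
      qed
    qed (auto simp: pos_less)
    also have "\<dots> = (\<Sum>i\<in>ks \<mu>. int (lk \<mu> i))"
      by (subst sum.reindex) (auto simp: inj_on_def pos_inj lookup_ex)
    finally show ?thesis by (simp add: wdeg_def tdeg_def lookup_ex_ge)
  qed
  then show ?thesis unfolding poly_grading_def keys_emb by simp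
qed

section \<open>Powers of the ideal of minors\<close>

lemma poly_ring_simps [simp]:
  "carrier poly_ring = UNIV" "p \<otimes>\<^bsub>poly_ring\<^esub> q = p * q" "p \<oplus>\<^bsub>poly_ring\<^esub> q = p + q"
  "\<zero>\<^bsub>poly_ring\<^esub> = 0" "\<one>\<^bsub>poly_ring\<^esub> = 1"
  by (simp_all add: ring_of_type_algebra_def)

lemma cring_poly_ring: "cring (poly_ring :: 'a::field_char_0 poly6 ring)"
  by (rule cring_from_type_algebra)

lemma ring_poly_ring: "ring (poly_ring :: 'a::field_char_0 poly6 ring)"
  using cring_poly_ring by (rule cring.axioms(1))

text \<open>The image of the degree-\<open>t\<close> part of \<open>R[T\<^sub>1, T\<^sub>2, T\<^sub>3]\<close> under \<open>T\<^sub>i \<mapsto> \<Delta>\<^sub>i\<close>, hence \<open>I\<^sup>t\<close>.\<close>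

definition rees :: "nat \<Rightarrow> 'a::field_char_0 poly6 set" where
  "rees t = {p. emb p \<in> ev ` G {} (int t)}"

lemma rees_add: "p \<in> rees t \<Longrightarrow> q \<in> rees t \<Longrightarrow> p + q \<in> rees t"
  unfolding rees_def by (auto simp: emb_add ev_add[symmetric] intro!: imageI G_add)

lemma rees_uminus: "p \<in> rees t \<Longrightarrow> - p \<in> rees t"
  unfolding rees_def by (auto simp: emb_uminus ev_uminus[symmetric] intro!: imageI G_uminus)

lemma rees_zero: "0 \<in> rees t"
  unfolding rees_def using ev_zero G_zero[of "{}" "int t"] by (auto intro: image_eqI[of _ _ 0])

lemma rees_mult: "p \<in> rees s \<Longrightarrow> q \<in> rees t \<Longrightarrow> p * q \<in> rees (s + t)"
  unfolding rees_def
  by (auto simp: emb_mult ev_mult[symmetric] intro!: imageI G_mult)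

lemma rees_0: "rees 0 = UNIV"
proof -
  have "emb p \<in> ev ` G {} (int 0)" for p :: "'a poly6"
    using emb_in_G[of p "{}"] by (intro image_eqI[of _ _ "emb p"]) (simp_all add: ev_free)
  then show ?thesis by (auto simp: rees_def)
qed

lemma ideal_rees: "ideal (rees t :: 'a::field_char_0 poly6 set) poly_ring"
proof (rule idealI)
  show "ring poly_ring" by (rule ring_poly_ring)
  show "subgroup (rees t :: 'a poly6 set) (add_monoid poly_ring)"
  proof
    fix p :: "'a poly6" assume p: "p \<in> rees t"
    interpret ring "poly_ring :: 'a poly6 ring" by (rule ring_poly_ring)
    have "inv\<^bsub>add_monoid poly_ring\<^esub> p = - p"
      using minus_equality[of "- p" p] by (simp add: a_inv_def)
    then show "inv\<^bsub>add_monoid poly_ring\<^esub> p \<in> rees t" using p by (simp add: rees_uminus)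
  qed (auto intro: rees_add rees_zero)
  show "x \<otimes>\<^bsub>poly_ring\<^esub> p \<in> rees t" "p \<otimes>\<^bsub>poly_ring\<^esub> x \<in> rees t"
    if "p \<in> rees t" for x p :: "'a poly6"
    using rees_mult[of x 0 p t] rees_mult[of p t x 0] that by (auto simp: rees_0)
qed

definition minor_poly :: "nat \<Rightarrow> 'a::field_char_0 poly6" where
  "minor_poly i = (if i = 6 then var Var_v * var Var_z - var Var_w * var Var_y
     else if i = 7 then var Var_w * var Var_x - var Var_u * var Var_z
     else var Var_u * var Var_y - var Var_v * var Var_x)"

lemma emb_minor_poly: "emb (minor_poly i) = minor i"
  by (simp add: minor_poly_def minor_def emb_diff emb_mult emb_var)

lemma minor_poly_in_rees: "minor_poly i \<in> rees 1"
proof -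
  define j where "j = (if i = 6 \<or> i = 7 then i else 8)"
  have "minor i = minor j" "j \<in> {6, 7, 8}" by (auto simp: minor_def j_def)
  then show ?thesis unfolding rees_def
    by (auto simp: emb_minor_poly ev_xvar intro!: image_eqI[of _ _ "xvar j"] G_xvar1)
qed

text \<open>A monomial of positive degree in the T_i is divisible by one of them; \<open>?P\<close>
  assigns it to the first such.\<close>

lemma split_G:
  fixes g :: "'a::field laur"
  assumes g: "g \<in> G {} (d + 1)" and d: "0 \<le> d"
  shows "\<exists>a\<in>G {} d. \<exists>b\<in>G {} d. \<exists>c\<in>G {} d. g = xvar 6 * a + xvar 7 * b + xvar 8 * c"
proof -
  let ?P = "\<lambda>i \<mu>. i = (if 1 \<le> lk \<mu> 6 then 6 else if 1 \<le> lk \<mu> 7 then 7 else 8 :: nat)"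
  define f where "f i = xvar_inv i * restr (?P i) g" for i
  have f: "f i \<in> G {} d" if i: "i \<in> {6, 7, 8}" for i
    unfolding G_def nn_def
  proof (safe)
    fix \<mu> assume "\<mu> \<in> ks (f i)"
    then obtain \<nu> where \<nu>: "\<nu> \<in> ks g" "?P i \<nu>" "\<mu> = sg i (-1) + \<nu>"
      by (auto simp: f_def xvar_inv_def keys_single_times keys_restr)
    have g\<nu>: "\<And>j. 0 \<le> lk \<nu> j" "\<And>j. 9 \<le> j \<Longrightarrow> lk \<nu> j = 0" "tdeg \<nu> = d + 1"
      using g \<nu>(1) by (auto simp: G_def nn_def)
    have "1 \<le> lk \<nu> i" using i \<nu>(2) g\<nu>(3) d g\<nu>(1)[of 6] g\<nu>(1)[of 7]
      by (auto simp: tdeg_def split: if_splits)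
    then show "0 \<le> lk \<mu> j" for j using g\<nu>(1)[of j] by (auto simp: \<nu>(3) lookup_add lookup_single when_def)
    show "lk \<mu> j = 0" if "9 \<le> j" for j
      using g\<nu>(2)[OF that] that i by (auto simp: \<nu>(3) lookup_add lookup_single when_def)
    show "tdeg \<mu> = d" using g\<nu>(3) i by (auto simp: \<nu>(3) tdeg_def lookup_add lookup_single when_def)
  qed
  have Xf: "xvar i * f i = restr (?P i) g" for i by (simp add: f_def mult.assoc[symmetric])
  have "g = xvar 6 * f 6 + xvar 7 * f 7 + xvar 8 * f 8"
    unfolding Xf by (rule poly_mapping_eqI) (auto simp: lookup_add lookup_restr)
  with f show ?thesis by blast
qed

text \<open>The cofactors from \<open>split_G\<close> involve the T_i; applying \<open>ev\<close>
  makes them polynomials in the six indeterminates, hence values of \<open>emb\<close>.\<close>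

lemma rees_Suc:
  fixes p :: "'a::field_char_0 poly6"
  assumes "p \<in> rees (Suc t)"
  shows "\<exists>a\<in>rees t. \<exists>b\<in>rees t. \<exists>c\<in>rees t. p = a * minor_poly 6 + b * minor_poly 7 + c * minor_poly 8"
proof -
  obtain g where g: "g \<in> G {} (int t + 1)" "emb p = ev g" using assms by (auto simp: rees_def add.commute)
  then obtain a b c where abc: "a \<in> G {} (int t)" "b \<in> G {} (int t)" "c \<in> G {} (int t)"
    and eq: "g = xvar 6 * a + xvar 7 * b + xvar 8 * c" using split_G[OF g(1) of_nat_0_le_iff] by blast
  obtain a' b' c' where e: "emb a' = ev a" "emb b' = ev b" "emb c' = ev c"
    using emb_surj[OF ev_in_G[OF abc(1)]] emb_surj[OF ev_in_G[OF abc(2)]]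
      emb_surj[OF ev_in_G[OF abc(3)]] by auto
  have ev_T: "ev (xvar i * q) = minor i * ev q" if "i \<in> {6, 7, 8}" "q \<in> G {} (int t)" for i and q :: "'a laur"
    using ev_mult[OF G_xvar1[OF that(1)] that(2)] that(1) by (auto simp: ev_xvar)
  have "emb p = emb (a' * minor_poly 6 + b' * minor_poly 7 + c' * minor_poly 8)"
  proof -
    have "emb p = minor 6 * ev a + minor 7 * ev b + minor 8 * ev c"
      unfolding g(2) eq ev_add using abc by (simp add: ev_T)
    then show ?thesis by (simp add: emb_add emb_mult emb_minor_poly e mult.commute)
  qed
  moreover have "a' \<in> rees t" "b' \<in> rees t" "c' \<in> rees t" using abc e by (auto simp: rees_def)
  ultimately show ?thesis by (auto simp: emb_inj)
qed

lemma minors_ideal_eq: "(minors_ideal :: 'a::field_char_0 poly6 set) = rees 1"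
proof
  interpret cring "poly_ring :: 'a poly6 ring" by (rule cring_poly_ring)
  show "minors_ideal \<subseteq> (rees 1 :: 'a poly6 set)"
    unfolding minors_ideal_def by (rule genideal_minimal[OF ideal_rees])
      (use minor_poly_in_rees[of 6] minor_poly_in_rees[of 7] minor_poly_in_rees[of 8] in
        \<open>simp add: minor_poly_def\<close>)
  have I: "ideal (minors_ideal :: 'a poly6 set) poly_ring"
    unfolding minors_ideal_def by (rule genideal_ideal) simp
  have mem: "minor_poly i \<in> (minors_ideal :: 'a poly6 set)" for i
    unfolding minors_ideal_def minor_poly_def
    by (rule subsetD[OF genideal_self]) auto
  show "rees 1 \<subseteq> (minors_ideal :: 'a poly6 set)"
  proof
    fix p :: "'a poly6" assume "p \<in> rees 1"
    then obtain a b c where p: "p = a * minor_poly 6 + b * minor_poly 7 + c * minor_poly 8"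
      using rees_Suc[of p 0] by auto
    have m: "x * minor_poly i \<in> minors_ideal" for x :: "'a poly6" and i
      using ideal.I_l_closed[OF I mem] by simp
    have add: "x + y \<in> minors_ideal" if "x \<in> minors_ideal" "y \<in> minors_ideal" for x y :: "'a poly6"
      using additive_subgroup.a_closed[OF ideal.axioms(1)[OF I] that] by simp
    show "p \<in> minors_ideal" unfolding p by (intro add m)
  qed
qed

lemma minors_power_eq: "(minors_power t :: 'a::field_char_0 poly6 set) = rees t"
proof (induction t)
  case 0
  show ?case by (simp add: minors_power_def ideals_set_def rees_0)
next
  case (Suc t)
  have "minors_power (Suc t) = ideal_prod poly_ring (rees t) (rees 1 :: 'a poly6 set)"
  proof -
    have "minors_power (Suc t) = ideal_prod poly_ring (minors_power t) (minors_ideal :: 'a poly6 set)"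
      by (simp add: minors_power_def ideals_set_def)
    then show ?thesis by (simp only: Suc.IH minors_ideal_eq)
  qed
  also have "\<dots> = rees (Suc t)"
  proof
    show "ideal_prod poly_ring (rees t) (rees 1) \<subseteq> (rees (Suc t) :: 'a poly6 set)"
    proof
      fix p :: "'a poly6" assume "p \<in> ideal_prod poly_ring (rees t) (rees 1)"
      then show "p \<in> rees (Suc t)"
        by (induction rule: ideal_prod.induct) (use rees_mult[of _ t _ 1] in \<open>auto intro: rees_add\<close>)
    qed
    show "rees (Suc t) \<subseteq> ideal_prod poly_ring (rees t) (rees 1 :: 'a poly6 set)"
    proof
      fix p :: "'a poly6" assume "p \<in> rees (Suc t)"
      then obtain a b c where p: "p = a * minor_poly 6 + b * minor_poly 7 + c * minor_poly 8"
        and abc: "a \<in> rees t" "b \<in> rees t" "c \<in> rees t" using rees_Suc by blast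
      note m = minor_poly_in_rees
      have pr: "x * minor_poly i \<in> ideal_prod poly_ring (rees t) (rees 1)"
        if "x \<in> rees t" for x :: "'a poly6" and i
        using ideal_prod.prod[OF that m, of poly_ring i] by simp
      have add: "x + y \<in> ideal_prod poly_ring (rees t) (rees 1)"
        if "x \<in> ideal_prod poly_ring (rees t) (rees 1)" "y \<in> ideal_prod poly_ring (rees t) (rees 1)"
        for x y :: "'a poly6"
        using ideal_prod.sum[OF that] by simp
      show "p \<in> ideal_prod poly_ring (rees t) (rees 1)" unfolding p by (intro add pr abc)
    qed
  qed
  finally show ?case .
qed

section \<open>One-dimensional vector spaces\<close>

lemma line_vectorspace:
  fixes H :: "('a::field_char_0, 'm) module" and h :: "'a \<Rightarrow> 'm"
  assumes carrier: "carrier H = range h" and inj: "inj h"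
    and add: "\<And>a b. h a \<oplus>\<^bsub>H\<^esub> h b = h (a + b)" and zero: "\<zero>\<^bsub>H\<^esub> = h 0"
    and smult: "\<And>a b. a \<odot>\<^bsub>H\<^esub> h b = h (a * b)"
  shows "vectorspace base_field H \<and> vectorspace.fin_dim base_field H \<and> vectorspace.dim base_field H = 1"
proof -
  let ?K = "base_field :: 'a ring"
  have K: "carrier ?K = UNIV" "\<And>x y. x \<otimes>\<^bsub>?K\<^esub> y = x * y" "\<And>x y. x \<oplus>\<^bsub>?K\<^esub> y = x + y"
    "\<zero>\<^bsub>?K\<^esub> = 0" "\<one>\<^bsub>?K\<^esub> = 1"
    by (simp_all add: ring_of_type_algebra_def)
  have "abelian_group H"
  proof (rule abelian_groupI)
    fix x assume "x \<in> carrier H"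
    then obtain a where "x = h a" by (auto simp: carrier)
    then have "h (- a) \<oplus>\<^bsub>H\<^esub> x = \<zero>\<^bsub>H\<^esub>" by (simp add: add zero)
    then show "\<exists>y\<in>carrier H. y \<oplus>\<^bsub>H\<^esub> x = \<zero>\<^bsub>H\<^esub>" by (auto simp: carrier)
  qed (auto simp: carrier add zero algebra_simps)
  moreover have "cring ?K" by (rule cring_from_type_algebra)
  ultimately have M: "module ?K H"
    by (intro moduleI) (auto simp: carrier K smult add algebra_simps)
  moreover have "field ?K" by (rule field_from_type_algebra)
  ultimately have V: "vectorspace ?K H" by (rule vectorspace.intro)
  interpret vectorspace ?K H by (rule V)
  have h1: "h 1 \<in> carrier H" by (simp add: carrier)
  have lc: "lincomb a {h 1} = h (a (h 1))" for a
    using h1 smult by (simp add: lincomb_def carrier)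
  have "gen_set {h 1}"
  proof
    show "span {h 1} \<subseteq> carrier H" using h1 by (intro span_is_subset2) simp
    show "carrier H \<subseteq> span {h 1}"
    proof
      fix v assume "v \<in> carrier H"
      then obtain b where "v = h b" by (auto simp: carrier)
      then have "v = lincomb (\<lambda>_. b) {h 1}" by (simp add: lc)
      then show "v \<in> span {h 1}" by (auto simp: span_def K)
    qed
  qed
  moreover have "lin_indpt {h 1}"
  proof
    assume "lin_dep {h 1}"
    then obtain A a v where A: "A \<subseteq> {h 1}" "lincomb a A = \<zero>\<^bsub>H\<^esub>" "v \<in> A" "a v \<noteq> 0"
      by (auto simp: lin_dep_def K)
    then have "A = {h 1}" "v = h 1" by auto
    then show False using A inj \<open>\<zero>\<^bsub>H\<^esub> = h 0\<close> by (auto simp: lc inj_def)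
  qed
  ultimately have b: "basis {h 1}" using h1 by (simp add: basis_def)
  then have "dim = 1" using dim_basis[of "{h 1}"] by simp
  moreover have "fin_dim" using b unfolding fin_dim_def basis_def by blast
  ultimately show ?thesis using V by blast
qed

section \<open>Localizations of \<open>R / I\<^sup>t\<close>\<close>

text \<open>The extension of \<open>I\<^sup>t\<close> to the localization of \<open>R\<close> at the product of the indeterminates in \<open>S\<close>.\<close>

definition JJ :: "nat \<Rightarrow> nat set \<Rightarrow> 'a::field_char_0 laur set" where
  "JJ t S = ev ` G S (int t)"

lemma JJ_add: "p \<in> JJ t S \<Longrightarrow> q \<in> JJ t S \<Longrightarrow> p + q \<in> JJ t S"
  unfolding JJ_def by (auto simp: ev_add[symmetric] intro!: imageI G_add)
lemma JJ_uminus: "p \<in> JJ t S \<Longrightarrow> - p \<in> JJ t S"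
  unfolding JJ_def by (auto simp: ev_uminus[symmetric] intro!: imageI G_uminus)
lemma JJ_zero: "0 \<in> JJ t S"
  unfolding JJ_def by (rule image_eqI[of _ _ 0]) auto
lemma JJ_sum: "(\<And>j. j \<in> A \<Longrightarrow> f j \<in> JJ t S) \<Longrightarrow> sum f A \<in> JJ t S"
  by (induction A rule: infinite_finite_induct) (auto intro: JJ_add JJ_zero)
lemma JJ_esg:
  fixes p :: "'a::field_char_0 laur"
  shows "p \<in> JJ t S \<Longrightarrow> esg T j * p \<in> JJ t S"
  using esg_cases[of T j, where 'b = "'a laur"] by (auto intro: JJ_uminus)
lemma JJ_mult: "r \<in> G S 0 \<Longrightarrow> p \<in> JJ t S \<Longrightarrow> S \<subseteq> V \<Longrightarrow> r * p \<in> JJ t S"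
proof -
  assume r: "r \<in> G S 0" and "p \<in> JJ t S" and S: "S \<subseteq> V"
  then obtain g where g: "g \<in> G S (int t)" "p = ev g" by (auto simp: JJ_def)
  have "r * p = ev (r * g)" using ev_mult[OF r g(1) S] ev_free[OF r S] g(2) by simp
  then show ?thesis unfolding JJ_def using G_mult0[OF r g(1)] by blast
qed
lemma JJ_mono: "p \<in> JJ t S \<Longrightarrow> S \<subseteq> T \<Longrightarrow> p \<in> JJ t T"
  unfolding JJ_def by (auto intro: G_mono)
lemma JJ_commute: "p - q \<in> JJ t S \<longleftrightarrow> q - p \<in> JJ t S"
  using JJ_uminus[of "p - q" t S] JJ_uminus[of "q - p" t S] by auto
lemma JJ_trans: "p - q \<in> JJ t S \<Longrightarrow> q - r \<in> JJ t S \<Longrightarrow> p - r \<in> JJ t S"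
  using JJ_add[of "p - q" t S "q - r"] by simp

lemma rees_JJ: "p \<in> rees t \<longleftrightarrow> emb p \<in> JJ t {}"
  by (simp add: rees_def JJ_def)

abbreviation gens :: "'a::field_char_0 poly6 list" where "gens \<equiv> max_ideal_gens"
abbreviation prodx :: "nat set \<Rightarrow> 'a::field_char_0 poly6" where "prodx \<equiv> cech_elt poly_ring gens"

lemma pow_poly_ring [simp]: "p [^]\<^bsub>poly_ring\<^esub> (n::nat) = p ^ n"
  by (induction n) (simp_all add: mult.commute)

lemma emb_gens: "j < 6 \<Longrightarrow> emb (gens ! j) = xvar j"
proof -
  assume "j < 6"
  then consider "j = 0" | "j = 1" | "j = 2" | "j = 3" | "j = 4" | "j = 5" by linarith
  then show ?thesis by cases (simp_all add: max_ideal_gens_def emb_var)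
qed

lemma xpow_insert: "finite S \<Longrightarrow> j \<notin> S \<Longrightarrow> xpow (insert j S) n = xpow {j} n * xpow S n"
  by (simp add: xpow_def mult_single)

lemma xpow_power: "xpow S m ^ n = xpow S (m * int n)"
  by (induction n) (simp_all add: algebra_simps xpow_add)

lemma xpow_1: "xpow {j} 1 = xvar j"
  by (simp add: xpow_def xvar_def)

lemma cech_elt_insert:
  "finite S \<Longrightarrow> j \<notin> S \<Longrightarrow> prodx (insert j S) = gens ! j * (prodx S :: 'a::field_char_0 poly6)"
proof -
  assume S: "finite S" "j \<notin> S"
  interpret cring "poly_ring :: 'a poly6 ring" by (rule cring_poly_ring)
  show ?thesis unfolding cech_elt_def using S by (subst finprod_insert) auto
qed

lemma cech_elt_empty: "prodx {} = (1 :: 'a::field_char_0 poly6)"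
proof -
  interpret cring "poly_ring :: 'a poly6 ring" by (rule cring_poly_ring)
  show ?thesis by (simp add: cech_elt_def)
qed

lemma emb_prodx: "S \<subseteq> V \<Longrightarrow> emb (prodx S) = xpow S 1"
proof -
  assume S: "S \<subseteq> V"
  then have "finite S" by (rule finite_subV)
  then show ?thesis using S
  proof (induction S rule: finite_induct)
    case empty
    show ?case by (simp add: cech_elt_empty xpow_def single_one)
  next
    case (insert j S)
    then show ?case by (simp add: cech_elt_insert emb_mult emb_gens xpow_insert xpow_1)
  qed
qed

lemma emb_prodx_power: "S \<subseteq> V \<Longrightarrow> emb (prodx S ^ n) = xpow S (int n)"
  by (simp add: emb_power emb_prodx xpow_power)

section \<open>Cosets modulo powers of the ideal\<close>

definition cst :: "nat \<Rightarrow> 'a::field_char_0 poly6 \<Rightarrow> 'a poly6 set" where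
  "cst t p = minors_power t +>\<^bsub>poly_ring\<^esub> p"

lemma cst_eq: "cst t p = (\<lambda>i. i + p) ` rees t"
  by (auto simp: cst_def minors_power_eq a_r_coset_def r_coset_def)

lemma cst_eq_iff: "cst t p = cst t q \<longleftrightarrow> p - q \<in> rees t"
proof
  assume "cst t p = cst t q"
  moreover have "p \<in> cst t p" unfolding cst_eq using rees_zero[of t] by (rule rev_image_eqI) simp
  ultimately obtain i where "i \<in> rees t" "p = i + q" by (auto simp: cst_eq)
  then show "p - q \<in> rees t" by simp
next
  assume d: "p - q \<in> rees t"
  have sub: "cst t p \<subseteq> cst t q" if "p - q \<in> rees t" for p q :: "'a poly6"
    unfolding cst_eq
  proof
    fix x assume "x \<in> (\<lambda>i. i + p) ` rees t"
    then obtain i where "i \<in> rees t" "x = i + p" by auto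
    then show "x \<in> (\<lambda>i. i + q) ` rees t"
      using rees_add[OF _ that, of i] by (intro rev_image_eqI[of "i + (p - q)"]) auto
  qed
  show "cst t p = cst t q" using sub[OF d] sub[of q p] rees_uminus[OF d] by auto
qed

lemma coset_regular: "rees t +>\<^bsub>regular_module poly_ring\<^esub> p = cst t p"
  by (auto simp: cst_eq a_r_coset_def r_coset_def regular_module_def)

lemma thickening_carrier: "carrier (thickening t) = range (cst t)"
  by (auto simp: thickening_def quotient_module_def A_RCOSETS_def RCOSETS_def minors_power_eq
      coset_regular[symmetric] a_r_coset_def regular_module_def)

lemma thickening_zero: "\<zero>\<^bsub>thickening t\<^esub> = cst t 0"
  by (simp add: thickening_def quotient_module_def minors_power_eq cst_eq)

lemma thickening_add: "cst t p \<oplus>\<^bsub>thickening t\<^esub> cst t q = cst t (p + q)"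
proof -
  have "cst t p \<oplus>\<^bsub>thickening t\<^esub> cst t q = {x + y | x y. x \<in> cst t p \<and> y \<in> cst t q}"
    by (auto simp: thickening_def quotient_module_def set_add_def set_mult_def regular_module_def)
  also have "\<dots> = cst t (p + q)"
  proof (rule equalityI; rule subsetI)
    fix z assume "z \<in> {x + y | x y. x \<in> cst t p \<and> y \<in> cst t q}"
    then obtain i j where "i \<in> rees t" "j \<in> rees t" "z = (i + p) + (j + q)" by (auto simp: cst_eq)
    then show "z \<in> cst t (p + q)" unfolding cst_eq
      by (intro rev_image_eqI[of "i + j"]) (auto intro: rees_add)
  next
    fix z assume "z \<in> cst t (p + q)"
    then obtain i where "i \<in> rees t" "z = (i + p) + (0 + q)" by (auto simp: cst_eq add.assoc)
    then show "z \<in> {x + y | x y. x \<in> cst t p \<and> y \<in> cst t q}"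
      using rees_zero[of t] unfolding cst_eq by blast
  qed
  finally show ?thesis .
qed

text \<open>Operations on quotients and localizations are defined as unions over all
  representatives; independence of the representative makes the union equal to the common
  value.\<close>

lemma UN_const: "a \<in> A \<Longrightarrow> (\<And>x. x \<in> A \<Longrightarrow> B x = C) \<Longrightarrow> (\<Union>x\<in>A. B x) = C"
  by auto

lemma thickening_smult: "r \<odot>\<^bsub>thickening t\<^esub> cst t p = cst t (r * p)"
proof -
  have "r \<odot>\<^bsub>thickening t\<^esub> cst t p = (\<Union>x\<in>cst t p. cst t (r * x))"
    by (simp add: thickening_def quotient_module_def minors_power_eq coset_regular)
      (simp add: regular_module_def)
  also have "\<dots> = cst t (r * p)"
  proof (rule UN_const)
    show "0 + p \<in> cst t p" unfolding cst_eq using rees_zero by (rule imageI)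
    fix x assume "x \<in> cst t p"
    then obtain i where "i \<in> rees t" "x = i + p" by (auto simp: cst_eq)
    then have "r * x - r * p \<in> rees t"
      using rees_mult[of r 0 i t] by (simp add: rees_0 algebra_simps)
    then show "cst t (r * x) = cst t (r * p)" by (simp add: cst_eq_iff)
  qed
  finally show ?thesis .
qed

text \<open>The class in the localization at \<open>prodx S\<close> that corresponds to the Laurent polynomial \<open>l\<close>.\<close>

definition cls :: "nat \<Rightarrow> nat set \<Rightarrow> 'a::field_char_0 laur \<Rightarrow> ('a poly6 set \<times> nat) set" where
  "cls t S l = {(cst t p, a) | p a. emb p * xpow S (- int a) - l \<in> JJ t S}"

lemma cls_cong: "l - l' \<in> JJ t S \<Longrightarrow> cls t S l = cls t S l'"
proof -
  have "cls t S l \<subseteq> cls t S l'" if "l - l' \<in> JJ t S" for l l'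
    unfolding cls_def using JJ_trans[OF _ that] by blast
  then show "l - l' \<in> JJ t S \<Longrightarrow> cls t S l = cls t S l'" using JJ_commute[of l l' t S] by blast
qed

lemma fraction_exists:
  assumes S: "S \<subseteq> V" and l: "l \<in> G S 0"
  shows "\<exists>p a. l = emb p * xpow S (- int a)"
proof -
  have fin: "finite S" using S by (rule finite_subV)
  obtain N where N: "nn {} (xpow S (int N) * l)"
    using clear_denominators[OF fin, of "{}" l] l by (auto simp: G_def)
  have "xpow S (int N) * l \<in> G {} 0"
    using G_mult0[OF G_xpow[OF fin S] l, of "int N"] N by (auto simp: G_def)
  then obtain p where p: "emb p = xpow S (int N) * l" using emb_surj by blast
  have "emb p * xpow S (- int N) = (xpow S (int N) * xpow S (- int N)) * l"
    unfolding p by (simp only: mult_ac)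
  then have "l = emb p * xpow S (- int N)" by simp
  then show ?thesis by blast
qed

lemma fraction_in_G: "S \<subseteq> V \<Longrightarrow> emb p * xpow S n \<in> G S 0"
  using finite_subV by (intro G_mult0 emb_in_G G_xpow)

lemma cls_mem: "emb p * xpow S (- int a) - l \<in> JJ t S \<Longrightarrow> (cst t p, a) \<in> cls t S l"
  by (auto simp: cls_def)

lemma cls_cases:
  assumes "(m, a) \<in> cls t S l"
  obtains p where "m = cst t p" "emb p * xpow S (- int a) - l \<in> JJ t S"
  using assms by (auto simp: cls_def)

text \<open>Membership in the extended ideal is tested in R. The preimage \<open>g\<close> under
  \<open>ev\<close> has denominators in \<open>S\<close> only, and clearing them before
  \<open>ev\<close> is applied gives an element of \<open>rees t\<close>.\<close>

lemma fraction_JJ_iff: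
  assumes S: "S \<subseteq> V"
  shows "emb p * xpow S (- int a) \<in> JJ t S \<longleftrightarrow> (\<exists>c. prodx S ^ c * p \<in> rees t)"
proof
  have fin: "finite S" using S by (rule finite_subV)
  assume "emb p * xpow S (- int a) \<in> JJ t S"
  then obtain g where g: "g \<in> G S (int t)" "emb p * xpow S (- int a) = ev g" by (auto simp: JJ_def)
  obtain N where N: "nn {} (xpow S (int N) * g)"
    using clear_denominators[OF fin, of "{}" g] g by (auto simp: G_def)
  let ?g = "xpow S (int a) * (xpow S (int N) * g)"
  have "nn {} ?g" by (rule nn_mult[OF nn_xpow_nonneg[OF fin] N]) simp
  moreover have gS: "?g \<in> G S (int t)" by (intro G_mult0 G_xpow fin S g)
  ultimately have gG: "?g \<in> G {} (int t)" by (auto simp: G_def)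
  have "ev ?g = xpow S (int a) * (xpow S (int N) * ev g)"
    by (simp add: ev_mult[OF G_xpow[OF fin S] G_mult0[OF G_xpow[OF fin S] g(1)] S]
      ev_mult[OF G_xpow[OF fin S] g(1) S] ev_free[OF G_xpow[OF fin S] S])
  also have "\<dots> = xpow S (int N) * emb p * (xpow S (int a) * xpow S (- int a))"
    unfolding g(2)[symmetric] by (simp only: mult_ac)
  also have "\<dots> = emb (prodx S ^ N * p)" by (simp add: emb_mult emb_prodx_power[OF S])
  finally have "emb (prodx S ^ N * p) \<in> JJ t {}" using gG unfolding JJ_def by (metis imageI)
  then show "\<exists>c. prodx S ^ c * p \<in> rees t" unfolding rees_JJ by blast
next
  have fin: "finite S" using S by (rule finite_subV)
  assume "\<exists>c. prodx S ^ c * p \<in> rees t"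
  then obtain c where "xpow S (int c) * emb p \<in> JJ t {}"
    by (auto simp: rees_JJ emb_mult emb_prodx_power[OF S])
  then have "xpow S (int c) * emb p \<in> JJ t S" by (rule JJ_mono) simp
  from JJ_mult[OF G_xpow[OF fin S] JJ_mult[OF G_xpow[OF fin S] this S] S, of "- int a" "- int c"]
  show "emb p * xpow S (- int a) \<in> JJ t S"
    by (simp add: mult.assoc[symmetric]) (simp add: mult_ac)
qed

abbreviation loc :: "nat \<Rightarrow> nat set \<Rightarrow> ('a::field_char_0 poly6, ('a poly6 set \<times> nat) set) module" where
  "loc t S \<equiv> localization poly_ring (thickening t) (prodx S)"

text \<open>Localization commutes with passing to R / I^t: \<open>fraction_JJ_iff\<close>, applied
  to the cross difference \<open>?r\<close>, turns equality of fractions into congruence of Laurent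
  polynomials.\<close>

lemma loc_frac_eq:
  assumes S: "S \<subseteq> V"
  shows "loc_frac poly_ring (thickening t) (prodx S) (cst t p) a = cls t S (emb p * xpow S (- int a))"
proof -
  have *: "(\<exists>c::nat. cst t (prodx S ^ c * (prodx S ^ b * p)) = cst t (prodx S ^ c * (prodx S ^ a * q))) \<longleftrightarrow>
      emb q * xpow S (- int b) - emb p * xpow S (- int a) \<in> JJ t S" for b q
  proof -
    let ?r = "prodx S ^ b * p - prodx S ^ a * q"
    have "emb ?r * xpow S (- int (a + b)) = emb p * xpow S (- int a) - emb q * xpow S (- int b)"
    proof -
      have x: "xpow S (int b) * xpow S (- int (a + b)) = xpow S (- int a)"
        "xpow S (int a) * xpow S (- int (a + b)) = xpow S (- int b)"
        by (simp_all flip: xpow_add)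
      have "emb ?r * xpow S (- int (a + b)) =
          emb p * (xpow S (int b) * xpow S (- int (a + b))) -
          emb q * (xpow S (int a) * xpow S (- int (a + b)))"
        unfolding emb_diff emb_mult emb_prodx_power[OF S]
        by (simp only: left_diff_distrib right_diff_distrib mult_ac)
      then show ?thesis unfolding x .
    qed
    moreover have "(\<exists>c. cst t (prodx S ^ c * (prodx S ^ b * p)) = cst t (prodx S ^ c * (prodx S ^ a * q))) \<longleftrightarrow>
      (\<exists>c. prodx S ^ c * ?r \<in> rees t)"
      by (simp add: cst_eq_iff right_diff_distrib)
    ultimately show ?thesis
      using fraction_JJ_iff[OF S, of ?r "a + b" t] JJ_commute by metis
  qed
  have "loc_frac poly_ring (thickening t) (prodx S) (cst t p) a =
      {(n, b). n \<in> range (cst t) \<and> (\<exists>c::nat.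
        prodx S ^ c \<odot>\<^bsub>thickening t\<^esub> (prodx S ^ b \<odot>\<^bsub>thickening t\<^esub> cst t p) =
        prodx S ^ c \<odot>\<^bsub>thickening t\<^esub> (prodx S ^ a \<odot>\<^bsub>thickening t\<^esub> n))}"
    by (auto simp: loc_frac_def loc_rel_def thickening_carrier)
  also have "\<dots> = cls t S (emb p * xpow S (- int a))"
    unfolding cls_def by (auto simp: thickening_smult *[symmetric]; blast)
  finally show ?thesis .
qed

lemma cls_eq_iff:
  assumes S: "S \<subseteq> V" and l: "l \<in> G S 0"
  shows "cls t S l = cls t S l' \<longleftrightarrow> l - l' \<in> JJ t S"
proof
  assume eq: "cls t S l = cls t S l'"
  obtain p a where pa: "l = emb p * xpow S (- int a)" using fraction_exists[OF S l] by blast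
  have "(cst t p, a) \<in> cls t S l" by (rule cls_mem) (simp add: pa JJ_zero)
  then obtain q where q: "cst t p = cst t q" "emb q * xpow S (- int a) - l' \<in> JJ t S"
    unfolding eq by (rule cls_cases)
  have "emb (p - q) \<in> JJ t {}" using q(1) by (simp add: cst_eq_iff rees_JJ)
  then have "xpow S (- int a) * emb (p - q) \<in> JJ t S"
    using S finite_subV by (intro JJ_mult G_xpow) (auto intro: JJ_mono)
  then have "l - emb q * xpow S (- int a) \<in> JJ t S"
    by (simp add: pa emb_diff algebra_simps)
  then show "l - l' \<in> JJ t S" using q(2) by (rule JJ_trans)
qed (rule cls_cong)

lemma loc_carrier:
  assumes S: "S \<subseteq> V"
  shows "carrier (loc t S :: ('a::field_char_0 poly6, _) module) = cls t S ` G S 0"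
proof -
  have "carrier (loc t S :: ('a poly6, _) module) =
      {loc_frac poly_ring (thickening t) (prodx S) (cst t p) a | p a. True}"
    by (auto simp: localization_def quotient_def loc_frac_def thickening_carrier)
  also have "\<dots> = cls t S ` G S 0"
  proof (rule equalityI; rule subsetI)
    fix x :: "('a poly6 set \<times> nat) set"
    assume "x \<in> {loc_frac poly_ring (thickening t) (prodx S) (cst t p) a | p a. True}"
    then obtain p a where "x = cls t S (emb p * xpow S (- int a))" by (auto simp: loc_frac_eq[OF S])
    then show "x \<in> cls t S ` G S 0" using fraction_in_G[OF S] by blast
  next
    fix x :: "('a poly6 set \<times> nat) set"
    assume "x \<in> cls t S ` G S 0"
    then obtain l where l: "l \<in> G S 0" "x = cls t S l" by blast
    obtain p a where "l = emb p * xpow S (- int a)" using fraction_exists[OF S l(1)] by blast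
    then have "x = loc_frac poly_ring (thickening t) (prodx S) (cst t p) a"
      using l(2) by (simp add: loc_frac_eq[OF S])
    then show "x \<in> {loc_frac poly_ring (thickening t) (prodx S) (cst t p) a | p a. True}" by blast
  qed
  finally show ?thesis .
qed

lemma loc_zero: "S \<subseteq> V \<Longrightarrow> \<zero>\<^bsub>loc t S\<^esub> = cls t S 0"
  by (simp add: localization_def thickening_zero loc_frac_eq)

lemma cls_witness:
  assumes "S \<subseteq> V" "l \<in> G S 0"
  obtains p a where "(cst t p, a) \<in> cls t S l"
proof -
  obtain p a where "l = emb p * xpow S (- int a)" using fraction_exists[OF assms] by blast
  then have "(cst t p, a) \<in> cls t S l" by (intro cls_mem) (simp add: JJ_zero)
  then show ?thesis by (rule that)
qed

lemma loc_add:
  assumes S: "S \<subseteq> V" and l: "l \<in> G S 0" "l' \<in> G S 0"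
  shows "cls t S l \<oplus>\<^bsub>loc t S\<^esub> cls t S l' = cls t S (l + l')"
proof -
  let ?F = "\<lambda>m a n b. loc_frac poly_ring (thickening t) (prodx S)
    ((prodx S ^ b \<odot>\<^bsub>thickening t\<^esub> m) \<oplus>\<^bsub>thickening t\<^esub> (prodx S ^ a \<odot>\<^bsub>thickening t\<^esub> n)) (a + b)"
  have eq: "?F m a n b = cls t S (l + l')" if m: "(m, a) \<in> cls t S l" and n: "(n, b) \<in> cls t S l'" for m a n b
  proof -
    obtain p where p: "m = cst t p" "emb p * xpow S (- int a) - l \<in> JJ t S" using m by (rule cls_cases)
    obtain q where q: "n = cst t q" "emb q * xpow S (- int b) - l' \<in> JJ t S" using n by (rule cls_cases)
    have x: "xpow S (int b) * xpow S (- int (a + b)) = xpow S (- int a)"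
        "xpow S (int a) * xpow S (- int (a + b)) = xpow S (- int b)"
      by (simp_all flip: xpow_add)
    have "emb (prodx S ^ b * p + prodx S ^ a * q) * xpow S (- int (a + b)) =
        emb p * (xpow S (int b) * xpow S (- int (a + b))) +
        emb q * (xpow S (int a) * xpow S (- int (a + b)))"
      unfolding emb_add emb_mult emb_prodx_power[OF S] by (simp only: distrib_right distrib_left mult_ac)
    then have e: "emb (prodx S ^ b * p + prodx S ^ a * q) * xpow S (- int (a + b)) =
        emb p * xpow S (- int a) + emb q * xpow S (- int b)" unfolding x .
    have "?F m a n b = cls t S (emb p * xpow S (- int a) + emb q * xpow S (- int b))"
      by (simp add: p(1) q(1) thickening_smult thickening_add loc_frac_eq[OF S] e[simplified])
    also have "\<dots> = cls t S (l + l')"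
      using JJ_add[OF p(2) q(2)] by (intro cls_cong) (simp add: algebra_simps)
    finally show ?thesis .
  qed
  obtain m a where ma: "(m, a) \<in> cls t S l" using cls_witness[OF S l(1)] by blast
  obtain n b where nb: "(n, b) \<in> cls t S l'" using cls_witness[OF S l(2)] by blast
  have "cls t S l \<oplus>\<^bsub>loc t S\<^esub> cls t S l' =
      (\<Union>x\<in>cls t S l. \<Union>y\<in>cls t S l'. ?F (fst x) (snd x) (fst y) (snd y))"
    by (simp add: localization_def case_prod_beta)
  also have "\<dots> = cls t S (l + l')"
    by (intro UN_const[OF ma] UN_const[OF nb]) (simp add: eq)
  finally show ?thesis .
qed

lemma loc_smult:
  assumes S: "S \<subseteq> V" and l: "l \<in> G S 0"
  shows "r \<odot>\<^bsub>loc t S\<^esub> cls t S l = cls t S (emb r * l)"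
proof -
  have eq: "loc_frac poly_ring (thickening t) (prodx S) (r \<odot>\<^bsub>thickening t\<^esub> m) a = cls t S (emb r * l)"
    if m: "(m, a) \<in> cls t S l" for m a
  proof -
    obtain p where p: "m = cst t p" "emb p * xpow S (- int a) - l \<in> JJ t S" using m by (rule cls_cases)
    have "emb r * (emb p * xpow S (- int a) - l) \<in> JJ t S" by (rule JJ_mult[OF emb_in_G p(2) S])
    then show ?thesis
      by (simp add: p(1) thickening_smult loc_frac_eq[OF S] emb_mult right_diff_distrib mult.assoc cls_cong)
  qed
  obtain m a where ma: "(m, a) \<in> cls t S l" using cls_witness[OF S l] by blast
  have "r \<odot>\<^bsub>loc t S\<^esub> cls t S l = (\<Union>x\<in>cls t S l.
      loc_frac poly_ring (thickening t) (prodx S) (r \<odot>\<^bsub>thickening t\<^esub> fst x) (snd x))"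
    by (simp add: localization_def case_prod_beta)
  also have "\<dots> = cls t S (emb r * l)" by (intro UN_const[OF ma]) (simp add: eq)
  finally show ?thesis .
qed

text \<open>Numerator and denominator gain the same power of the new indeterminate, so the Laurent
  polynomial is unchanged.\<close>

lemma loc_map_cls:
  assumes S: "insert j S \<subseteq> V" "j \<notin> S" and l: "l \<in> G S 0"
  shows "loc_map poly_ring (thickening t) (prodx S) (gens ! j) (cls t S l) = cls t (insert j S) l"
proof -
  have SV: "S \<subseteq> V" and j: "j < 6" and fin: "finite S" using S finite_subV by auto
  have f: "prodx S * gens ! j = (prodx (insert j S) :: 'a poly6)"
    using fin S(2) by (simp add: cech_elt_insert mult.commute)
  have eq: "loc_frac poly_ring (thickening t) (prodx (insert j S)) ((gens ! j) ^ a \<odot>\<^bsub>thickening t\<^esub> m) a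
      = cls t (insert j S) l" if m: "(m, a) \<in> cls t S l" for m a
  proof -
    obtain p where p: "m = cst t p" "emb p * xpow S (- int a) - l \<in> JJ t S" using m by (rule cls_cases)
    have x: "xvar j ^ a * xpow {j} (- int a) = 1"
      by (simp add: xpow_1[symmetric] xpow_power)
    have "emb ((gens ! j) ^ a * p) * xpow (insert j S) (- int a) =
        (xvar j ^ a * xpow {j} (- int a)) * (emb p * xpow S (- int a))"
      unfolding xpow_insert[OF fin S(2)] emb_mult emb_power emb_gens[OF j] by (simp only: mult_ac)
    then have e: "emb ((gens ! j) ^ a * p) * xpow (insert j S) (- int a) = emb p * xpow S (- int a)"
      unfolding x by simp
    show ?thesis
      using JJ_mono[OF p(2), of "insert j S"]
      by (simp add: p(1) thickening_smult loc_frac_eq[OF S(1)] e cls_cong subset_insertI)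
  qed
  obtain m a where ma: "(m, a) \<in> cls t S l" using cls_witness[OF SV l] by blast
  have "loc_map poly_ring (thickening t) (prodx S) (gens ! j) (cls t S l) = (\<Union>x\<in>cls t S l.
      loc_frac poly_ring (thickening t) (prodx (insert j S)) ((gens ! j) ^ snd x \<odot>\<^bsub>thickening t\<^esub> fst x) (snd x))"
    by (simp add: loc_map_def case_prod_beta f)
  also have "\<dots> = cls t (insert j S) l" by (intro UN_const[OF ma]) (simp add: eq)
  finally show ?thesis .
qed

lemma loc_abelian_group:
  assumes S: "S \<subseteq> V"
  shows "abelian_group (loc t S)"
proof (rule abelian_groupI)
  fix x assume "x \<in> carrier (loc t S)"
  then obtain l where l: "x = cls t S l" "l \<in> G S 0" by (auto simp: loc_carrier[OF S])
  have "cls t S (- l) \<oplus>\<^bsub>loc t S\<^esub> x = \<zero>\<^bsub>loc t S\<^esub>"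
    unfolding l(1) loc_add[OF S G_uminus[OF l(2)] l(2)] loc_zero[OF S] by simp
  then show "\<exists>y\<in>carrier (loc t S). y \<oplus>\<^bsub>loc t S\<^esub> x = \<zero>\<^bsub>loc t S\<^esub>"
    unfolding loc_carrier[OF S] using G_uminus[OF l(2)] by blast
qed (auto simp: loc_carrier[OF S] loc_add[OF S] loc_zero[OF S] G_add G_zero algebra_simps)

lemma loc_uminus:
  assumes S: "S \<subseteq> V" and l: "l \<in> G S 0"
  shows "\<ominus>\<^bsub>loc t S\<^esub> cls t S l = cls t S (- l)"
proof -
  interpret abelian_group "loc t S" by (rule loc_abelian_group[OF S])
  show ?thesis
    by (rule minus_equality)
      (use l G_uminus[OF l] in \<open>auto simp: loc_carrier[OF S] loc_add[OF S] loc_zero[OF S]\<close>)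
qed

lemma loc_finsum:
  assumes S: "S \<subseteq> V" and "finite A" "\<And>j. j \<in> A \<Longrightarrow> h j \<in> G S 0 \<and> F j = cls t S (h j)"
  shows "finsum (loc t S) F A = cls t S (\<Sum>j\<in>A. h j)"
  using assms(2,3)
proof (induction A rule: finite_induct)
  case empty
  interpret abelian_group "loc t S" by (rule loc_abelian_group[OF S])
  show ?case by (simp add: loc_zero[OF S])
next
  case (insert j A)
  interpret abelian_group "loc t S" by (rule loc_abelian_group[OF S])
  have "finsum (loc t S) F (insert j A) = F j \<oplus>\<^bsub>loc t S\<^esub> finsum (loc t S) F A"
    using insert by (intro finsum_insert) (auto simp: loc_carrier[OF S])
  then show ?case
    using insert by (simp add: loc_add[OF S] G_sum)
qed

section \<open>The Cech complex of \<open>R / I\<^sup>t\<close>\<close>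

abbreviation idx :: "nat \<Rightarrow> nat set set" where "idx k \<equiv> {S. S \<subseteq> V \<and> card S = k}"

lemma cech_index_eq: "cech_index gens k = idx k"
  by (simp add: cech_index_def max_ideal_gens_def eval_nat_numeral)

definition cochain :: "nat \<Rightarrow> nat \<Rightarrow> (nat set \<Rightarrow> 'a::field_char_0 laur) \<Rightarrow> (nat set \<Rightarrow> ('a poly6 set \<times> nat) set)" where
  "cochain t k c = (\<lambda>S\<in>idx k. cls t S (c S))"

abbreviation cech :: "nat \<Rightarrow> nat \<Rightarrow> ('a::field_char_0 poly6, nat set \<Rightarrow> ('a poly6 set \<times> nat) set) module" where
  "cech t k \<equiv> cech_module poly_ring gens (thickening t) k"

lemma cochain_cong: "(\<And>S. S \<subseteq> V \<Longrightarrow> card S = k \<Longrightarrow> c S - d S \<in> JJ t S) \<Longrightarrow> cochain t k c = cochain t k d"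
  unfolding cochain_def by (rule restrict_ext, rule cls_cong) simp

lemma cochain_eq_iff:
  assumes "co k 0 c"
  shows "cochain t k c = cochain t k d \<longleftrightarrow> (\<forall>S. S \<subseteq> V \<longrightarrow> card S = k \<longrightarrow> c S - d S \<in> JJ t S)"
proof
  assume eq: "cochain t k c = cochain t k d"
  show "\<forall>S. S \<subseteq> V \<longrightarrow> card S = k \<longrightarrow> c S - d S \<in> JJ t S"
  proof (intro allI impI)
    fix S assume S: "S \<subseteq> V" "card S = k"
    then have "cls t S (c S) = cls t S (d S)" using fun_cong[OF eq, of S] by (simp add: cochain_def)
    then show "c S - d S \<in> JJ t S" using cls_eq_iff[OF S(1) coD[OF assms S]] by simp
  qed
qed (auto intro: cochain_cong)

lemma cech_carrier: "carrier (cech t k :: ('a::field_char_0 poly6, _) module) = cochain t k ` {c. co k 0 c}"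
proof
  show "cochain t k ` {c. co k 0 c} \<subseteq> carrier (cech t k :: ('a poly6, _) module)"
  proof (rule image_subsetI)
    fix c :: "nat set \<Rightarrow> 'a laur"
    assume "c \<in> {c. co k 0 c}"
    then show "cochain t k c \<in> carrier (cech t k)"
      by (simp add: cech_module_def cech_index_eq cochain_def restrict_PiE_iff loc_carrier coD)
  qed
  show "carrier (cech t k :: ('a poly6, _) module) \<subseteq> cochain t k ` {c. co k 0 c}"
  proof
    fix x assume x: "x \<in> carrier (cech t k :: ('a poly6, _) module)"
    have "\<forall>S\<in>idx k. \<exists>l. l \<in> G S 0 \<and> x S = cls t S l"
    proof
      fix S assume S: "S \<in> idx k"
      have "x \<in> (\<Pi>\<^sub>E S\<in>idx k. carrier (loc t S))" using x by (simp add: cech_module_def cech_index_eq)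
      then have "x S \<in> carrier (loc t S)" using S by (rule PiE_mem)
      then have "x S \<in> cls t S ` G S 0" using S by (simp add: loc_carrier)
      then show "\<exists>l. l \<in> G S 0 \<and> x S = cls t S l" by blast
    qed
    from bchoice[OF this] obtain c where c: "\<And>S. S \<in> idx k \<Longrightarrow> c S \<in> G S 0 \<and> x S = cls t S (c S)"
      by blast
    have "x = cochain t k c"
    proof
      fix S show "x S = cochain t k c S"
        using x c by (cases "S \<in> idx k")
          (auto simp: cochain_def cech_module_def cech_index_eq PiE_def extensional_def)
    qed
    moreover have "co k 0 c" using c by (simp add: co_def)
    ultimately show "x \<in> cochain t k ` {c. co k 0 c}" by blast
  qed
qed

lemma cech_zero: "\<zero>\<^bsub>cech t k\<^esub> = cochain t k (\<lambda>_. 0)"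
  unfolding cochain_def cech_module_def cech_index_eq by (auto simp: loc_zero intro!: restrict_ext)

lemma cech_add: "co k 0 c \<Longrightarrow> co k 0 d \<Longrightarrow> cochain t k c \<oplus>\<^bsub>cech t k\<^esub> cochain t k d = cochain t k (\<lambda>S. c S + d S)"
  unfolding cech_module_def cech_index_eq
  by (auto simp: cochain_def loc_add coD intro!: restrict_ext)

lemma cech_smult: "co k 0 c \<Longrightarrow> r \<odot>\<^bsub>cech t k\<^esub> cochain t k c = cochain t k (\<lambda>S. emb r * c S)"
  unfolding cech_module_def cech_index_eq
  by (auto simp: cochain_def loc_smult coD intro!: restrict_ext)

lemma cech_diff_cochain:
  assumes c: "co k 0 c"
  shows "cech_diff poly_ring gens (thickening t) k (cochain t k c) = cochain t (Suc k) (delta c)"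
  unfolding cech_diff_def cech_index_eq cochain_def[of t "Suc k"]
proof (rule restrict_ext)
  fix T assume "T \<in> idx (Suc k)"
  then have T: "T \<subseteq> V" "card T = Suc k" by auto
  show "(\<Oplus>\<^bsub>loc t T\<^esub>j\<in>T.
      let y = loc_map poly_ring (thickening t) (prodx (T - {j})) (gens ! j) (cochain t k c (T - {j}))
      in if even (card {i \<in> T. i < j}) then y else \<ominus>\<^bsub>loc t T\<^esub> y) = cls t T (delta c T)"
    unfolding delta_def
  proof (rule loc_finsum[OF T(1)])
    show "finite T" using T(1) by (rule finite_subV)
    fix j assume j: "j \<in> T"
    have Tj: "T - {j} \<subseteq> V" "card (T - {j}) = k" using T j by (auto simp: card_remove_subV)
    have cT: "c (T - {j}) \<in> G (T - {j}) 0" by (rule coD[OF c Tj])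
    then have cT': "c (T - {j}) \<in> G T 0" by (rule G_mono) auto
    have ins: "insert j (T - {j}) = T" using j by auto
    have "loc_map poly_ring (thickening t) (prodx (T - {j})) (gens ! j) (cls t (T - {j}) (c (T - {j}))) =
        cls t (insert j (T - {j})) (c (T - {j}))"
      using T ins by (intro loc_map_cls cT) auto
    then have m: "loc_map poly_ring (thickening t) (prodx (T - {j})) (gens ! j) (cochain t k c (T - {j})) =
        cls t T (c (T - {j}))"
      unfolding ins using Tj by (simp add: cochain_def)
    show "esg T j * c (T - {j}) \<in> G T 0 \<and>
      (let y = loc_map poly_ring (thickening t) (prodx (T - {j})) (gens ! j) (cochain t k c (T - {j}))
       in if even (card {i \<in> T. i < j}) then y else \<ominus>\<^bsub>loc t T\<^esub> y) = cls t T (esg T j * c (T - {j}))"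
      unfolding m Let_def using cT' by (auto simp: esg_def loc_uminus[OF T(1)] G_uminus)
  qed
qed

lemma cocycles_eq:
  "cech_cocycles poly_ring gens (thickening t) k =
    cochain t k ` {c. co k 0 c \<and> (\<forall>T. T \<subseteq> V \<longrightarrow> card T = Suc k \<longrightarrow> delta c T \<in> JJ t T)}"
proof -
  have "cech_diff poly_ring gens (thickening t) k (cochain t k c) = \<zero>\<^bsub>cech t (Suc k)\<^esub> \<longleftrightarrow>
      (\<forall>T. T \<subseteq> V \<longrightarrow> card T = Suc k \<longrightarrow> delta c T \<in> JJ t T)" if c: "co k 0 c" for c
    unfolding cech_diff_cochain[OF c] cech_zero cochain_eq_iff[OF co_delta[OF c]] by simp
  then show ?thesis unfolding cech_cocycles_def cech_carrier by auto
qed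

lemma coboundaries_eq:
  "cech_coboundaries poly_ring gens (thickening t) (Suc k) = (\<lambda>b. cochain t (Suc k) (delta b)) ` {b. co k 0 b}"
  by (auto simp: cech_coboundaries_def cech_carrier cech_diff_cochain image_image)

lemma loc_grading_eq:
  assumes S: "S \<subseteq> V"
  shows "loc_grading poly_ring poly_grading (thickening t) (thickening_grading t) (prodx S) 0 =
    cls t S ` {l \<in> G S 0. \<forall>\<mu>\<in>ks l. wdeg \<mu> = 0}"
proof -
  have fin: "finite S" using S by (rule finite_subV)
  define e where "e = wdeg (\<Sum>i\<in>S. sg i 1)"
  have e_mult: "wdeg (\<Sum>i\<in>S. sg i n) = n * e" for n
  proof -
    have "(\<Sum>j<6. lk (\<Sum>i\<in>S. sg i m) j) = (\<Sum>j<6. if j \<in> S then m else 0)" for m :: int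
      using fin by (simp add: lookup_sum_single)
    then have w: "wdeg (\<Sum>i\<in>S. sg i m) = (\<Sum>j<6. if j \<in> S then m else 0)" for m :: int
      using S fin by (auto simp: wdeg_def tdeg_def lookup_sum_single)
    show ?thesis unfolding e_def w sum_distrib_left by (rule sum.cong) auto
  qed
  have keys: "ks (emb p * xpow S n) = (+) (\<Sum>i\<in>S. sg i n) ` ks (emb p)" for p :: "'a poly6" and n
    unfolding xpow_def by (subst mult.commute) (rule keys_single_times)
  \<comment> \<open>The power of the product is a nonzero monomial, so the degree that
    \<open>loc_grading\<close> asks of the denominator is unique.\<close>
  have pw: "prodx S ^ a \<in> poly_grading d \<longleftrightarrow> d = int a * e" for a d
    unfolding poly_grading_iff emb_prodx_power[OF S] by (auto simp: xpow_def e_mult)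
  have deg_frac: "(\<forall>\<mu>\<in>ks (emb p * xpow S (- int a)). wdeg \<mu> = 0) \<longleftrightarrow> p \<in> poly_grading (int a * e)"
    for p :: "'a poly6" and a
    unfolding keys poly_grading_iff by (auto simp: wdeg_add e_mult)
  show ?thesis
  proof (rule equalityI; rule subsetI)
    fix x assume "x \<in> loc_grading poly_ring poly_grading (thickening t) (thickening_grading t) (prodx S :: 'a poly6) 0"
    then obtain p a where p: "x = loc_frac poly_ring (thickening t) (prodx S) (cst t p) a"
      "p \<in> poly_grading (int a * e)"
      by (auto simp: loc_grading_def thickening_grading_def pw cst_def)
    then show "x \<in> cls t S ` {l \<in> G S 0. \<forall>\<mu>\<in>ks l. wdeg \<mu> = 0}"
      unfolding loc_frac_eq[OF S] using deg_frac fraction_in_G[OF S] by blast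
  next
    fix x :: "('a poly6 set \<times> nat) set"
    assume "x \<in> cls t S ` {l \<in> G S 0. \<forall>\<mu>\<in>ks l. wdeg \<mu> = 0}"
    then obtain l where l: "l \<in> G S 0" "\<forall>\<mu>\<in>ks l. wdeg \<mu> = 0" "x = cls t S l" by auto
    obtain p a where pa: "l = emb p * xpow S (- int a)" using fraction_exists[OF S l(1)] by blast
    then have "x = loc_frac poly_ring (thickening t) (prodx S) (cst t p) a" "p \<in> poly_grading (int a * e)"
      using l deg_frac by (auto simp: loc_frac_eq[OF S])
    then show "x \<in> loc_grading poly_ring poly_grading (thickening t) (thickening_grading t) (prodx S) 0"
      unfolding loc_grading_def thickening_grading_def cst_def[symmetric] using pw[of a "int a * e"] by auto
  qed
qed

lemma cech_grading_eq:
  "cech_grading poly_ring poly_grading gens (thickening t) (thickening_grading t) k 0 =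
    (cochain t k :: (nat set \<Rightarrow> 'a::field_char_0 laur) \<Rightarrow> _) ` {c. co k 0 c \<and> (\<forall>S. \<forall>\<mu>\<in>ks (c S). wdeg \<mu> = 0)}"
    (is "?L = ?R")
proof
  show "?R \<subseteq> ?L"
  proof (rule image_subsetI)
    fix c :: "nat set \<Rightarrow> 'a laur"
    assume "c \<in> {c. co k 0 c \<and> (\<forall>S. \<forall>\<mu>\<in>ks (c S). wdeg \<mu> = 0)}"
    then show "cochain t k c \<in>
      cech_grading poly_ring poly_grading gens (thickening t) (thickening_grading t) k 0"
      by (simp add: cech_grading_def cech_index_eq cochain_def restrict_PiE_iff)
        (auto simp: loc_grading_eq coD)
  qed
  show "?L \<subseteq> ?R"
  proof
    fix x assume x: "x \<in> ?L"
    have "\<forall>S\<in>idx k. \<exists>l. l \<in> G S 0 \<and> (\<forall>\<mu>\<in>ks l. wdeg \<mu> = 0) \<and> x S = cls t S l"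
    proof
      fix S assume S: "S \<in> idx k"
      have "x \<in> (\<Pi>\<^sub>E S\<in>idx k.
          loc_grading poly_ring poly_grading (thickening t) (thickening_grading t) (prodx S) 0)"
        using x by (simp add: cech_grading_def cech_index_eq)
      then have "x S \<in> loc_grading poly_ring poly_grading (thickening t) (thickening_grading t) (prodx S) 0"
        using S by (rule PiE_mem)
      then show "\<exists>l. l \<in> G S 0 \<and> (\<forall>\<mu>\<in>ks l. wdeg \<mu> = 0) \<and> x S = cls t S l"
        using S by (auto simp: loc_grading_eq)
    qed
    from bchoice[OF this] obtain c where
      c: "\<And>S. S \<in> idx k \<Longrightarrow> c S \<in> G S 0 \<and> (\<forall>\<mu>\<in>ks (c S). wdeg \<mu> = 0) \<and> x S = cls t S (c S)"
      by blast
    \<comment> \<open>Homogeneity is demanded at every set, also at those outside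
      \<open>idx k\<close>, hence the value 0 there.\<close>
    define d where "d S = (if S \<in> idx k then c S else 0)" for S
    have "x = cochain t k d"
    proof
      fix S show "x S = cochain t k d S"
        using x c by (cases "S \<in> idx k")
          (auto simp: cochain_def d_def cech_grading_def cech_index_eq PiE_def extensional_def)
    qed
    moreover have "co k 0 d" "\<forall>S. \<forall>\<mu>\<in>ks (d S). wdeg \<mu> = 0" using c by (auto simp: co_def d_def)
    ultimately show "x \<in> ?R" by blast
  qed
qed

section \<open>The degree-zero part of \<open>H\<^sup>3\<close>\<close>

definition bnd :: "nat \<Rightarrow> (nat set \<Rightarrow> 'a::field_char_0 laur) \<Rightarrow> bool" where
  "bnd t c \<longleftrightarrow> (\<exists>b. co 2 0 b \<and> (\<forall>S. S \<subseteq> V \<longrightarrow> card S = 3 \<longrightarrow> c S - delta b S \<in> JJ t S))"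

definition hclass :: "nat \<Rightarrow> (nat set \<Rightarrow> 'a::field_char_0 laur) \<Rightarrow> (nat set \<Rightarrow> ('a poly6 set \<times> nat) set) set" where
  "hclass t c = (\<lambda>b. cochain t 3 (\<lambda>S. delta b S + c S)) ` {b. co 2 0 b}"

lemma co_add: "co k d c \<Longrightarrow> co k d c' \<Longrightarrow> co k d (\<lambda>S. c S + c' S)"
  by (auto simp: co_def intro: G_add)

lemma co_diff: "co k d c \<Longrightarrow> co k d c' \<Longrightarrow> co k d (\<lambda>S. c S - c' S)"
  by (auto simp: co_def intro: G_diff)

lemma co_mult: "r \<in> G {} 0 \<Longrightarrow> co k d c \<Longrightarrow> co k d (\<lambda>S. r * c S)"
  by (auto simp: co_def intro: G_mult0 G_mono)

lemma co_zero: "co k d (\<lambda>_. 0)"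
  by (simp add: co_def G_zero)

lemma delta_zero: "delta (\<lambda>_. 0) S = 0"
  by (simp add: delta_def)

lemma co3_delta: "co 2 0 b \<Longrightarrow> co 3 0 (delta b)"
  using co_delta[of 2 0 b] by (simp add: eval_nat_numeral)

lemma hclass_eqI:
  assumes "bnd t (\<lambda>S. c S - c' S)"
  shows "hclass t c = hclass t c'"
proof -
  have sub: "hclass t c \<subseteq> hclass t c'" if cc: "bnd t (\<lambda>S. c S - c' S)" for c c' :: "nat set \<Rightarrow> 'a laur"
  proof
    fix x assume "x \<in> hclass t c"
    then obtain b where b: "co 2 0 b" "x = cochain t 3 (\<lambda>S. delta b S + c S)" by (auto simp: hclass_def)
    obtain d where d: "co 2 0 d" "\<And>S. S \<subseteq> V \<Longrightarrow> card S = 3 \<Longrightarrow> c S - c' S - delta d S \<in> JJ t S"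
      using cc unfolding bnd_def by blast
    have "x = cochain t 3 (\<lambda>S. delta (\<lambda>S. b S + d S) S + c' S)"
      unfolding b(2) using d(2) by (intro cochain_cong) (simp add: delta_add algebra_simps)
    then show "x \<in> hclass t c'" unfolding hclass_def using co_add[OF b(1) d(1)] by blast
  qed
  have "bnd t (\<lambda>S. c' S - c S)"
  proof -
    obtain d where d: "co 2 0 d" "\<And>S. S \<subseteq> V \<Longrightarrow> card S = 3 \<Longrightarrow> c S - c' S - delta d S \<in> JJ t S"
      using assms unfolding bnd_def by blast
    have "c' S - c S - delta (\<lambda>S. 0 - d S) S \<in> JJ t S" if "S \<subseteq> V" "card S = 3" for S
    proof -
      have "c' S - c S - delta (\<lambda>S. 0 - d S) S = - (c S - c' S - delta d S)"
        unfolding delta_diff[of "\<lambda>_. 0" d] delta_zero by simp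
      then show ?thesis using JJ_uminus[OF d(2)[OF that]] by (simp only:)
    qed
    then show ?thesis unfolding bnd_def using co_diff[OF co_zero d(1)] by blast
  qed
  then show ?thesis using sub[OF assms] sub by blast
qed

lemma hclass_eqD:
  assumes c: "co 3 0 c" and eq: "hclass t c = hclass t c'"
  shows "bnd t (\<lambda>S. c S - c' S)"
proof -
  have "cochain t 3 (\<lambda>S. delta (\<lambda>_. 0) S + c S) \<in> hclass t c"
    unfolding hclass_def using co_zero by blast
  then obtain b where b: "co 2 0 b"
    "cochain t 3 (\<lambda>S. delta (\<lambda>_. 0) S + c S) = cochain t 3 (\<lambda>S. delta b S + c' S)"
    unfolding eq by (auto simp: hclass_def)
  then have "cochain t 3 c = cochain t 3 (\<lambda>S. delta b S + c' S)" by (simp add: delta_zero)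
  then show ?thesis
    unfolding cochain_eq_iff[OF c] bnd_def using b(1) by (auto simp: algebra_simps)
qed

lemma coset_cech:
  assumes "co 3 0 c"
  shows "cech_coboundaries poly_ring gens (thickening t) 3 +>\<^bsub>cech t 3\<^esub> cochain t 3 c = hclass t c"
proof -
  have "cech_coboundaries poly_ring gens (thickening t) 3 = (\<lambda>b. cochain t 3 (delta b)) ` {b. co 2 0 b}"
    using coboundaries_eq[of t 2] by (simp add: eval_nat_numeral)
  then have "cech_coboundaries poly_ring gens (thickening t) 3 +>\<^bsub>cech t 3\<^esub> cochain t 3 c =
      (\<lambda>b. cochain t 3 (delta b) \<oplus>\<^bsub>cech t 3\<^esub> cochain t 3 c) ` {b. co 2 0 b}"
    by (auto simp: a_r_coset_def r_coset_def)
  also have "\<dots> = hclass t c"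
    unfolding hclass_def by (rule image_cong) (auto simp: cech_add co3_delta assms)
  finally show ?thesis .
qed

lemma coboundaries_hclass: "cech_coboundaries poly_ring gens (thickening t) 3 = hclass t (\<lambda>_. 0)"
  using coboundaries_eq[of t 2] by (simp add: hclass_def eval_nat_numeral)

abbreviation coh :: "nat \<Rightarrow> ('a::field_char_0, (nat set \<Rightarrow> ('a poly6 set \<times> nat) set) set) module" where
  "coh t \<equiv> thickening_local_cohomology t 3 0"

lemma coh_zero: "\<zero>\<^bsub>coh t\<^esub> = hclass t (\<lambda>_. 0)"
  by (simp add: thickening_local_cohomology_def restrict_scalars_def local_cohomology_def
      quotient_module_def coboundaries_hclass)

lemma coh_carrier:
  "carrier (coh t :: ('a::field_char_0, _) module) = hclass t ` {c. co 3 0 c \<and> (\<forall>T. T \<subseteq> V \<longrightarrow> card T = 4 \<longrightarrow> delta c T \<in> JJ t T) \<and>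
     (\<forall>S. \<forall>\<mu>\<in>ks (c S). wdeg \<mu> = 0)}"
  (is "_ = hclass t ` ?C")
proof -
  have S3: "Suc 3 = (4 :: nat)" by simp
  have int: "cech_cocycles poly_ring gens (thickening t) 3 \<inter>
      cech_grading poly_ring poly_grading gens (thickening t) (thickening_grading t) 3 0 = cochain t 3 ` ?C"
  proof (rule equalityI; rule subsetI)
    fix x :: "nat set \<Rightarrow> ('a poly6 set \<times> nat) set" assume "x \<in> cech_cocycles poly_ring gens (thickening t) 3 \<inter>
      cech_grading poly_ring poly_grading gens (thickening t) (thickening_grading t) 3 0"
    \<comment> \<open>One representative is a cocycle modulo I^t, the other is homogeneous. They
      agree modulo \<open>JJ\<close>, so the homogeneous one is a cocycle modulo I^t too.\<close>
    then obtain c d where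
      c: "x = cochain t 3 c" "co 3 0 c" "\<And>T. T \<subseteq> V \<Longrightarrow> card T = 4 \<Longrightarrow> delta c T \<in> JJ t T" and
      d: "x = cochain t 3 d" "co 3 0 d" "\<forall>S. \<forall>\<mu>\<in>ks (d S). wdeg \<mu> = 0"
      unfolding cocycles_eq cech_grading_eq S3 by blast
    have dc: "d S - c S \<in> JJ t S" if "S \<subseteq> V" "card S = 3" for S
      using c(1) d(1) cochain_eq_iff[OF d(2), of t c] that by auto
    have "delta d T \<in> JJ t T" if T: "T \<subseteq> V" "card T = 4" for T
    proof -
      have "delta (\<lambda>S. d S - c S) T \<in> JJ t T"
        unfolding delta_def
      proof (rule JJ_sum)
        fix j assume j: "j \<in> T"
        have "d (T - {j}) - c (T - {j}) \<in> JJ t (T - {j})"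
          using T j card_remove_subV[of T j 3] by (intro dc) auto
        then have "d (T - {j}) - c (T - {j}) \<in> JJ t T" by (rule JJ_mono) auto
        then show "esg T j * (d (T - {j}) - c (T - {j})) \<in> JJ t T" by (rule JJ_esg)
      qed
      then have "delta d T - delta c T \<in> JJ t T" by (simp add: delta_diff)
      then show ?thesis using JJ_add[OF _ c(3)[OF T]] by fastforce
    qed
    then show "x \<in> cochain t 3 ` ?C" using d by blast
  next
    fix x :: "nat set \<Rightarrow> ('a poly6 set \<times> nat) set" assume "x \<in> cochain t 3 ` ?C"
    then show "x \<in> cech_cocycles poly_ring gens (thickening t) 3 \<inter>
      cech_grading poly_ring poly_grading gens (thickening t) (thickening_grading t) 3 0"
      unfolding cocycles_eq cech_grading_eq S3 by blast
  qed
  have "carrier (coh t :: ('a, _) module) = (\<lambda>x. cech_coboundaries poly_ring gens (thickening t) 3 +>\<^bsub>cech t 3\<^esub> x) `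
      (cochain t 3 ` ?C)"
    unfolding int[symmetric]
    by (auto simp: thickening_local_cohomology_def restrict_scalars_def local_cohomology_grading_def)
  also have "\<dots> = hclass t ` ?C"
    unfolding image_image by (rule image_cong) (auto simp: coset_cech)
  finally show ?thesis .
qed

lemma coh_add:
  assumes c: "co 3 0 c" and d: "co 3 0 d"
  shows "hclass t c \<oplus>\<^bsub>coh t\<^esub> hclass t d = hclass t (\<lambda>S. c S + d S)"
proof -
  have sum: "cochain t 3 (\<lambda>S. delta b S + c S) \<oplus>\<^bsub>cech t 3\<^esub> cochain t 3 (\<lambda>S. delta b' S + d S) =
      cochain t 3 (\<lambda>S. delta (\<lambda>S. b S + b' S) S + (c S + d S))" if "co 2 0 b" "co 2 0 b'" for b b'
    using that c d by (subst cech_add) (auto intro: co_add co3_delta simp: delta_add algebra_simps)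
  have "hclass t c \<oplus>\<^bsub>coh t\<^esub> hclass t d =
      {x \<oplus>\<^bsub>cech t 3\<^esub> y | x y. x \<in> hclass t c \<and> y \<in> hclass t d}"
    by (auto simp: thickening_local_cohomology_def restrict_scalars_def local_cohomology_def
        quotient_module_def set_add_def set_mult_def)
  also have "\<dots> = hclass t (\<lambda>S. c S + d S)"
  proof (rule equalityI; rule subsetI)
    fix z assume "z \<in> {x \<oplus>\<^bsub>cech t 3\<^esub> y | x y. x \<in> hclass t c \<and> y \<in> hclass t d}"
    then obtain b b' where "co 2 0 b" "co 2 0 b'" "z = cochain t 3 (\<lambda>S. delta b S + c S) \<oplus>\<^bsub>cech t 3\<^esub>
        cochain t 3 (\<lambda>S. delta b' S + d S)" by (auto simp: hclass_def)
    then show "z \<in> hclass t (\<lambda>S. c S + d S)"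
      using sum co_add unfolding hclass_def by blast
  next
    fix z assume "z \<in> hclass t (\<lambda>S. c S + d S)"
    then obtain b where b: "co 2 0 b" "z = cochain t 3 (\<lambda>S. delta b S + (c S + d S))"
      by (auto simp: hclass_def)
    then have "z = cochain t 3 (\<lambda>S. delta b S + c S) \<oplus>\<^bsub>cech t 3\<^esub>
        cochain t 3 (\<lambda>S. delta (\<lambda>_. 0) S + d S)"
      by (simp add: sum[OF b(1) co_zero])
    then show "z \<in> {x \<oplus>\<^bsub>cech t 3\<^esub> y | x y. x \<in> hclass t c \<and> y \<in> hclass t d}"
      using b(1) co_zero unfolding hclass_def by blast
  qed
  finally show ?thesis .
qed

lemma coh_smult:
  assumes c: "co 3 0 c"
  shows "a \<odot>\<^bsub>coh t\<^esub> hclass t c = hclass t (\<lambda>S. sg 0 a * c S)"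
proof -
  have "a \<odot>\<^bsub>coh t\<^esub> hclass t c = (\<Union>x\<in>hclass t c.
      cech_coboundaries poly_ring gens (thickening t) 3 +>\<^bsub>cech t 3\<^esub> (const_poly a \<odot>\<^bsub>cech t 3\<^esub> x))"
    by (simp add: thickening_local_cohomology_def restrict_scalars_def local_cohomology_def
        quotient_module_def a_r_coset_def r_coset_def)
  also have "\<dots> = hclass t (\<lambda>S. sg 0 a * c S)"
  proof (rule UN_const)
    show "cochain t 3 (\<lambda>S. delta (\<lambda>_. 0) S + c S) \<in> hclass t c"
      unfolding hclass_def using co_zero by blast
    fix x assume "x \<in> hclass t c"
    then obtain b where b: "co 2 0 b" "x = cochain t 3 (\<lambda>S. delta b S + c S)" by (auto simp: hclass_def)
    have x3: "co 3 0 (\<lambda>S. delta b S + c S)" by (intro co_add co3_delta b c)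
    have "cech_coboundaries poly_ring gens (thickening t) 3 +>\<^bsub>cech t 3\<^esub> (const_poly a \<odot>\<^bsub>cech t 3\<^esub> x) =
        hclass t (\<lambda>S. sg 0 a * (delta b S + c S))"
      unfolding b(2) cech_smult[OF x3] emb_const by (intro coset_cech co_mult G_const x3)
    also have "\<dots> = hclass t (\<lambda>S. sg 0 a * c S)"
    proof (rule hclass_eqI)
      have "co 2 0 (\<lambda>S. sg 0 a * b S)" by (intro co_mult G_const b)
      then show "bnd t (\<lambda>S. sg 0 a * (delta b S + c S) - sg 0 a * c S)"
        unfolding bnd_def by (intro exI[of _ "\<lambda>S. sg 0 a * b S"]) (simp add: delta_mult distrib_left JJ_zero)
    qed
    finally show "cech_coboundaries poly_ring gens (thickening t) 3 +>\<^bsub>cech t 3\<^esub> (const_poly a \<odot>\<^bsub>cech t 3\<^esub> x) =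
        hclass t (\<lambda>S. sg 0 a * c S)" .
  qed
  finally show ?thesis .
qed

theorem proposition3p3:
  fixes t :: nat
  assumes "t \<ge> 2"
  shows "let H30 = (thickening_local_cohomology t 3 0 :: ('a::field_char_0, _) module)
         in vectorspace base_field H30 \<and>
            vectorspace.fin_dim base_field H30 \<and>
            vectorspace.dim base_field H30 = 1"
proof -
  define n where "n = t - 2"
  have tn: "int t - 2 = int n" using assms by (simp add: n_def)
  obtain q :: "'a laur" where q: "q \<in> G V (int t - 2)" "\<And>\<nu>. \<nu> \<in> ks q \<Longrightarrow> wdeg \<nu> = - 6"
    "negl (l1 * q)" "negl (l2 * q)" "of_inv q = det3 ^ n"
    using socle_generator[of n] unfolding tn by blast
  obtain c0 where c0: "co 3 0 c0" "zigzag (int t) c0 q"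
    using zigzag_realizes[OF q(1,3,4)] by blast
  \<comment> \<open>\<open>zigzag_realizes\<close> does not control degrees. The part of weight 0
    still leads to \<open>q\<close>, because \<open>q\<close> has weight -6.\<close>
  define w where "w S = homog 0 (c0 S)" for S
  have w: "co 3 0 w" unfolding w_def by (rule co_homog[OF c0(1)])
  have w_deg: "wdeg \<mu> = 0" if "\<mu> \<in> ks (w S)" for \<mu> S using that by (simp add: w_def keys_restr)
  have "homog (- 6) q = q" by (rule restr_all) (rule q(2))
  moreover have "w = (\<lambda>S. homog 0 (c0 S))" by (rule ext) (rule w_def)
  ultimately have wz: "zigzag (int t) w q" using zigzag_homog[OF c0(2)] by simp
  have scaled: "zigzag (int t) (\<lambda>S. sg 0 a * w S) (sg 0 a * q)" for a
  proof -
    have e: "x - sg 0 (1 - a) * x = sg 0 a * x" for x :: "'a laur"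
      by (simp add: single_diff single_one left_diff_distrib)
    show ?thesis using zigzag_diff_scale[OF wz wz, of "1 - a"] unfolding e .
  qed
  define h where "h a = hclass t (\<lambda>S. sg 0 a * w S)" for a
  have co_w: "co 3 0 (\<lambda>S. sg 0 a * w S)" for a by (intro co_mult G_const w)
  have hdiff: "(\<lambda>S. sg 0 a * w S - sg 0 b * w S) = (\<lambda>S. sg 0 (a - b) * w S)" for a b
    by (simp add: single_diff left_diff_distrib)
  have "inj h"
  proof (rule injI)
    fix a b assume "h a = h b"
    then have "bnd t (\<lambda>S. sg 0 a * w S - sg 0 b * w S)" unfolding h_def by (rule hclass_eqD[OF co_w])
    then have "bnd t (\<lambda>S. sg 0 (a - b) * w S)" unfolding hdiff .
    then obtain d where "\<And>S. S \<subseteq> V \<Longrightarrow> card S = 3 \<Longrightarrow> sg 0 (a - b) * w S - delta d S \<in> ev ` G S (int t)"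
      unfolding bnd_def JJ_def by blast
    then have "negl (sg 0 (a - b) * q)" using zigzag_well_defined[OF scaled] by blast
    then have "negl (0 - sg 0 (a - b) * q)" using negl_uminus by simp
    then have "of_inv (0 - sg 0 (a - b) * q) = 0" by (simp only: negl_iff_of_inv)
    moreover have "of_inv (0 :: 'a laur) = 0" using negl_zero by (simp only: negl_iff_of_inv[symmetric])
    ultimately have "sg 0 (a - b) * det3 ^ n = (0 :: 'a laur)" by (simp only: of_inv_diff_scale q(5)) simp
    then have "sg 0 (a - b) = (0 :: 'a laur)" using det3_nz[where 'a = 'a] by simp
    then have "lk (sg 0 (a - b) :: 'a laur) 0 = 0" by simp
    then show "a = b" by simp
  qed
  moreover have "carrier (coh t) = range h"
  proof (rule equalityI; rule subsetI)
    fix x :: "(nat set \<Rightarrow> ('a poly6 set \<times> nat) set) set" assume "x \<in> carrier (coh t)"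
    then obtain c where x: "x = hclass t c" and c: "co 3 0 c"
      "\<And>T. T \<subseteq> V \<Longrightarrow> card T = 4 \<Longrightarrow> delta c T \<in> JJ t T" "\<And>S \<mu>. \<mu> \<in> ks (c S) \<Longrightarrow> wdeg \<mu> = 0"
      unfolding coh_carrier by blast
    obtain r where r: "zigzag (int t) c r"
      using zigzag_exists[OF c(1), of "int t"] c(2) unfolding JJ_def by blast
    \<comment> \<open>As \<open>c\<close> has weight 0, the zigzag from \<open>c\<close> to
      \<open>r\<close> restricts to one ending in the part of weight -6.\<close>
    let ?r = "homog (- 6) r"
    have "homog 0 (c S) = c S" for S by (rule restr_all) (rule c(3))
    then have cz: "zigzag (int t) c ?r" using zigzag_homog[OF r] by simp
    have rG: "?r \<in> G V (int n)" using cz unfolding zigzag_def tn by blast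
    have "matpoly n (of_inv ?r)" by (rule matpoly_of_inv[OF rG]) (simp add: keys_restr)
    moreover have "pol 6 0 (of_inv ?r) = 0" "pol 6 3 (of_inv ?r) = 0"
      using zigzag_negl[OF cz] negl_l1_iff[OF rG] negl_l2_iff[OF rG] by auto
    ultimately obtain a where a: "of_inv ?r = sg 0 a * det3 ^ n" using invariants_spanned by blast
    \<comment> \<open>The scalar found for the invariant polynomials is the coordinate of the class:
      the difference has negligible image in the top cohomology, so \<open>zigzag_injective\<close>
      makes it a coboundary.\<close>
    have "of_inv (?r - sg 0 a * q) = 0" unfolding of_inv_diff_scale a q(5) by simp
    then have "negl (?r - sg 0 a * q)" by (simp add: negl_iff_of_inv)
    then have "bnd t (\<lambda>S. c S - sg 0 a * w S)"
      using zigzag_injective[OF co_diff_scale[OF c(1) w] zigzag_diff_scale[OF cz wz]]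
      unfolding bnd_def JJ_def by blast
    then have "x = h a" unfolding x h_def by (rule hclass_eqI)
    then show "x \<in> range h" by blast
  next
    fix x assume "x \<in> range h"
    then obtain a where x: "x = h a" by blast
    have "delta (\<lambda>S. sg 0 a * w S) T \<in> JJ t T" if T: "T \<subseteq> V" "card T = 4" for T
    proof -
      obtain g where "co 4 (int t) g" "delta (\<lambda>S. sg 0 a * w S) T = ev (g T)"
        using scaled[of a] T unfolding zigzag_def by blast
      then show ?thesis using coD[of 4 "int t" g T] T unfolding JJ_def by simp
    qed
    moreover have "wdeg \<mu> = 0" if "\<mu> \<in> ks (sg 0 a * w S)" for \<mu> S
      using that w_deg by (auto elim!: keys_timesE split: if_splits)
    ultimately show "x \<in> carrier (coh t)"
      unfolding x h_def coh_carrier using co_w by blast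
  qed
  moreover have "h a \<oplus>\<^bsub>coh t\<^esub> h b = h (a + b)" for a b
    unfolding h_def by (simp add: coh_add co_w single_add distrib_right)
  moreover have "\<zero>\<^bsub>coh t\<^esub> = h 0" by (simp add: h_def coh_zero)
  moreover have "a \<odot>\<^bsub>coh t\<^esub> h b = h (a * b)" for a b
    unfolding h_def coh_smult[OF co_w] by (simp add: mult.assoc[symmetric] mult_single)
  ultimately show ?thesis unfolding Let_def by (intro line_vectorspace)
qed

end
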